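(* Let $G$ be a finite group and let $A$ and $B$ be submodular subgroups of $G$ such that $G=AB$ and $A,B\in\mathfrak{C}$. Then the following statements hold. (1) If $(|G:AF(G)|,\,|G:BF(G)|)=1$, then $G\in\mathfrak{C}$. (2) If $G^{\mathcal{A}}$ is nilpotent, then $G\in\mathfrak{Z}$.
   Context: All groups are finite. $G=AB$ means $G=\{ab: a\in A,\ b\in B\}$; $F(G)$ is the Fitting subgroup of $G$; $(m,n)$ denotes the greatest common divisor. A subgroup $M$ of a group $G$ is modular in $G$ if it is a modular element of the subgroup lattice of $G$, i.e. $\langle X, M\cap Z\rangle=\langle X,M\rangle\cap Z$ for all subgroups $X\le Z\le G$, and $\langle M, Y\cap Z\rangle=\langle M,Y\rangle\cap Z$ for all subgroups $Y,Z\le G$ with $M\le Z$. A subgroup $H$ of $G$ is submodular in $G$ if there is a chain $H=H_0\le H_1\le\dots\le H_n=G$ such that $H_i$ is a modular subgroup of $H_{i+1}$ for every $i$. $\mathfrak{Z}$ is the class of all finite groups in which every Sylow subgroup is submodular. $\mathfrak{C}$ is the class of all finite groups in which every cyclic primary subgroup (cyclic subgroup of prime power order) is submodular. $\mathcal{A}$ is the formation of all finite groups with abelian Sylow subgroups, and $G^{\mathcal{A}}$ is the $\mathcal{A}$-residual of $G$, the smallest normal subgroup $N$ of $G$ with $G/N\in\mathcal{A}$. *)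

theory Defs
  imports "HOL-Algebra.Sylow" "HOL-Algebra.Elementary_Groups"
begin

section \<open>Modular and submodular subgroups\<close>

definition modular_subgroup :: "'a set \<Rightarrow> ('a, 'b) monoid_scheme \<Rightarrow> bool" where
  "modular_subgroup M G \<longleftrightarrow>
     subgroup M G \<and>
     (\<forall>X Z. subgroup X G \<longrightarrow> subgroup Z G \<longrightarrow> X \<subseteq> Z \<longrightarrow>
        generate G (X \<union> (M \<inter> Z)) = generate G (X \<union> M) \<inter> Z) \<and>
     (\<forall>Y Z. subgroup Y G \<longrightarrow> subgroup Z G \<longrightarrow> M \<subseteq> Z \<longrightarrow>
        generate G (M \<union> (Y \<inter> Z)) = generate G (M \<union> Y) \<inter> Z)"

definition submodular_subgroup :: "'a set \<Rightarrow> ('a, 'b) monoid_scheme \<Rightarrow> bool" where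
  "submodular_subgroup H G \<longleftrightarrow>
     (\<exists>(n :: nat) K.
        K 0 = H \<and> K n = carrier G \<and>
        (\<forall>i \<le> n. subgroup (K i) G) \<and>
        (\<forall>i < n. modular_subgroup (K i) (G\<lparr>carrier := K (Suc i)\<rparr>)))"


section \<open>Sylow subgroups and the classes of groups\<close>

text \<open>For a prime not dividing the order the Sylow subgroup is trivial; likewise
  the trivial subgroup counts as a cyclic primary subgroup. Both are harmless, since the trivial
  subgroup is abelian and modular.\<close>

definition sylow_subgroup :: "nat \<Rightarrow> 'a set \<Rightarrow> ('a, 'b) monoid_scheme \<Rightarrow> bool" where
  "sylow_subgroup p P G \<longleftrightarrow>
     prime p \<and> subgroup P G \<and> card P = p ^ multiplicity p (order G)"

definition cyclic_primary_subgroup :: "'a set \<Rightarrow> ('a, 'b) monoid_scheme \<Rightarrow> bool" where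
  "cyclic_primary_subgroup C G \<longleftrightarrow>
     subgroup C G \<and> cyclic_group (G\<lparr>carrier := C\<rparr>) \<and> (\<exists>p k. prime (p :: nat) \<and> card C = p ^ k)"

text \<open>The classes \<open>\<ZZ>\<close>, \<open>\<CC>\<close> and \<open>\<A>\<close>, in this order.\<close>

definition class_Z :: "('a, 'b) monoid_scheme \<Rightarrow> bool" where
  "class_Z G \<longleftrightarrow> group G \<and> finite (carrier G) \<and>
     (\<forall>p P. sylow_subgroup p P G \<longrightarrow> submodular_subgroup P G)"

definition class_C :: "('a, 'b) monoid_scheme \<Rightarrow> bool" where
  "class_C G \<longleftrightarrow> group G \<and> finite (carrier G) \<and>
     (\<forall>C. cyclic_primary_subgroup C G \<longrightarrow> submodular_subgroup C G)"

definition class_A :: "('a, 'b) monoid_scheme \<Rightarrow> bool" where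
  "class_A G \<longleftrightarrow> group G \<and> finite (carrier G) \<and>
     (\<forall>p P. sylow_subgroup p P G \<longrightarrow> comm_group (G\<lparr>carrier := P\<rparr>))"


section \<open>Nilpotent groups and the Fitting subgroup\<close>

definition commutator_subgroup :: "('a, 'b) monoid_scheme \<Rightarrow> 'a set \<Rightarrow> 'a set \<Rightarrow> 'a set" where
  "commutator_subgroup G H K =
     generate G {h \<otimes>\<^bsub>G\<^esub> k \<otimes>\<^bsub>G\<^esub> inv\<^bsub>G\<^esub> h \<otimes>\<^bsub>G\<^esub> inv\<^bsub>G\<^esub> k | h k. h \<in> H \<and> k \<in> K}"

primrec lower_central :: "('a, 'b) monoid_scheme \<Rightarrow> nat \<Rightarrow> 'a set" where
  "lower_central G 0 = carrier G"
| "lower_central G (Suc n) = commutator_subgroup G (lower_central G n) (carrier G)"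

definition nilpotent_group :: "('a, 'b) monoid_scheme \<Rightarrow> bool" where
  "nilpotent_group G \<longleftrightarrow> group G \<and> (\<exists>n. lower_central G n = {\<one>\<^bsub>G\<^esub>})"

definition fitting_subgroup :: "('a, 'b) monoid_scheme \<Rightarrow> 'a set" where
  "fitting_subgroup G = generate G (\<Union>{N. N \<lhd> G \<and> nilpotent_group (G\<lparr>carrier := N\<rparr>)})"


section \<open>The residual of the class \<open>\<A>\<close>\<close>

text \<open>The least element is taken with respect to inclusion; that it exists for finite groups is
  the content of \<open>A_residual_least\<close> below.\<close>

definition A_residual :: "('a, 'b) monoid_scheme \<Rightarrow> 'a set" where
  "A_residual G = (LEAST N. N \<lhd> G \<and> class_A (G Mod N))"

lemma sylow_subgroup_image:
  assumes "group_hom G K f" "finite (carrier G)" "f ` carrier G = carrier K"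
    and P: "sylow_subgroup p P G"
  shows "sylow_subgroup p (f ` P) K"
proof -
  interpret h: group_hom G K f by fact
  let ?N = "kernel G K f"
  have p: "prime p" and sP: "subgroup P G" and cP: "card P = p ^ multiplicity p (order G)"
    using P by (auto simp: sylow_subgroup_def)
  have finP: "finite P"
    using sP assms(2) by (meson finite_subset subgroup.subset)
  interpret hP: group_hom "G\<lparr>carrier := P\<rparr>" K f
    using sP h.group_hom_axioms h.homh h.G.subgroup_imp_group[OF sP] subgroup.subset[OF sP]
    by (auto simp: group_hom_def group_hom_axioms_def hom_def subset_iff)
  have kP: "kernel (G\<lparr>carrier := P\<rparr>) K f = ?N \<inter> P"
    using subgroup.subset[OF sP] by (auto simp: kernel_def)
  have fib: "order L = card (f ` carrier L) * card (kernel L K f)"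
    if "group_hom L K f" "finite (carrier L)" for L :: "('a, 'b) monoid_scheme"
  proof -
    interpret l: group_hom L K f by fact
    let ?K = "K\<lparr>carrier := f ` carrier L\<rparr>"
    have k: "kernel L ?K f = kernel L K f" by (auto simp: kernel_def)
    interpret l': group_hom L ?K f
      using l.img_is_subgroup h.H.subgroup_imp_group l.homh
      by (auto simp: group_hom_def group_hom_axioms_def hom_def)
    have "card (carrier (L Mod kernel L ?K f)) = card (carrier ?K)"
      using iso_same_card[OF l'.FactGroup_iso] by simp
    then have "card (rcosets\<^bsub>L\<^esub> kernel L K f) = card (f ` carrier L)"
      unfolding k by (simp add: FactGroup_def)
    moreover have "card (rcosets\<^bsub>L\<^esub> kernel L K f) * card (kernel L K f) = order L"
      using l.G.lagrange l.subgroup_kernel by blast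
    ultimately show ?thesis by simp
  qed
  have c1: "order G = order K * card ?N"
    using fib[OF assms(1,2)] assms(3) by (simp add: order_def)
  have c2: "card P = card (f ` P) * card (?N \<inter> P)"
    using fib[OF hP.group_hom_axioms] finP kP by (simp add: order_def)
  have sNP: "subgroup (?N \<inter> P) (G\<lparr>carrier := ?N\<rparr>)"
    using h.subgroup_kernel sP
    by (simp add: h.G.subgroups_Inter_pair h.G.subgroup_incl)
  have "group (G\<lparr>carrier := ?N\<rparr>)"
    using h.subgroup_kernel h.G.subgroup_imp_group by blast
  from group.lagrange[OF this sNP] obtain i where c3: "card ?N = i * card (?N \<inter> P)"
    unfolding order_def by (simp, metis)
  have ord0: "order G > 0" using assms(2) h.G.order_gt_0_iff_finite by blast
  obtain m where m: "order G = card P * m"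
    using h.G.lagrange[OF sP] by (metis mult.commute)
  have np: "\<not> p dvd m"
  proof
    assume "p dvd m"
    then have "p ^ Suc (multiplicity p (order G)) dvd order G"
      using m cP mult_dvd_mono[of p m "card P" "card P"] by (simp add: mult.commute)
    then show False
      using power_dvd_iff_le_multiplicity[of "order G" p] ord0 p
      by (metis Suc_n_not_le_n not_prime_unit less_irrefl)
  qed
  have NP0: "card (?N \<inter> P) > 0"
    using c2 cP p by (intro gr0I) (auto dest: prime_gt_0_nat)
  have c4: "order K * i = card (f ` P) * m"
  proof -
    have "card (?N \<inter> P) * (order K * i) = card (?N \<inter> P) * (card (f ` P) * m)"
      using c1 c2 c3 m by (metis mult.assoc mult.commute)
    then show ?thesis using NP0 by simp
  qed
  have sub: "subgroup (f ` P) K"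
    using h.subgroup_img_is_subgroup sP by blast
  obtain j where j: "order K = card (f ` P) * j"
    using h.H.lagrange[OF sub] by (metis mult.commute)
  have fP0: "card (f ` P) > 0"
    using c2 cP p by (intro gr0I) (auto dest: prime_gt_0_nat)
  have "j * i = m"
    using c4 j fP0 by (simp add: mult.assoc)
  then have npj: "\<not> p dvd j" using np by auto
  obtain b where b: "card (f ` P) = p ^ b"
    using c2 cP divides_primepow_nat[OF p] by (metis dvd_triv_left)
  have "multiplicity p (order K) = b"
    using j b npj p by (intro multiplicity_eqI) auto
  then show ?thesis
    using sub p b by (simp add: sylow_subgroup_def)
qed

lemma class_A_Int:
  fixes G :: "('a, 'b) monoid_scheme"
  assumes fin: "finite (carrier G)" and M: "M \<lhd> G" "class_A (G Mod M)"
    and N: "N \<lhd> G" "class_A (G Mod N)"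
  shows "M \<inter> N \<lhd> G \<and> class_A (G Mod (M \<inter> N))"
proof -
  let ?D = "M \<inter> N"
  interpret M: normal M G by fact
  interpret N: normal N G by fact
  have D: "?D \<lhd> G"
    using M(1) N(1) M.normal_subgroup_intersect by blast
  interpret D: normal ?D G by fact
  have epi: "group_hom (G Mod ?D) (G Mod L) ((<#>\<^bsub>G\<^esub>) L)"
            "(<#>\<^bsub>G\<^esub>) L ` carrier (G Mod ?D) = carrier (G Mod L)"
            "\<And>x. x \<in> carrier G \<Longrightarrow> L <#>\<^bsub>G\<^esub> (?D #>\<^bsub>G\<^esub> x) = L #>\<^bsub>G\<^esub> x"
    if L: "L \<lhd> G" "?D \<subseteq> L" for L
  proof -
    interpret L: normal L G by fact
    have LD: "L <#>\<^bsub>G\<^esub> ?D = L"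
    proof
      show "L <#>\<^bsub>G\<^esub> ?D \<subseteq> L"
        using L(2) by (auto simp: set_mult_def)
      show "L \<subseteq> L <#>\<^bsub>G\<^esub> ?D"
      proof
        fix x assume x: "x \<in> L"
        then have "x = x \<otimes>\<^bsub>G\<^esub> \<one>\<^bsub>G\<^esub>" by (simp add: L.mem_carrier)
        then show "x \<in> L <#>\<^bsub>G\<^esub> ?D"
          using x D.one_closed unfolding set_mult_def by blast
      qed
    qed
    show eq: "\<And>x. x \<in> carrier G \<Longrightarrow> L <#>\<^bsub>G\<^esub> (?D #>\<^bsub>G\<^esub> x) = L #>\<^bsub>G\<^esub> x"
      using M.setmult_rcos_assoc[OF L.subset D.subset] LD by simp
    show "(<#>\<^bsub>G\<^esub>) L ` carrier (G Mod ?D) = carrier (G Mod L)"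
      unfolding carrier_FactGroup image_image using eq by simp
    have "(<#>\<^bsub>G\<^esub>) L \<in> hom (G Mod ?D) (G Mod L)"
      by (auto simp: hom_def carrier_FactGroup eq D.rcos_sum L.rcos_sum)
    then show "group_hom (G Mod ?D) (G Mod L) ((<#>\<^bsub>G\<^esub>) L)"
      using D.factorgroup_is_group L.factorgroup_is_group
      by (simp add: group_hom_def group_hom_axioms_def)
  qed
  have finD: "finite (carrier (G Mod ?D))"
    using fin by (simp add: carrier_FactGroup)
  have "comm_group ((G Mod ?D)\<lparr>carrier := P\<rparr>)" if P: "sylow_subgroup p P (G Mod ?D)" for p P
  proof -
    interpret Q: group "G Mod ?D" by (rule D.factorgroup_is_group)
    have sP: "subgroup P (G Mod ?D)" using P by (simp add: sylow_subgroup_def)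
    have comm: "L <#>\<^bsub>G\<^esub> (X <#>\<^bsub>G\<^esub> Y) = L <#>\<^bsub>G\<^esub> (Y <#>\<^bsub>G\<^esub> X)"
      if L: "L \<lhd> G" "?D \<subseteq> L" "class_A (G Mod L)" and XY: "X \<in> P" "Y \<in> P" for L X Y
    proof -
      interpret h: group_hom "G Mod ?D" "G Mod L" "(<#>\<^bsub>G\<^esub>) L" by (rule epi(1)[OF L(1,2)])
      have "sylow_subgroup p ((<#>\<^bsub>G\<^esub>) L ` P) (G Mod L)"
        by (rule sylow_subgroup_image[OF epi(1)[OF L(1,2)] finD epi(2)[OF L(1,2)] P])
      then have "comm_group ((G Mod L)\<lparr>carrier := (<#>\<^bsub>G\<^esub>) L ` P\<rparr>)"
        using L(3) by (auto simp: class_A_def)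
      then have "(L <#>\<^bsub>G\<^esub> X) \<otimes>\<^bsub>G Mod L\<^esub> (L <#>\<^bsub>G\<^esub> Y) = (L <#>\<^bsub>G\<^esub> Y) \<otimes>\<^bsub>G Mod L\<^esub> (L <#>\<^bsub>G\<^esub> X)"
        using XY comm_monoid.m_comm[OF comm_group.axioms(1)] by fastforce
      then show ?thesis
        using h.hom_mult[of X Y] h.hom_mult[of Y X] XY subgroup.mem_carrier[OF sP] by simp
    qed
    have "X <#>\<^bsub>G\<^esub> Y = Y <#>\<^bsub>G\<^esub> X" if XY: "X \<in> P" "Y \<in> P" for X Y
    proof -
      have "X \<otimes>\<^bsub>G Mod ?D\<^esub> Y \<in> carrier (G Mod ?D)" "Y \<otimes>\<^bsub>G Mod ?D\<^esub> X \<in> carrier (G Mod ?D)"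
        using XY subgroup.mem_carrier[OF sP] by blast+
      then obtain x y where x: "x \<in> carrier G" "X <#>\<^bsub>G\<^esub> Y = ?D #>\<^bsub>G\<^esub> x"
        and y: "y \<in> carrier G" "Y <#>\<^bsub>G\<^esub> X = ?D #>\<^bsub>G\<^esub> y"
        by (auto simp: carrier_FactGroup)
      have "M #>\<^bsub>G\<^esub> x = M #>\<^bsub>G\<^esub> y"
        using comm[OF M(1) _ M(2) XY] epi(3)[OF M(1)] x y by simp
      moreover have "N #>\<^bsub>G\<^esub> x = N #>\<^bsub>G\<^esub> y"
        using comm[OF N(1) _ N(2) XY] epi(3)[OF N(1)] x y by simp
      ultimately have "x \<in> M #>\<^bsub>G\<^esub> y" "x \<in> N #>\<^bsub>G\<^esub> y"
        using x(1) M.rcos_self M.subgroup_axioms N.subgroup_axioms by metis+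
      then have "x \<otimes>\<^bsub>G\<^esub> inv\<^bsub>G\<^esub> y \<in> ?D"
        using M.rcos_module_imp[OF M.is_group y(1)] N.rcos_module_imp[OF M.is_group y(1)] by blast
      then have "x \<in> ?D #>\<^bsub>G\<^esub> y"
        using D.rcos_module_rev[OF M.is_group y(1) x(1)] by blast
      then show ?thesis
        using x y M.repr_independence[OF _ y(1) D.subgroup_axioms] by simp
    qed
    then show ?thesis
      using Q.subgroup_imp_group[OF sP]
      by (intro group.group_comm_groupI) auto
  qed
  then show ?thesis
    using D finD D.factorgroup_is_group by (auto simp: class_A_def)
qed

lemma A_residual_least:
  fixes G :: "('a, 'b) monoid_scheme"
  assumes "group G" and fin: "finite (carrier G)"
  shows "A_residual G \<lhd> G" and "class_A (G Mod A_residual G)"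
    and "\<And>N. N \<lhd> G \<Longrightarrow> class_A (G Mod N) \<Longrightarrow> A_residual G \<subseteq> N"
proof -
  interpret group G by fact
  let ?Q = "\<lambda>N. N \<lhd> G \<and> class_A (G Mod N)"
  have "carrier G \<lhd> G" by (rule normal_self)
  moreover have "class_A (G Mod carrier G)"
  proof -
    interpret n: normal "carrier G" G by fact
    interpret Q: group "G Mod carrier G" by (rule n.factorgroup_is_group)
    have car: "carrier (G Mod carrier G) = {carrier G}"
      using coset_join2[OF _ subgroup_self] one_closed by (auto simp: carrier_FactGroup image_iff)
    have "comm_group ((G Mod carrier G)\<lparr>carrier := P\<rparr>)" if "subgroup P (G Mod carrier G)" for P
      using Q.subgroup_imp_group[OF that] subgroup.subset[OF that] car
      by (intro group.group_comm_groupI) auto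
    then show ?thesis
      using Q.is_group car by (auto simp: class_A_def sylow_subgroup_def)
  qed
  ultimately have "?Q (carrier G)" by blast
  then obtain N where N: "?Q N" and min: "\<And>M. ?Q M \<Longrightarrow> card N \<le> card M"
    using exists_least_iff[of "\<lambda>k. \<exists>M. ?Q M \<and> card M = k"] by (metis not_less)
  have le: "N \<subseteq> M" if "?Q M" for M
  proof -
    have "?Q (M \<inter> N)" using class_A_Int[OF fin] that N by blast
    then have "card N \<le> card (M \<inter> N)" by (rule min)
    moreover have "finite N"
      using N fin by (meson finite_subset normal_imp_subgroup subgroup.subset)
    ultimately have "M \<inter> N = N" by (metis card_seteq Int_lower2)
    then show ?thesis by blast
  qed
  have "A_residual G = N"
    unfolding A_residual_def using N le by (intro Least_equality) auto
  then show "A_residual G \<lhd> G" "class_A (G Mod A_residual G)"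
    "\<And>N. N \<lhd> G \<Longrightarrow> class_A (G Mod N) \<Longrightarrow> A_residual G \<subseteq> N"
    using N le by auto
qed

end

theory Submission
  imports Defs "HOL-Algebra.Group_Action" "HOL-Algebra.Multiplicative_Group"
    "HOL-Number_Theory.Residue_Primitive_Roots"
begin

text \<open>
  Let \<open>p\<close> be the largest prime divisor of \<open>|G|\<close>. If \<open>M\<close> is modular in \<open>G\<close>, then \<open>O\<^sub>p(M) \<le> O\<^sub>p(G)\<close>:
  in a minimal counterexample the zipper lemma makes \<open>M\<close> the only maximal subgroup containing a
  given element of \<open>O\<^sub>p(M)\<close>, modularity then forces \<open>|M|\<close> to be \<open>p\<close> or \<open>pq\<close>, and
  counting conjugates gives a contradiction. So submodular \<open>p\<close>-elements lie in \<open>O\<^sub>p(G)\<close>, and if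
  they generate a Sylow \<open>p\<close>-subgroup \<open>P\<close> (as the \<open>p\<close>-elements of \<open>A\<close> and \<open>B\<close> do),
  then \<open>P\<close> is normal. Passing to \<open>G/P\<close> by induction, one has to show that a \<open>q\<close>-subgroup \<open>L\<close> is
  submodular in \<open>LP\<close>. Here \<open>x\<^sup>q\<close> centralizes \<open>P\<close> for every submodular \<open>q\<close>-element \<open>x\<close>, and
  \<open>x\<close> has an eigenvector on each invariant elementary abelian section of \<open>P\<close>. Hence if \<open>L\<close> acts on \<open>P\<close>
  as an abelian group generated by such elements, the chief factors are of order \<open>p\<close>, \<open>L\<close>
  induces on them a group of order 1 or \<open>q\<close>, and \<open>L\<close> is submodular in \<open>LP\<close>. For (1) the action is cyclic, as some Sylow
  \<open>q\<close>-subgroup lies in \<open>A F(G)\<close> or \<open>B F(G)\<close> and the \<open>q\<close>-elements of \<open>F(G)\<close> centralize \<open>P\<close>;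
  for (2) it is abelian because the residual is nilpotent.\<close>

section \<open>Conjugation and normalizers\<close>

text \<open>The largest prime \<open>p\<close> matters because it divides \<open>t - 1\<close> for
  no prime divisor \<open>t\<close> of the order, so that a \<open>p\<close>-element normalizing a
  subgroup of prime order centralizes it. This is how the maximality of \<open>p\<close> enters.
  Membership in the class of groups is not carried through the last induction. It is weakened to
  hypotheses that pass to quotients: for each prime some Sylow subgroup is generated by submodular
  elements, and there is a normal subgroup \<open>F\<close> whose primary elements lie in the
  corresponding cores. The Fitting subgroup serves as \<open>F\<close> for statement (1), the
  nilpotent residual for statement (2). The image of \<open>F\<close> has the same property,
  although the image of the Fitting subgroup need not be the Fitting subgroup of the quotient. An
  induction on the order cannot change the type of the elements, while cosets are sets of elements.
  Quotients are therefore copied onto representatives of the cosets, and the inductions run over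
  groups of type \<open>'a monoid\<close>.\<close>

definition cj :: "('a, 'b) monoid_scheme \<Rightarrow> 'a \<Rightarrow> 'a \<Rightarrow> 'a" where
  "cj G x y = x \<otimes>\<^bsub>G\<^esub> y \<otimes>\<^bsub>G\<^esub> inv\<^bsub>G\<^esub> x"

definition normalizes :: "('a, 'b) monoid_scheme \<Rightarrow> 'a set \<Rightarrow> 'a set \<Rightarrow> bool" where
  "normalizes G H N \<longleftrightarrow> (\<forall>h\<in>H. \<forall>n\<in>N. cj G h n \<in> N)"

definition prime_power_card :: "nat \<Rightarrow> 'a set \<Rightarrow> bool" where
  "prime_power_card p H \<longleftrightarrow> (\<exists>k. card H = p ^ k)"

text \<open>Equality of sets instead of inclusion makes this a subgroup without any finiteness
  assumption.\<close>

definition normr :: "('a, 'b) monoid_scheme \<Rightarrow> 'a set \<Rightarrow> 'a set" where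
  "normr G H = {g \<in> carrier G. cj G g ` H = H}"

locale fin_group = group G for G (structure) +
  assumes fin: "finite (carrier G)"

context group
begin

lemma inv_cancel [simp]:
  assumes "x \<in> carrier G" "y \<in> carrier G"
  shows "inv x \<otimes> (x \<otimes> y) = y" "x \<otimes> (inv x \<otimes> y) = y"
  using assms by (simp_all flip: m_assoc)

lemma cj_closed [simp]: "x \<in> carrier G \<Longrightarrow> y \<in> carrier G \<Longrightarrow> cj G x y \<in> carrier G"
  by (simp add: cj_def)

lemma cj_one [simp]: "y \<in> carrier G \<Longrightarrow> cj G \<one> y = y" "x \<in> carrier G \<Longrightarrow> cj G x \<one> = \<one>"
  by (simp_all add: cj_def)

lemma cj_mult:
  assumes "x \<in> carrier G" "y \<in> carrier G" "z \<in> carrier G"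
  shows "cj G x (y \<otimes> z) = cj G x y \<otimes> cj G x z" "cj G (x \<otimes> y) z = cj G x (cj G y z)"
  using assms by (simp_all add: cj_def m_assoc inv_mult_group)

lemma cj_inv:
  assumes "x \<in> carrier G" "y \<in> carrier G"
  shows "cj G x (inv y) = inv (cj G x y)"
  using assms by (simp add: cj_def m_assoc inv_mult_group)

lemma cj_cancel [simp]:
  assumes "x \<in> carrier G" "y \<in> carrier G"
  shows "cj G (inv x) (cj G x y) = y" "cj G x (cj G (inv x) y) = y"
  using assms by (simp_all flip: cj_mult)

lemma cj_pow:
  assumes "x \<in> carrier G" "y \<in> carrier G"
  shows "cj G x y [^] (n::nat) = cj G x (y [^] n)"
  by (induction n) (use assms in \<open>auto simp: cj_mult\<close>)

lemma cj_eq_iff: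
  assumes "x \<in> carrier G" "y \<in> carrier G" "z \<in> carrier G"
  shows "cj G x y = cj G x z \<longleftrightarrow> y = z"
  using assms by (metis cj_cancel(1))

lemma cj_inj: "x \<in> carrier G \<Longrightarrow> H \<subseteq> carrier G \<Longrightarrow> inj_on (cj G x) H"
  by (auto simp: inj_on_def cj_eq_iff subset_iff)

lemma cj_fix_iff:
  assumes "x \<in> carrier G" "y \<in> carrier G"
  shows "cj G x y = y \<longleftrightarrow> x \<otimes> y = y \<otimes> x"
  using assms by (metis cj_def inv_solve_right m_closed)

lemma cj_fix_sym:
  assumes "x \<in> carrier G" "y \<in> carrier G"
  shows "cj G x y = y \<longleftrightarrow> cj G y x = x"
  using assms by (auto simp: cj_fix_iff)

lemma cj_hom: "x \<in> carrier G \<Longrightarrow> group_hom G G (cj G x)"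
  by (unfold_locales) (auto simp: hom_def cj_mult)

lemma cj_subgroup: "x \<in> carrier G \<Longrightarrow> subgroup H G \<Longrightarrow> subgroup (cj G x ` H) G"
  using group_hom.subgroup_img_is_subgroup[OF cj_hom] by blast

lemma cj_card: "x \<in> carrier G \<Longrightarrow> H \<subseteq> carrier G \<Longrightarrow> card (cj G x ` H) = card H"
  by (simp add: card_image cj_inj)

lemma cj_image_comp:
  "x \<in> carrier G \<Longrightarrow> y \<in> carrier G \<Longrightarrow> H \<subseteq> carrier G \<Longrightarrow> cj G x ` cj G y ` H = cj G (x \<otimes> y) ` H"
  by (auto simp: cj_mult image_image subset_iff intro!: image_cong)

lemma cj_image_one: "H \<subseteq> carrier G \<Longrightarrow> cj G \<one> ` H = H"
  by (auto simp: subset_iff image_iff)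

lemma cj_image_cancel:
  assumes "x \<in> carrier G" "H \<subseteq> carrier G"
  shows "cj G (inv x) ` cj G x ` H = H" "cj G x ` cj G (inv x) ` H = H"
  using assms by (simp_all add: cj_image_comp cj_image_one)

lemma cj_image_iff:
  assumes "x \<in> carrier G" "y \<in> carrier G" "H \<subseteq> carrier G"
  shows "y \<in> cj G x ` H \<longleftrightarrow> cj G (inv x) y \<in> H"
proof
  assume "y \<in> cj G x ` H"
  then show "cj G (inv x) y \<in> H" using assms by auto
next
  assume "cj G (inv x) y \<in> H"
  then have "cj G x (cj G (inv x) y) \<in> cj G x ` H" by blast
  then show "y \<in> cj G x ` H" using assms by simp
qed

lemma cj_carrier_image: "x \<in> carrier G \<Longrightarrow> cj G x ` carrier G = carrier G"
  by (metis cj_closed cj_cancel(2) image_eqI inv_closed subsetI subset_antisym image_subsetI)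

lemma cj_consistent: "subgroup H G \<Longrightarrow> x \<in> H \<Longrightarrow> cj (G\<lparr>carrier := H\<rparr>) x y = cj G x y"
  by (simp add: cj_def)

lemma cj_self_image:
  assumes "subgroup H G" "x \<in> H"
  shows "cj G x ` H = H"
proof -
  interpret H: subgroup H G by fact
  have "cj G y ` H \<subseteq> H" if "y \<in> H" for y using that by (auto simp: cj_def)
  from this[of x] this[of "inv x"] assms(2) show ?thesis
    by (metis H.m_inv_closed H.mem_carrier H.subset cj_image_cancel(2) image_mono subset_antisym)
qed

lemma subgroup_subset_iff:
  assumes "subgroup L G"
  shows "subgroup H (G\<lparr>carrier := L\<rparr>) \<longleftrightarrow> subgroup H G \<and> H \<subseteq> L"
proof
  assume H: "subgroup H (G\<lparr>carrier := L\<rparr>)"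
  then show "subgroup H G \<and> H \<subseteq> L" 
    using incl_subgroup[OF assms H] subgroup.subset[OF H] by simp
qed (use subgroup_incl assms in blast)

text \<open>Conjugation is injective, so a finite set that is mapped into itself is mapped onto
  itself.\<close>

lemma normalizes_eq:
  assumes "finite N" "H \<subseteq> carrier G" "N \<subseteq> carrier G" "normalizes G H N" "h \<in> H"
  shows "cj G h ` N = N"
proof -
  have "cj G h ` N \<subseteq> N" using assms by (auto simp: normalizes_def)
  moreover have "card (cj G h ` N) = card N" using assms by (intro cj_card) auto
  ultimately show ?thesis using assms(1) by (simp add: card_subset_eq)
qed

lemma normr_subgroup:
  assumes "H \<subseteq> carrier G"
  shows "subgroup (normr G H) G"
proof (rule subgroupI)
  show "normr G H \<noteq> {}" using cj_image_one[OF assms] by (auto simp: normr_def)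
  fix a assume a: "a \<in> normr G H"
  then show "inv a \<in> normr G H" using cj_image_cancel(1)[of a H] assms by (auto simp: normr_def)
  fix b assume b: "b \<in> normr G H"
  then show "a \<otimes> b \<in> normr G H" using a assms by (auto simp: normr_def simp flip: cj_image_comp)
qed (auto simp: normr_def)

lemma normr_super: "subgroup H G \<Longrightarrow> H \<subseteq> normr G H"
  using cj_self_image subgroup.mem_carrier by (fastforce simp: normr_def)

lemma normr_cj:
  assumes "g \<in> carrier G" "H \<subseteq> carrier G"
  shows "normr G (cj G g ` H) = cj G g ` normr G H"
proof -
  have *: "cj G g ` normr G K \<subseteq> normr G (cj G g ` K)" if "g \<in> carrier G" "K \<subseteq> carrier G" for g K
  proof -
    have "cj G (cj G g x) ` cj G g ` K = cj G g ` cj G x ` K" if "x \<in> carrier G" for x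
      using that \<open>g \<in> carrier G\<close> \<open>K \<subseteq> carrier G\<close>
      by (simp add: cj_image_comp) (simp add: cj_def m_assoc)
    then show ?thesis using that(1) by (force simp: normr_def)
  qed
  have "cj G (inv g) ` normr G (cj G g ` H) \<subseteq> normr G H"
    using *[of "inv g" "cj G g ` H"] assms cj_closed
    by (metis cj_image_cancel(1) image_subset_iff inv_closed subsetD)
  then have "cj G g ` cj G (inv g) ` normr G (cj G g ` H) \<subseteq> cj G g ` normr G H" by blast
  then show ?thesis using *[of g H] assms
    by (simp add: cj_image_cancel normr_def)
qed

lemma normalizes_normr:
  assumes "K \<subseteq> carrier G" "\<And>x. x \<in> K \<Longrightarrow> cj G x ` H = H"
  shows "K \<subseteq> normr G H"
  using assms by (auto simp: normr_def)

lemma set_mult_subgroupI: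
  assumes H: "subgroup H G" and K: "subgroup K G" and n: "normalizes G H K"
  shows "subgroup (H <#> K) G"
proof (rule subgroupI)
  note [simp] = subgroup.mem_carrier[OF H] subgroup.mem_carrier[OF K]
  note [simp] = subgroup.m_closed[OF H] subgroup.m_closed[OF K] subgroup.m_inv_closed[OF H] subgroup.m_inv_closed[OF K]
  show "H <#> K \<subseteq> carrier G" by (auto simp: set_mult_def)
  show "H <#> K \<noteq> {}" using subgroup.one_closed[OF H] subgroup.one_closed[OF K] by (auto simp: set_mult_def)
  fix a assume a: "a \<in> H <#> K"
  then obtain h k where hk: "h \<in> H" "k \<in> K" "a = h \<otimes> k" by (auto simp: set_mult_def)
  have "inv a = inv h \<otimes> cj G h (inv k)" using hk by (simp add: cj_def inv_mult_group m_assoc)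
  moreover have "cj G h (inv k) \<in> K" using n hk by (auto simp: normalizes_def)
  ultimately show "inv a \<in> H <#> K" using hk by (auto simp: set_mult_def)
  fix b assume "b \<in> H <#> K"
  then obtain h' k' where hk': "h' \<in> H" "k' \<in> K" "b = h' \<otimes> k'" by (auto simp: set_mult_def)
  have "a \<otimes> b = (h \<otimes> h') \<otimes> (cj G (inv h') k \<otimes> k')" using hk hk' by (simp add: cj_def m_assoc)
  moreover have "cj G (inv h') k \<in> K" using n hk hk' by (auto simp: normalizes_def)
  moreover have "h \<otimes> h' \<in> H" "cj G (inv h') k \<otimes> k' \<in> K" using calculation(2) hk hk' by auto
  ultimately show "a \<otimes> b \<in> H <#> K" unfolding set_mult_def by blast
qed

lemma set_mult_contains:
  assumes "subgroup H G" "subgroup K G"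
  shows "H \<subseteq> H <#> K" "K \<subseteq> H <#> K"
proof -
  have "x \<otimes> \<one> \<in> H <#> K" if "x \<in> H" for x
    using that subgroup.one_closed[OF assms(2)] unfolding set_mult_def by blast
  then show "H \<subseteq> H <#> K" using subgroup.mem_carrier[OF assms(1)] by fastforce
  have "\<one> \<otimes> x \<in> H <#> K" if "x \<in> K" for x
    using that subgroup.one_closed[OF assms(1)] unfolding set_mult_def by blast
  then show "K \<subseteq> H <#> K" using subgroup.mem_carrier[OF assms(2)] by fastforce
qed

lemma set_multI: "h \<in> H \<Longrightarrow> k \<in> K \<Longrightarrow> h \<otimes> k \<in> H <#> K"
  by (auto simp: set_mult_def)

lemma set_mult_least: "subgroup Z G \<Longrightarrow> H \<subseteq> Z \<Longrightarrow> K \<subseteq> Z \<Longrightarrow> H <#> K \<subseteq> Z"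
  by (auto simp: set_mult_def intro: subgroup.m_closed)

lemma normal_iff_normalizes: "N \<lhd> G \<longleftrightarrow> subgroup N G \<and> normalizes G (carrier G) N"
  by (auto simp: normal_inv_iff normalizes_def cj_def)

lemma generate_subset: "S \<subseteq> carrier G \<Longrightarrow> S \<subseteq> generate G S"
  by (auto intro: generate.incl)

end

section \<open>Counting products, conjugates and fixed points\<close>

lemma card_by_fibres:
  assumes "finite S" "\<And>y. y \<in> f ` S \<Longrightarrow> card {x \<in> S. f x = y} = k"
  shows "card S = card (f ` S) * k"
  using sum.image_gen[OF assms(1), of "\<lambda>_. 1::nat" f] assms(2) by simp

context fin_group
begin

lemma sub_finite: "subgroup H G \<Longrightarrow> finite H"
  using fin finite_subset subgroup.subset by blast

lemma fin_group_sub: "subgroup H G \<Longrightarrow> fin_group (G\<lparr>carrier := H\<rparr>)"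
  by (simp add: fin_group.intro fin_group_axioms.intro sub_finite subgroup_imp_group)

lemma card_pos: "subgroup H G \<Longrightarrow> 0 < card H"
  using sub_finite subgroup.one_closed by (metis card_gt_0_iff empty_iff)

lemma card_dvd:
  assumes "subgroup H G" "subgroup K G" "H \<subseteq> K"
  shows "card H dvd card K"
proof -
  have "card (rcosets\<^bsub>G\<lparr>carrier := K\<rparr>\<^esub> H) * card H = card K"
    using group.lagrange[OF subgroup_imp_group[OF assms(2)] subgroup_incl[OF assms]]
    by (simp add: order_def)
  then show ?thesis by (metis dvd_triv_right)
qed

lemma card_dvd_order: "subgroup H G \<Longrightarrow> card H dvd order G"
  using card_dvd[OF _ subgroup_self] subgroup.subset by (auto simp: order_def)

text \<open>Multiplication maps the pairs from \<open>A\<close> and \<open>B\<close> onto the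
  product set; the fibre over \<open>a b\<close> consists of the pairs \<open>(a d, d^-1 b)\<close>
  with \<open>d\<close> in \<open>A \<inter> B\<close>.\<close>

lemma card_set_mult:
  assumes A: "subgroup A G" and B: "subgroup B G"
  shows "card (A <#> B) * card (A \<inter> B) = card A * card B"
proof -
  note [simp] = subgroup.mem_carrier[OF A] subgroup.mem_carrier[OF B]
  note [simp] = subgroup.m_closed[OF A] subgroup.m_closed[OF B] subgroup.m_inv_closed[OF A] subgroup.m_inv_closed[OF B]
  let ?f = "\<lambda>(a, b). a \<otimes> b"
  have "card {x \<in> A \<times> B. ?f x = y} = card (A \<inter> B)" if y: "y \<in> ?f ` (A \<times> B)" for y
  proof -
    obtain a b where ab: "a \<in> A" "b \<in> B" "y = a \<otimes> b" using y by auto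
    have "bij_betw (\<lambda>d. (a \<otimes> d, inv d \<otimes> b)) (A \<inter> B) {x \<in> A \<times> B. ?f x = y}"
    proof (rule bij_betw_byWitness[where f' = "\<lambda>x. inv a \<otimes> fst x"])
      show "(\<lambda>d. (a \<otimes> d, inv d \<otimes> b)) ` (A \<inter> B) \<subseteq> {x \<in> A \<times> B. ?f x = y}"
        using ab by (auto simp: m_assoc)
      have *: "inv a \<otimes> a' = b \<otimes> inv b'" "inv (inv a \<otimes> a') \<otimes> b = b'"
        if "a' \<in> A" "b' \<in> B" "a' \<otimes> b' = y" for a' b'
      proof -
        have "inv a \<otimes> a' = inv a \<otimes> (a' \<otimes> b') \<otimes> inv b'" using that(1,2) ab(1,2) by (simp add: m_assoc)
        also have "\<dots> = b \<otimes> inv b'" using that ab by simp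
        finally show 1: "inv a \<otimes> a' = b \<otimes> inv b'" .
        show "inv (inv a \<otimes> a') \<otimes> b = b'" unfolding 1 using that ab by (simp add: inv_mult_group m_assoc)
      qed
      show "(\<lambda>x. inv a \<otimes> fst x) ` {x \<in> A \<times> B. ?f x = y} \<subseteq> A \<inter> B"
      proof
        fix z assume "z \<in> (\<lambda>x. inv a \<otimes> fst x) ` {x \<in> A \<times> B. ?f x = y}"
        then obtain u where "u \<in> A \<times> B" "?f u = y" "z = inv a \<otimes> fst u" by blast
        then obtain a' b' where h: "a' \<in> A" "b' \<in> B" "a' \<otimes> b' = y" and z: "z = inv a \<otimes> a'"
          by (auto simp: mem_Times_iff split_beta)
        have "inv a \<otimes> a' \<in> A" using h ab by simp
        moreover have "inv a \<otimes> a' \<in> B" unfolding *(1)[OF h] using h ab by simp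
        ultimately show "z \<in> A \<inter> B" using z by blast
      qed
      show "\<forall>x\<in>{x \<in> A \<times> B. ?f x = y}. (a \<otimes> (inv a \<otimes> fst x), inv (inv a \<otimes> fst x) \<otimes> b) = x"
        using * ab by auto
    qed (use ab in auto)
    from bij_betw_same_card[OF this] show ?thesis by (rule sym)
  qed
  from card_by_fibres[OF _ this] have "card (A \<times> B) = card (?f ` (A \<times> B)) * card (A \<inter> B)"
    using sub_finite A B by blast
  moreover have "?f ` (A \<times> B) = A <#> B" by (auto simp: set_mult_def image_iff)
  ultimately show ?thesis by (simp add: card_cartesian_product)
qed

text \<open>Pairs \<open>(g, h)\<close> with \<open>h\<close> a nonidentity element of
  \<open>H\<close> are sent to the conjugate of \<open>h\<close> by \<open>g\<close>. Pairs with the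
  same value have first components in the same coset of the normalizer, so all fibres have its size.
  The product form avoids division.\<close>

lemma card_conjugates_of_TI:
  assumes H: "subgroup H G"
    and TI: "\<And>g. g \<in> carrier G \<Longrightarrow> g \<notin> normr G H \<Longrightarrow> cj G g ` H \<inter> H = {\<one>}"
  shows "card (\<Union>g\<in>carrier G. cj G g ` (H - {\<one>})) * card (normr G H) = order G * (card H - 1)"
proof -
  let ?S = "carrier G \<times> (H - {\<one>})"
  let ?f = "\<lambda>(g, h). cj G g h"
  have HG: "H \<subseteq> carrier G" using H subgroup.subset by blast
  have nG: "normr G H \<subseteq> carrier G" by (auto simp: normr_def)
  have "card {x \<in> ?S. ?f x = y} = card (normr G H)" if y: "y \<in> ?f ` ?S" for y
  proof -
    obtain g h where gh: "g \<in> carrier G" "h \<in> H" "h \<noteq> \<one>" "y = cj G g h" using y by auto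
    have hG: "h \<in> carrier G" using gh HG by blast
    have "bij_betw (\<lambda>n. (g \<otimes> n, cj G (inv n) h)) (normr G H) {x \<in> ?S. ?f x = y}"
    proof (rule bij_betw_byWitness[where f' = "\<lambda>x. inv g \<otimes> fst x"])
      have 1: "cj G (inv n) h \<in> H - {\<one>}" if "n \<in> normr G H" for n
      proof -
        have "inv n \<in> normr G H" by (rule subgroup.m_inv_closed[OF normr_subgroup[OF HG] that])
        then have "cj G (inv n) h \<in> H" using gh by (auto simp: normr_def)
        moreover have "cj G (inv n) h \<noteq> cj G (inv n) \<one>"
          using gh hG that nG cj_eq_iff[of "inv n" h \<one>] by auto
        ultimately show ?thesis using that nG by auto
      qed
      have 2: "cj G (g \<otimes> n) (cj G (inv n) h) = cj G g h" if "n \<in> normr G H" for n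
        using that nG gh hG by (subst cj_mult) (auto simp: subsetD)
      show "(\<lambda>n. (g \<otimes> n, cj G (inv n) h)) ` normr G H \<subseteq> {x \<in> ?S. ?f x = y}"
        using 1 2 gh nG by auto
      have 3: "inv g \<otimes> g' \<in> normr G H \<and> cj G (inv (inv g \<otimes> g')) h = h'"
        if "g' \<in> carrier G" "h' \<in> H" "h' \<noteq> \<one>" "cj G g' h' = y" for g' h'
      proof -
        have h'G: "h' \<in> carrier G" using that HG by blast
        have "cj G (inv g \<otimes> g') h' = h" using that gh h'G hG by (simp add: cj_mult)
        then have "h \<in> cj G (inv g \<otimes> g') ` H" using that by blast
        then have "inv g \<otimes> g' \<in> normr G H" using TI[of "inv g \<otimes> g'"] gh that by auto
        moreover have "cj G (inv (inv g \<otimes> g')) h = h'" 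
          using cj_cancel(1)[of "inv g \<otimes> g'" h'] \<open>cj G (inv g \<otimes> g') h' = h\<close> gh that h'G by simp
        ultimately show ?thesis by blast
      qed
      show "(\<lambda>x. inv g \<otimes> fst x) ` {x \<in> ?S. ?f x = y} \<subseteq> normr G H"
      proof
        fix z assume "z \<in> (\<lambda>x. inv g \<otimes> fst x) ` {x \<in> ?S. ?f x = y}"
        then obtain u where "u \<in> ?S" "?f u = y" "z = inv g \<otimes> fst u" by blast
        then show "z \<in> normr G H" using 3[of "fst u" "snd u"] by (simp add: mem_Times_iff split_beta)
      qed
      show "\<forall>x\<in>{x \<in> ?S. ?f x = y}. (g \<otimes> (inv g \<otimes> fst x), cj G (inv (inv g \<otimes> fst x)) h) = x"
        using 3 gh by auto
    qed (use gh nG in auto)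
    from bij_betw_same_card[OF this] show ?thesis by (rule sym)
  qed
  from card_by_fibres[OF _ this] have "card ?S = card (?f ` ?S) * card (normr G H)"
    using sub_finite H fin by blast
  moreover have "?f ` ?S = (\<Union>g\<in>carrier G. cj G g ` (H - {\<one>}))" by (auto simp: image_iff)
  moreover have "card (H - {\<one>}) = card H - 1" using subgroup.one_closed[OF H] by simp
  ultimately show ?thesis by (simp add: card_cartesian_product order_def)
qed

lemma prime_power_card_sub:
  assumes "subgroup H G" "subgroup K G" "H \<subseteq> K" "prime p" "prime_power_card p K"
  shows "prime_power_card p H"
  using card_dvd[OF assms(1-3)] assms(4,5) divides_primepow_nat unfolding prime_power_card_def by metis

text \<open>Orbits of a \<open>p\<close>-group have \<open>p\<close>-power length, so those that are
  not single points contribute a multiple of \<open>p\<close>. The action is an ordinary function,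
  which lets it be conjugation or multiplication of cosets.\<close>

lemma fixed_points_cong:
  assumes R: "subgroup R G" and p: "prime p" and pR: "prime_power_card p R"
    and E: "finite E"
    and cl: "\<And>g e. g \<in> R \<Longrightarrow> e \<in> E \<Longrightarrow> f g e \<in> E"
    and one: "\<And>e. e \<in> E \<Longrightarrow> f \<one> e = e"
    and mult: "\<And>g h e. g \<in> R \<Longrightarrow> h \<in> R \<Longrightarrow> e \<in> E \<Longrightarrow> f (g \<otimes> h) e = f g (f h e)"
  shows "[card E = card {e \<in> E. \<forall>g\<in>R. f g e = e}] (mod p)"
proof -
  let ?R = "G\<lparr>carrier := R\<rparr>"
  \<comment> \<open>Members of \<open>BijGroup E\<close> must be undefined outside \<open>E\<close>,
    hence the restriction.\<close>
  let ?f = "\<lambda>g. restrict (f g) E"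
  let ?F = "{e \<in> E. \<forall>g\<in>R. f g e = e}"
  have bij: "bij_betw (f g) E E" if g: "g \<in> R" for g
  proof (rule bij_betw_byWitness[where f' = "f (inv g)"])
    have g': "inv g \<in> R" "g \<in> carrier G" using g subgroup.m_inv_closed[OF R] subgroup.mem_carrier[OF R] by auto
    show "\<forall>a\<in>E. f (inv g) (f g a) = a" using mult[OF g'(1) g] one g' by auto
    show "\<forall>a\<in>E. f g (f (inv g) a) = a" using mult[OF g g'(1)] one g' by auto
    show "f g ` E \<subseteq> E" "f (inv g) ` E \<subseteq> E" using cl g g' by auto
  qed
  interpret A: group_action ?R E ?f
  proof (unfold group_action_def group_hom_def group_hom_axioms_def, intro conjI)
    show "group ?R" using R subgroup_imp_group by blast
    show "group (BijGroup E)" by (rule group_BijGroup)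
    have "?f g \<in> Bij E" if "g \<in> R" for g
      using bij[OF that] by (auto simp: Bij_def bij_betw_restrict_eq)
    then show "?f \<in> hom ?R (BijGroup E)"
      using mult cl by (auto simp: hom_def BijGroup_def compose_def restrict_def fun_eq_iff)
  qed
  have orb: "orbit ?R ?f e = {f g e | g. g \<in> R}" if "e \<in> E" for e
    using that by (auto simp: orbit_def)
  have fino: "finite (orbits ?R E ?f)" using E by (auto simp: orbits_def)
  let ?O = "{Ob \<in> orbits ?R E ?f. card Ob \<noteq> 1}"
  have sum: "card E = (\<Sum>Ob\<in>orbits ?R E ?f. card Ob)"
    using A.disjoint_sum[OF E, of "\<lambda>_. 1::nat"] by simp
  have "p dvd card Ob" if Ob: "Ob \<in> ?O" for Ob
  proof -
    obtain e where e: "e \<in> E" "Ob = orbit ?R ?f e" using Ob by (auto simp: orbits_def)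
    have "card Ob dvd order ?R" using A.orbit_stabilizer_theorem[OF e(1)] e(2) by (metis dvd_triv_left)
    then have "card Ob dvd card R" by (simp add: order_def)
    then show ?thesis using pR p Ob divides_primepow_nat[OF p]
      unfolding prime_power_card_def by (metis (mono_tags, lifting) dvd_power mem_Collect_eq power_0 zero_less_iff_neq_zero)
  qed
  then have d: "p dvd (\<Sum>Ob\<in>?O. card Ob)" by (rule dvd_sum)
  have "{Ob \<in> orbits ?R E ?f. card Ob = 1} = (\<lambda>e. {e}) ` ?F"
  proof (intro equalityI subsetI)
    fix Ob assume h: "Ob \<in> {Ob \<in> orbits ?R E ?f. card Ob = 1}"
    then obtain e where e: "e \<in> E" "Ob = {f g e | g. g \<in> R}" using orb by (auto simp: orbits_def)
    have "e \<in> Ob" using e one[of e] subgroup.one_closed[OF R] by force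
    moreover have "card Ob = 1" using h by simp
    ultimately have 1: "Ob = {e}" by (metis card_1_singletonE singletonD)
    then have "\<forall>g\<in>R. f g e = e" using e by blast
    then show "Ob \<in> (\<lambda>e. {e}) ` ?F" using e 1 by blast
  next
    fix Ob assume "Ob \<in> (\<lambda>e. {e}) ` ?F"
    then obtain e where e: "e \<in> E" "\<forall>g\<in>R. f g e = e" "Ob = {e}" by auto
    have "orbit ?R ?f e = {e}" using orb[OF e(1)] e(1,2) subgroup.one_closed[OF R] one[OF e(1)] by force
    then show "Ob \<in> {Ob \<in> orbits ?R E ?f. card Ob = 1}" using e by (auto simp: orbits_def)
  qed
  then have "card {Ob \<in> orbits ?R E ?f. card Ob = 1} = card ?F"
    by (simp add: card_image inj_on_def)
  moreover have "(\<Sum>Ob\<in>{Ob \<in> orbits ?R E ?f. card Ob = 1}. card Ob) = card {Ob \<in> orbits ?R E ?f. card Ob = 1}"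
    by simp
  moreover have "(\<Sum>Ob\<in>orbits ?R E ?f. card Ob) = (\<Sum>Ob\<in>{Ob \<in> orbits ?R E ?f. card Ob = 1}. card Ob) + (\<Sum>Ob\<in>?O. card Ob)"
    using fino by (subst sum.union_disjoint[symmetric]) (auto intro!: sum.cong)
  ultimately have "card E = card ?F + (\<Sum>Ob\<in>?O. card Ob)" using sum by simp
  moreover obtain k where "(\<Sum>Ob\<in>?O. card Ob) = p * k" using d by (rule dvdE)
  ultimately show ?thesis by (simp add: cong_def)
qed

end

section \<open>Primary elements and Sylow subgroups\<close>

text \<open>An equation between powers, rather than a condition on the order, passes at once to
  images and subgroups.\<close>

definition p_elem :: "('a, 'b) monoid_scheme \<Rightarrow> nat \<Rightarrow> 'a \<Rightarrow> bool" where
  "p_elem G p x \<longleftrightarrow> x \<in> carrier G \<and> (\<exists>k. x [^]\<^bsub>G\<^esub> (p ^ k) = \<one>\<^bsub>G\<^esub>)"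

context group
begin

lemma rcoset_eq_iff:
  assumes "subgroup S G" "x \<in> carrier G" "y \<in> carrier G"
  shows "S #> x = S #> y \<longleftrightarrow> x \<otimes> inv y \<in> S"
proof -
  interpret S: subgroup S G by fact
  show ?thesis
  proof
    assume "S #> x = S #> y"
    then have "x \<in> S #> y" using rcos_self[OF assms(2,1)] by simp
    then show "x \<otimes> inv y \<in> S" using S.rcos_module_imp[OF is_group assms(3)] by blast
  next
    assume "x \<otimes> inv y \<in> S"
    then have "x \<in> S #> y" using S.rcos_module_rev[OF is_group assms(3,2)] by blast
    then show "S #> x = S #> y" using repr_independence[OF _ assms(3,1)] by blast
  qed
qed

lemma p_elem_cj: "p_elem G p x \<Longrightarrow> g \<in> carrier G \<Longrightarrow> p_elem G p (cj G g x)"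
  unfolding p_elem_def by (metis cj_closed cj_one(2) cj_pow)

lemma p_elem_pow: "p_elem G p x \<Longrightarrow> p_elem G p (x [^] (n::nat))"
  by (auto simp: p_elem_def nat_pow_pow mult.commute[of n]) (metis nat_pow_pow nat_pow_one)

lemma ord_dvd_coprime_one:
  assumes x: "x \<in> carrier G" and "x [^] (m::nat) = \<one>" "x [^] (n::nat) = \<one>" "coprime m n"
  shows "x = \<one>"
proof -
  have "ord x dvd m" "ord x dvd n" using assms pow_eq_id by blast+
  then have "ord x = 1" using \<open>coprime m n\<close> by (metis coprime_common_divisor_nat)
  then show ?thesis using ord_eq_1 x by blast
qed

lemma p_elem_disjoint:
  assumes "p_elem G p x" "p_elem G q x" "prime p" "prime q" "p \<noteq> q"
  shows "x = \<one>"
  using assms ord_dvd_coprime_one unfolding p_elem_def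
  by (metis coprime_power_left_iff coprime_power_right_iff primes_coprime)

lemma p_elem_coprime:
  assumes "p_elem G p x" "x [^] (m::nat) = \<one>" "prime p" "\<not> p dvd m"
  shows "x = \<one>"
  using assms ord_dvd_coprime_one unfolding p_elem_def
  by (metis coprime_power_left_iff prime_imp_coprime)

lemma p_elem_consistent:
  "subgroup H G \<Longrightarrow> x \<in> H \<Longrightarrow> p_elem (G\<lparr>carrier := H\<rparr>) p x \<longleftrightarrow> p_elem G p x"
  by (auto simp: p_elem_def nat_pow_consistent[symmetric] dest: subgroup.mem_carrier)

end

context fin_group
begin

lemma pow_card_one: "subgroup H G \<Longrightarrow> x \<in> H \<Longrightarrow> x [^] card H = \<one>"
  using group.pow_order_eq_1[OF subgroup_imp_group, of H x]
  by (simp add: order_def sub_finite nat_pow_consistent[symmetric])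

lemma p_elem_in: "subgroup H G \<Longrightarrow> prime_power_card p H \<Longrightarrow> x \<in> H \<Longrightarrow> p_elem G p x"
  using pow_card_one subgroup.mem_carrier by (fastforce simp: p_elem_def prime_power_card_def)

lemma p_elem_iff:
  assumes "prime p" "x \<in> carrier G"
  shows "p_elem G p x \<longleftrightarrow> prime_power_card p (generate G {x})"
proof
  assume "p_elem G p x"
  then obtain k where "x [^] (p ^ k) = \<one>" by (auto simp: p_elem_def)
  then have "ord x dvd p ^ k" using assms pow_eq_id by blast
  then show "prime_power_card p (generate G {x})"
    using generate_pow_card[OF assms(2)] divides_primepow_nat[OF assms(1)]
    unfolding prime_power_card_def by metis
next
  assume "prime_power_card p (generate G {x})"
  then show "p_elem G p x"
    using p_elem_in[OF generate_is_subgroup[of "{x}"]] assms generate.incl[of x "{x}" G] by blast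
qed

lemma cauchy:
  assumes H: "subgroup H G" and p: "prime p" "p dvd card H"
  obtains x where "x \<in> H" "x \<noteq> \<one>" "x [^] p = \<one>" "card (generate G {x}) = p"
proof -
  interpret H: fin_group "G\<lparr>carrier := H\<rparr>" using fin_group_sub[OF H] .
  \<comment> \<open>Sylow's theorem \<open>sylow_thm\<close> concerns any power of \<open>p\<close>
    dividing the order; exponent 1 gives Cauchy's theorem.\<close>
  obtain m where "order (G\<lparr>carrier := H\<rparr>) = p ^ 1 * m" using p(2) by (auto simp: order_def)
  then obtain K where K: "subgroup K (G\<lparr>carrier := H\<rparr>)" "card K = p ^ 1"
    using sylow_thm[OF p(1) H.is_group _ H.fin] by metis
  then have KG: "subgroup K G" "K \<subseteq> H" using subgroup_subset_iff[OF H] by auto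
  have "card K > 1" using K(2) p(1) prime_gt_1_nat by simp
  then have "K \<noteq> {\<one>}" by auto
  then obtain x where x: "x \<in> K" "x \<noteq> \<one>" using subgroup.one_closed[OF KG(1)] by blast
  have xG: "x \<in> carrier G" using x KG subgroup.mem_carrier by metis
  have xp: "x [^] p = \<one>" using pow_card_one[OF KG(1) x(1)] K(2) by simp
  have "ord x dvd p" using xp xG pow_eq_id by blast
  then have "ord x = p" using p(1) x(2) ord_eq_1[OF xG] prime_nat_iff by blast
  then have "card (generate G {x}) = p" using generate_pow_card[OF xG] by simp
  moreover have "x \<in> H" using x KG by blast
  ultimately show ?thesis using that[of x] x(2) xp by simp
qed

lemma prime_power_cardI:
  assumes H: "subgroup H G" and p: "prime p" and "\<And>x. x \<in> H \<Longrightarrow> p_elem G p x"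
  shows "prime_power_card p H"
proof -
  have "q = p" if q: "prime q" "q dvd card H" for q
  proof (rule ccontr)
    assume "q \<noteq> p"
    obtain x where "x \<in> H" "x \<noteq> \<one>" "x [^] q = \<one>" using cauchy[OF H q] by blast
    then show False using p_elem_coprime[of p x q] assms(3) p q(1) \<open>q \<noteq> p\<close> primes_dvd_imp_eq by blast
  qed
  moreover obtain m where m: "card H = p ^ multiplicity p (card H) * m" "\<not> p dvd m"
    using multiplicity_decompose'[of "card H" p] card_pos[OF H] p not_prime_unit
    by (metis less_irrefl)
  ultimately have "m = 1" using prime_factor_nat[of m] by (metis dvd_mult)
  then have "card H = p ^ multiplicity p (card H)" using m by simp
  then show ?thesis unfolding prime_power_card_def by blast
qed

text \<open>\<open>R\<close> acts on the right cosets of \<open>S\<close> by right multiplication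
  with inverses, and the coset of \<open>x\<close> is fixed exactly when \<open>x\<close> conjugates
  \<open>R\<close> into \<open>S\<close>. This count serves both for the conjugacy of Sylow
  subgroups and for the growth of normalizers in \<open>p\<close>-groups.\<close>

lemma coset_fixed_points:
  assumes R: "subgroup R G" and S: "subgroup S G" and p: "prime p" "prime_power_card p R"
  shows "[card (rcosets S) = card {C \<in> rcosets S. \<exists>x\<in>carrier G. C = S #> x \<and> (\<forall>r\<in>R. cj G x r \<in> S)}] (mod p)"
proof -
  let ?f = "\<lambda>r C. C #> inv r"
  have SG: "S \<subseteq> carrier G" using S subgroup.subset by blast
  have RG: "r \<in> carrier G" if "r \<in> R" for r using R subgroup.mem_carrier that by metis
  have act: "?f r (S #> x) = S #> (x \<otimes> inv r)" if "x \<in> carrier G" "r \<in> R" for r x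
    using that RG SG by (simp add: coset_mult_assoc)
  have fix_iff: "?f r (S #> x) = S #> x \<longleftrightarrow> cj G x r \<in> S" if x: "x \<in> carrier G" and r: "r \<in> R" for r x
  proof -
    have "?f r (S #> x) = S #> x \<longleftrightarrow> S #> x = S #> (x \<otimes> inv r)" using act x r by auto
    also have "\<dots> \<longleftrightarrow> cj G x r \<in> S"
      using rcoset_eq_iff[OF S x, of "x \<otimes> inv r"] x RG[OF r] by (simp add: cj_def inv_mult_group m_assoc)
    finally show ?thesis .
  qed
  have "[card (rcosets S) = card {C \<in> rcosets S. \<forall>r\<in>R. ?f r C = C}] (mod p)"
  proof (rule fixed_points_cong[OF R p])
    show "finite (rcosets S)" using fin by (simp add: RCOSETS_def)
    show "?f g e \<in> rcosets S" if "g \<in> R" "e \<in> rcosets S" for g e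
      using that act RG SG by (auto simp: RCOSETS_def)
    show "?f \<one> e = e" if "e \<in> rcosets S" for e
      using that SG by (auto simp: RCOSETS_def coset_mult_assoc)
    show "?f (g \<otimes> h) e = ?f g (?f h e)" if "g \<in> R" "h \<in> R" "e \<in> rcosets S" for g h e
      using that SG RG by (auto simp: RCOSETS_def coset_mult_assoc inv_mult_group m_assoc)
  qed
  moreover have "{C \<in> rcosets S. \<forall>r\<in>R. ?f r C = C}
      = {C \<in> rcosets S. \<exists>x\<in>carrier G. C = S #> x \<and> (\<forall>r\<in>R. cj G x r \<in> S)}"
    using fix_iff by (fastforce simp: RCOSETS_def)
  ultimately show ?thesis by simp
qed

text \<open>The index of a Sylow subgroup is prime to \<open>p\<close>, so \<open>R\<close> fixes
  one of its cosets.\<close>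

lemma sylow_contains:
  assumes R: "subgroup R G" "prime_power_card p R" and S: "sylow_subgroup p S G"
  obtains g where "g \<in> carrier G" "R \<subseteq> cj G g ` S"
proof -
  have p: "prime p" and sS: "subgroup S G" and cS: "card S = p ^ multiplicity p (order G)"
    using S by (auto simp: sylow_subgroup_def)
  have l: "card (rcosets S) * card S = order G" using lagrange[OF sS] .
  have "order G \<noteq> 0" using fin order_gt_0_iff_finite by simp
  then have "\<not> p dvd card (rcosets S)"
    using l cS p multiplicity_dvd'[of "Suc (multiplicity p (order G))" p "order G"]
    by (metis Suc_n_not_le_n mult.commute mult_dvd_mono dvd_refl not_prime_unit power_Suc power_dvd_iff_le_multiplicity)
  then have "card {C \<in> rcosets S. \<exists>x\<in>carrier G. C = S #> x \<and> (\<forall>r\<in>R. cj G x r \<in> S)} \<noteq> 0"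
    using coset_fixed_points[OF R(1) sS p R(2)] by (metis cong_0_iff)
  then have "{C \<in> rcosets S. \<exists>x\<in>carrier G. C = S #> x \<and> (\<forall>r\<in>R. cj G x r \<in> S)} \<noteq> {}"
    by (metis card.empty)
  then obtain x where x: "x \<in> carrier G" "\<forall>r\<in>R. cj G x r \<in> S" by blast
  have "R \<subseteq> cj G (inv x) ` S"
    using x cj_image_iff[of "inv x"] subgroup.mem_carrier[OF R(1)] subgroup.subset[OF sS] by auto
  then show ?thesis using that x by blast
qed

text \<open>Let \<open>T\<close> act on its own cosets in \<open>P\<close>. Their number is a
  multiple of \<open>p\<close> and the coset \<open>T\<close> is fixed, so a second coset is fixed,
  and its representative normalizes \<open>T\<close>.\<close>

lemma normalizer_grows:
  assumes P: "subgroup P G" "prime p" "prime_power_card p P" and T: "subgroup T G" "T \<subset> P"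
  obtains g where "g \<in> P" "g \<notin> T" "cj G g ` T = T"
proof -
  interpret P: fin_group "G\<lparr>carrier := P\<rparr>" using fin_group_sub[OF P(1)] .
  have sT: "subgroup T (G\<lparr>carrier := P\<rparr>)" using subgroup_incl[OF T(1) P(1)] T(2) by blast
  let ?C = "{C \<in> rcosets\<^bsub>G\<lparr>carrier := P\<rparr>\<^esub> T. \<exists>x\<in>P. C = T #> x \<and> (\<forall>r\<in>T. cj G x r \<in> T)}"
  have TP: "prime_power_card p T" using prime_power_card_sub T P by blast
  have l: "card (rcosets\<^bsub>G\<lparr>carrier := P\<rparr>\<^esub> T) * card T = card P"
    using P.lagrange[OF sT] by (simp add: order_def)
  have "card T < card P" using T(2) sub_finite[OF P(1)] by (simp add: psubset_card_mono)
  then have n1: "card (rcosets\<^bsub>G\<lparr>carrier := P\<rparr>\<^esub> T) \<noteq> 1" using l by auto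
  obtain n where "card P = p ^ n" using P(3) prime_power_card_def by blast
  then obtain m where "card (rcosets\<^bsub>G\<lparr>carrier := P\<rparr>\<^esub> T) = p ^ m"
    using l divides_primepow_nat[OF P(2)] by (metis dvd_triv_left)
  then have pd: "p dvd card (rcosets\<^bsub>G\<lparr>carrier := P\<rparr>\<^esub> T)" using n1 by (cases m) auto
  have "[card (rcosets\<^bsub>G\<lparr>carrier := P\<rparr>\<^esub> T) = card ?C] (mod p)"
    using P.coset_fixed_points[OF sT sT P(2) TP] by (simp add: cj_consistent[OF P(1)] cong: conj_cong bex_cong)
  then have "p dvd card ?C" using pd by (simp add: cong_def dvd_eq_mod_eq_0)
  have "T \<in> ?C"
  proof -
    have "T #> \<one> = T" using T subgroup.subset by (simp add: subgroup.subset)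
    moreover have "\<one> \<in> P" using subgroup.one_closed[OF P(1)] .
    moreover have "\<forall>r\<in>T. cj G \<one> r \<in> T" using subgroup.mem_carrier[OF T(1)] by simp
    moreover have "T #> \<one> \<in> rcosets\<^bsub>G\<lparr>carrier := P\<rparr>\<^esub> T" using calculation(2) by (auto simp: RCOSETS_def)
    ultimately show ?thesis by fastforce
  qed
  moreover have "finite ?C" using sub_finite[OF P(1)] by (simp add: RCOSETS_def)
  ultimately have "card ?C \<noteq> 0" by auto
  then have "card ?C \<noteq> 1" using \<open>p dvd card ?C\<close> P(2) by auto
  then have "\<exists>C\<in>?C. C \<noteq> T" using \<open>T \<in> ?C\<close> by (metis (no_types, lifting) card_1_singleton_iff is_singletonI is_singletonI' is_singleton_def One_nat_def empty_iff)
  then obtain x where x: "x \<in> P" "T #> x \<noteq> T" "\<forall>r\<in>T. cj G x r \<in> T" by blast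
  have xG: "x \<in> carrier G" using x P(1) subgroup.mem_carrier by metis
  have "x \<notin> T" using x(2) xG T(1) coset_join2 by blast
  moreover have "cj G x ` T = T"
    using x xG sub_finite[OF T(1)] subgroup.subset[OF T(1)] 
    by (intro normalizes_eq[of T "{x}"]) (auto simp: normalizes_def)
  ultimately show ?thesis using that x by blast
qed

text \<open>Under conjugation by \<open>P\<close> the number of fixed points in \<open>N\<close> is
  a multiple of \<open>p\<close>, and it is positive because of the identity.\<close>

lemma fixed_element:
  assumes P: "subgroup P G" "prime p" "prime_power_card p P" 
    and N: "subgroup N G" "prime_power_card p N" "N \<noteq> {\<one>}" "normalizes G P N"
  obtains z where "z \<in> N" "z \<noteq> \<one>" "\<And>g. g \<in> P \<Longrightarrow> cj G g z = z"
proof -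
  let ?C = "{z \<in> N. \<forall>g\<in>P. cj G g z = z}"
  note PG = subgroup.mem_carrier[OF P(1)] and NG = subgroup.mem_carrier[OF N(1)]
  have "[card N = card ?C] (mod p)"
    using P N(4) PG NG sub_finite[OF N(1)]
    by (intro fixed_points_cong[where f = "cj G"]) (auto simp: normalizes_def cj_mult)
  moreover have "p dvd card N"
  proof -
    obtain k where "card N = p ^ k" using N(2) prime_power_card_def by blast
    moreover have "card N \<noteq> 1" using N(3) subgroup.one_closed[OF N(1)] by (metis card_1_singletonE singletonD)
    ultimately show ?thesis by (cases k) auto
  qed
  ultimately have "p dvd card ?C" by (simp add: cong_def dvd_eq_mod_eq_0)
  moreover have "\<one> \<in> ?C" using subgroup.one_closed[OF N(1)] PG by simp
  moreover have "finite ?C" using sub_finite[OF N(1)] by simp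
  ultimately have "card ?C \<noteq> 1" using P(2) by auto
  then have "\<exists>z\<in>?C. z \<noteq> \<one>" using \<open>\<one> \<in> ?C\<close> by (metis (no_types, lifting) card_1_singleton_iff is_singletonI' is_singleton_def One_nat_def empty_iff)
  then show ?thesis using that by blast
qed

end

section \<open>Modular and submodular subgroups under homomorphisms and restriction\<close>

context group
begin

lemma generate_mono_sub: "subgroup Z G \<Longrightarrow> S \<subseteq> Z \<Longrightarrow> generate G S \<subseteq> Z"
  using generate_subgroup_incl by blast

lemma generate_id: "subgroup Z G \<Longrightarrow> generate G Z = Z"
  using generateI[of Z Z] by blast

lemma subgroup_Int: "subgroup H G \<Longrightarrow> subgroup K G \<Longrightarrow> subgroup (H \<inter> K) G"
  using subgroups_Inter_pair by blast

text \<open>Joins formed in \<open>L\<close> agree with joins formed in \<open>G\<close>, so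
  modularity in \<open>L\<close> can be handled with \<open>generate G\<close> and subgroups of
  \<open>G\<close> below \<open>L\<close>.\<close>

lemma modular_sub_iff:
  assumes L: "subgroup L G"
  shows "modular_subgroup M (G\<lparr>carrier := L\<rparr>) \<longleftrightarrow> subgroup M G \<and> M \<subseteq> L \<and>
    (\<forall>X Z. subgroup X G \<longrightarrow> subgroup Z G \<longrightarrow> X \<subseteq> Z \<longrightarrow> Z \<subseteq> L \<longrightarrow>
        generate G (X \<union> (M \<inter> Z)) = generate G (X \<union> M) \<inter> Z) \<and>
    (\<forall>Y Z. subgroup Y G \<longrightarrow> subgroup Z G \<longrightarrow> M \<subseteq> Z \<longrightarrow> Y \<subseteq> L \<longrightarrow> Z \<subseteq> L \<longrightarrow>
        generate G (M \<union> (Y \<inter> Z)) = generate G (M \<union> Y) \<inter> Z)"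
proof (cases "subgroup M G \<and> M \<subseteq> L")
  case True
  have g: "generate (G\<lparr>carrier := L\<rparr>) S = generate G S" if "S \<subseteq> L" for S
    using generate_consistent[OF that L] .
  have 1: "generate (G\<lparr>carrier := L\<rparr>) (X \<union> (M \<inter> Z)) = generate G (X \<union> (M \<inter> Z))"
    "generate (G\<lparr>carrier := L\<rparr>) (X \<union> M) = generate G (X \<union> M)"
    if "X \<subseteq> L" for X Z by (rule g, use that True in blast)+
  have 2: "generate (G\<lparr>carrier := L\<rparr>) (M \<union> (Y \<inter> Z)) = generate G (M \<union> (Y \<inter> Z))"
    "generate (G\<lparr>carrier := L\<rparr>) (M \<union> Y) = generate G (M \<union> Y)"
    if "Y \<subseteq> L" for Y Z by (rule g, use that True in blast)+
  show ?thesis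
    unfolding modular_subgroup_def subgroup_subset_iff[OF L] using 1 2 True
    by (smt (verit, ccfv_threshold) subset_trans)
qed (auto simp: modular_subgroup_def subgroup_subset_iff[OF L])

lemma modular_sub_subset:
  assumes "modular_subgroup M (G\<lparr>carrier := L\<rparr>)" "subgroup L G"
  shows "subgroup M G" "M \<subseteq> L"
  using assms(1) unfolding modular_sub_iff[OF assms(2)] by simp_all

lemma modular_law1:
  assumes "modular_subgroup M G" "subgroup X G" "subgroup Z G" "X \<subseteq> Z"
  shows "generate G (X \<union> (M \<inter> Z)) = generate G (X \<union> M) \<inter> Z"
  using assms by (auto simp: modular_subgroup_def)

lemma modular_law2:
  assumes "modular_subgroup M G" "subgroup Y G" "subgroup Z G" "M \<subseteq> Z"
  shows "generate G (M \<union> (Y \<inter> Z)) = generate G (M \<union> Y) \<inter> Z"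
  using assms by (auto simp: modular_subgroup_def)

lemma modular_restrict:
  assumes M: "modular_subgroup M G" and L: "subgroup L G"
  shows "modular_subgroup (M \<inter> L) (G\<lparr>carrier := L\<rparr>)"
proof -
  have sM: "subgroup M G" using M by (auto simp: modular_subgroup_def)
  have sML: "subgroup (M \<inter> L) G" using sM L subgroup_Int by blast
  have lawL: "generate G (X \<union> (M \<inter> L)) = generate G (X \<union> M) \<inter> L"
    if "subgroup X G" "X \<subseteq> L" for X using modular_law1[OF M that(1) L that(2)] .
  have "generate G (X \<union> (M \<inter> L \<inter> Z)) = generate G (X \<union> (M \<inter> L)) \<inter> Z"
    if X: "subgroup X G" and Z: "subgroup Z G" and XZ: "X \<subseteq> Z" "Z \<subseteq> L" for X Z
  proof -
    have "generate G (X \<union> (M \<inter> L \<inter> Z)) = generate G (X \<union> (M \<inter> Z))"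
      using XZ(2) by (metis inf.absorb_iff2 inf_assoc)
    also have "\<dots> = generate G (X \<union> M) \<inter> Z" using modular_law1[OF M X Z XZ(1)] .
    also have "\<dots> = generate G (X \<union> (M \<inter> L)) \<inter> Z" using lawL[OF X] XZ by blast
    finally show ?thesis .
  qed
  moreover have "generate G (M \<inter> L \<union> (Y \<inter> Z)) = generate G (M \<inter> L \<union> Y) \<inter> Z"
    if Y: "subgroup Y G" and Z: "subgroup Z G" and h: "M \<inter> L \<subseteq> Z" "Y \<subseteq> L" "Z \<subseteq> L" for Y Z
  proof -
    \<comment> \<open>The second law requires a subgroup containing all of \<open>M\<close>, which
      \<open>Z\<close> need not do. It is enlarged by \<open>M\<close>, and \<open>lawL\<close>
      shows that this adds nothing inside \<open>L\<close>.\<close>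
    let ?Z = "generate G (Z \<union> M)"
    have sub: "Z \<union> M \<subseteq> carrier G" using Z sM subgroup.subset by blast
    have sZ: "subgroup ?Z G" using generate_is_subgroup[OF sub] .
    have MZ: "M \<subseteq> ?Z" "Z \<subseteq> ?Z" using generate_subset[OF sub] by blast+
    have "?Z \<inter> L = generate G (Z \<union> (M \<inter> L))" using lawL[OF Z h(3)] by simp
    also have "Z \<union> (M \<inter> L) = Z" using h by blast
    also have "generate G Z = Z" using generate_id[OF Z] .
    finally have ZL: "?Z \<inter> L = Z" .
    have YZ: "Y \<inter> ?Z = Y \<inter> Z" using ZL h by blast
    have l2: "generate G (M \<union> (Y \<inter> Z)) = generate G (M \<union> Y) \<inter> ?Z"
      using modular_law2[OF M Y sZ MZ(1)] YZ by simp
    have "generate G (M \<inter> L \<union> (Y \<inter> Z)) = generate G ((Y \<inter> Z) \<union> M) \<inter> L"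
      using lawL[OF subgroup_Int[OF Y Z]] h by (simp add: Un_commute le_infI1)
    also have "\<dots> = generate G (M \<union> Y) \<inter> ?Z \<inter> L" using l2 by (simp add: Un_commute)
    also have "\<dots> = generate G (M \<union> Y) \<inter> L \<inter> Z" using ZL MZ(2) h by blast
    also have "\<dots> = generate G (M \<inter> L \<union> Y) \<inter> Z" using lawL[OF Y h(2)] by (simp add: Un_commute)
    finally show ?thesis .
  qed
  ultimately show ?thesis using sML by (auto simp: modular_sub_iff[OF L])
qed

text \<open>The condition leaves no subgroup strictly between \<open>M\<close> and \<open>G\<close>,
  so the second law only concerns \<open>Z = M\<close> and \<open>Z = G\<close>. In the first law
  either \<open>X\<close> lies in \<open>M\<close>, or \<open>X\<close> and
  \<open>M \<inter> Z\<close> already generate \<open>Z\<close>.\<close>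

lemma modular_by_maximality:
  assumes M: "subgroup M G"
    and max: "\<And>V Z. subgroup V G \<Longrightarrow> subgroup Z G \<Longrightarrow> V \<subseteq> Z \<Longrightarrow> \<not> V \<subseteq> M \<Longrightarrow> M \<inter> Z \<subseteq> V \<Longrightarrow> V = Z"
  shows "modular_subgroup M G"
proof -
  have MG: "M \<subseteq> carrier G" using M subgroup.subset by blast
  have "generate G (X \<union> (M \<inter> Z)) = generate G (X \<union> M) \<inter> Z"
    if X: "subgroup X G" and Z: "subgroup Z G" and XZ: "X \<subseteq> Z" for X Z
  proof -
    have sub: "X \<union> (M \<inter> Z) \<subseteq> carrier G" using X MG subgroup.subset by blast
    show ?thesis
    proof (cases "X \<subseteq> M")
      case True
      then have "X \<union> (M \<inter> Z) = M \<inter> Z" "X \<union> M = M" using XZ by auto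
      then show ?thesis using generate_id subgroup_Int[OF M Z] M by simp
    next
      case False
      have "generate G (X \<union> (M \<inter> Z)) = Z"
      proof (rule max[OF generate_is_subgroup[OF sub] Z])
        show "generate G (X \<union> (M \<inter> Z)) \<subseteq> Z" using generate_mono_sub[OF Z] XZ by simp
      qed (use generate_subset[OF sub] False in auto)
      moreover have "generate G (X \<union> (M \<inter> Z)) \<subseteq> generate G (X \<union> M)" by (rule mono_generate) blast
      ultimately show ?thesis by blast
    qed
  qed
  moreover have "generate G (M \<union> (Y \<inter> Z)) = generate G (M \<union> Y) \<inter> Z"
    if Y: "subgroup Y G" and Z: "subgroup Z G" and MZ: "M \<subseteq> Z" for Y Z
  proof (cases "Z \<subseteq> M")
    case True
    then have "Z = M" using MZ by blast
    moreover have "M \<union> (Y \<inter> M) = M" by blast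
    moreover have "M \<subseteq> generate G (M \<union> Y)" by (auto intro: generate.incl)
    ultimately show ?thesis using generate_id[OF M] by auto
  next
    case False
    have "Z = carrier G"
      by (rule max[OF Z subgroup_self]) (use False MZ subgroup.subset[OF Z] in auto)
    moreover have "generate G (M \<union> Y) \<subseteq> carrier G" using MG Y by (intro generate_incl) (auto dest: subgroup.subset)
    moreover have "Y \<inter> carrier G = Y" using subgroup.subset[OF Y] by blast
    ultimately show ?thesis by auto
  qed
  ultimately show ?thesis using M by (simp add: modular_subgroup_def)
qed

lemma generate_normal_Un:
  assumes X: "subgroup X G" and N: "N \<lhd> G"
  shows "generate G (X \<union> N) = X <#> N"
proof -
  have sN: "subgroup N G" and nN: "normalizes G X N"
    using N subgroup.subset[OF X] by (auto simp: normal_iff_normalizes normalizes_def)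
  show ?thesis
  proof (rule generateI[symmetric])
    show "subgroup (X <#> N) G" using set_mult_subgroupI[OF X sN nN] .
    show "X \<union> N \<subseteq> X <#> N" using set_mult_contains[OF X sN] by blast
    show "X <#> N \<subseteq> K" if "subgroup K G" "X \<union> N \<subseteq> K" for K using set_mult_least[of K X N] that by blast
  qed
qed

text \<open>Joins with a normal subgroup are products, and for products both laws are Dedekind's
  law.\<close>

lemma normal_modular:
  assumes N: "N \<lhd> G"
  shows "modular_subgroup N G"
proof -
  have sN: "subgroup N G" using N normal_imp_subgroup by blast
  have NG: "N \<subseteq> carrier G" using subgroup.subset[OF sN] .
  have "generate G (X \<union> (N \<inter> Z)) = generate G (X \<union> N) \<inter> Z"
    if X: "subgroup X G" and Z: "subgroup Z G" and XZ: "X \<subseteq> Z" for X Z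
  proof
    have "generate G (X \<union> (N \<inter> Z)) \<subseteq> Z" using generate_mono_sub[OF Z] XZ by simp
    moreover have "generate G (X \<union> (N \<inter> Z)) \<subseteq> generate G (X \<union> N)" by (rule mono_generate) blast
    ultimately show "generate G (X \<union> (N \<inter> Z)) \<subseteq> generate G (X \<union> N) \<inter> Z" by blast
    show "generate G (X \<union> N) \<inter> Z \<subseteq> generate G (X \<union> (N \<inter> Z))"
    proof
      fix z assume z: "z \<in> generate G (X \<union> N) \<inter> Z"
      then obtain x n where xn: "x \<in> X" "n \<in> N" "z = x \<otimes> n"
        unfolding generate_normal_Un[OF X N] by (auto simp: set_mult_def)
      have c: "x \<in> carrier G" "n \<in> carrier G" using xn NG subgroup.mem_carrier[OF X] by auto
      have "inv x \<otimes> z \<in> Z" using z xn XZ subgroup.m_closed[OF Z] subgroup.m_inv_closed[OF Z] by blast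
      then have "n \<in> Z" using xn c by simp
      then show "z \<in> generate G (X \<union> (N \<inter> Z))" using xn by (auto intro: generate.intros)
    qed
  qed
  moreover have "generate G (N \<union> (Y \<inter> Z)) = generate G (N \<union> Y) \<inter> Z"
    if Y: "subgroup Y G" and Z: "subgroup Z G" and NZ: "N \<subseteq> Z" for Y Z
  proof
    have "generate G (N \<union> (Y \<inter> Z)) \<subseteq> Z" using generate_mono_sub[OF Z] NZ by simp
    moreover have "generate G (N \<union> (Y \<inter> Z)) \<subseteq> generate G (N \<union> Y)" by (rule mono_generate) blast
    ultimately show "generate G (N \<union> (Y \<inter> Z)) \<subseteq> generate G (N \<union> Y) \<inter> Z" by blast
    show "generate G (N \<union> Y) \<inter> Z \<subseteq> generate G (N \<union> (Y \<inter> Z))"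
    proof
      fix z assume z: "z \<in> generate G (N \<union> Y) \<inter> Z"
      then obtain x n where xn: "x \<in> Y" "n \<in> N" "z = x \<otimes> n"
        using generate_normal_Un[OF Y N] by (auto simp: set_mult_def Un_commute)
      have c: "x \<in> carrier G" "n \<in> carrier G" using xn NG subgroup.mem_carrier[OF Y] by auto
      have "z \<otimes> inv n \<in> Z" using z xn NZ subgroup.m_closed[OF Z] subgroup.m_inv_closed[OF Z] by blast
      then have "x \<in> Z" using xn c by (simp add: m_assoc)
      then show "z \<in> generate G (N \<union> (Y \<inter> Z))" using xn by (auto intro: generate.intros)
    qed
  qed
  ultimately show ?thesis using sN by (simp add: modular_subgroup_def)
qed

end

section \<open>Modularity under images and preimages\<close>

context group_hom
begin

lemma preimage_subgroup:
  assumes "subgroup X H"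
  shows "subgroup {x \<in> carrier G. h x \<in> X} G"
proof (rule G.subgroupI)
  show "{x \<in> carrier G. h x \<in> X} \<noteq> {}" using subgroup.one_closed[OF assms] hom_one by (metis (mono_tags, lifting) G.one_closed empty_iff mem_Collect_eq)
qed (auto simp: subgroup.m_inv_closed[OF assms] subgroup.m_closed[OF assms])

lemma image_preimage:
  assumes "h ` carrier G = carrier H" "X \<subseteq> carrier H"
  shows "h ` {x \<in> carrier G. h x \<in> X} = X"
proof
  show "X \<subseteq> h ` {x \<in> carrier G. h x \<in> X}"
  proof
    fix y assume y: "y \<in> X"
    then obtain x where "x \<in> carrier G" "y = h x" using assms by (metis imageE subsetD)
    then show "y \<in> h ` {x \<in> carrier G. h x \<in> X}" using y by blast
  qed
qed blast

lemma image_generate: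
  assumes "S \<subseteq> carrier G"
  shows "h ` generate G S = generate H (h ` S)"
  using generate_img[OF assms] by simp

text \<open>Subgroups of the image are replaced by their full preimages: intersecting with a full
  preimage commutes with taking images, which fails for intersections in general.\<close>

lemma modular_image:
  assumes sur: "h ` carrier G = carrier H" and M: "modular_subgroup M G"
  shows "modular_subgroup (h ` M) H"
proof -
  let ?p = "\<lambda>X. {x \<in> carrier G. h x \<in> X}"
  have sM: "subgroup M G" using M by (auto simp: modular_subgroup_def)
  have MG: "M \<subseteq> carrier G" using subgroup.subset[OF sM] .
  have sp: "subgroup (?p X) G" if "subgroup X H" for X
    using preimage_subgroup[OF that] .
  have hp: "h ` ?p X = X" if "subgroup X H" for X
    using image_preimage[OF sur subgroup.subset[OF that]] .
  have int: "h ` (S \<inter> ?p Z) = h ` S \<inter> Z" if "S \<subseteq> carrier G" for S Z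
    using that by auto
  have "generate H (X \<union> (h ` M \<inter> Z)) = generate H (X \<union> h ` M) \<inter> Z"
    if X: "subgroup X H" and Z: "subgroup Z H" and XZ: "X \<subseteq> Z" for X Z
  proof -
    have "generate G (?p X \<union> (M \<inter> ?p Z)) = generate G (?p X \<union> M) \<inter> ?p Z"
      using G.modular_law1[OF M sp[OF X] sp[OF Z]] XZ by blast
    then have "h ` generate G (?p X \<union> (M \<inter> ?p Z)) = h ` (generate G (?p X \<union> M) \<inter> ?p Z)" by simp
    moreover have "h ` generate G (?p X \<union> (M \<inter> ?p Z)) = generate H (X \<union> (h ` M \<inter> Z))"
      using MG by (subst image_generate) (auto simp only: image_Un hp[OF X] int[OF MG])
    moreover have "h ` (generate G (?p X \<union> M) \<inter> ?p Z) = generate H (X \<union> h ` M) \<inter> Z"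
    proof -
      have c: "?p X \<union> M \<subseteq> carrier G" using MG by blast
      show ?thesis unfolding int[OF G.generate_incl[OF c]] image_generate[OF c] image_Un hp[OF X] ..
    qed
    ultimately show ?thesis by simp
  qed
  moreover have "generate H (h ` M \<union> (Y \<inter> Z)) = generate H (h ` M \<union> Y) \<inter> Z"
    if Y: "subgroup Y H" and Z: "subgroup Z H" and MZ: "h ` M \<subseteq> Z" for Y Z
  proof -
    have "generate G (M \<union> (?p Y \<inter> ?p Z)) = generate G (M \<union> ?p Y) \<inter> ?p Z"
      using G.modular_law2[OF M sp[OF Y] sp[OF Z]] MZ MG by blast
    then have "h ` generate G (M \<union> (?p Y \<inter> ?p Z)) = h ` (generate G (M \<union> ?p Y) \<inter> ?p Z)" by simp
    moreover have "h ` generate G (M \<union> (?p Y \<inter> ?p Z)) = generate H (h ` M \<union> (Y \<inter> Z))"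
    proof -
      have "h ` (?p Y \<inter> ?p Z) = Y \<inter> Z" using int[of "?p Y" Z] hp[OF Y] by auto
      then show ?thesis using MG by (subst image_generate) (auto simp only: image_Un)
    qed
    moreover have "h ` (generate G (M \<union> ?p Y) \<inter> ?p Z) = generate H (h ` M \<union> Y) \<inter> Z"
    proof -
      have c: "M \<union> ?p Y \<subseteq> carrier G" using MG by blast
      show ?thesis unfolding int[OF G.generate_incl[OF c]] image_generate[OF c] image_Un hp[OF Y] ..
    qed
    ultimately show ?thesis by simp
  qed
  moreover have "subgroup (h ` M) H" using sM subgroup_img_is_subgroup by blast
  ultimately show ?thesis by (simp add: modular_subgroup_def)
qed

text \<open>The laws in \<open>H\<close> produce an element with the right image. It differs from
  the wanted one by an element of the kernel, and the kernel lies in the preimage of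
  \<open>M\<close>.\<close>

lemma modular_preimage:
  assumes sur: "h ` carrier G = carrier H" and M: "modular_subgroup M H"
  shows "modular_subgroup {x \<in> carrier G. h x \<in> M} G"
proof -
  let ?M = "{x \<in> carrier G. h x \<in> M}"
  have sM: "subgroup M H" using M by (auto simp: modular_subgroup_def)
  have sM': "subgroup ?M G"
    using preimage_subgroup[OF sM] .
  have hM: "h ` ?M = M"
    using image_preimage[OF sur subgroup.subset[OF sM]] .
  have hMi: "h ` (?M \<inter> S) = M \<inter> h ` S" if "S \<subseteq> carrier G" for S
    using that by auto
  have kM: "inv x \<otimes> y \<in> ?M" "y \<otimes> inv x \<in> ?M"
    if "x \<in> carrier G" "y \<in> carrier G" "h x = h y" for x y
    using that subgroup.one_closed[OF sM] by auto
  have 1: "generate G (X \<union> (?M \<inter> Z)) = generate G (X \<union> ?M) \<inter> Z"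
    if X: "subgroup X G" and Z: "subgroup Z G" and XZ: "X \<subseteq> Z" for X Z
  proof
    have XG: "X \<subseteq> carrier G" and ZG: "Z \<subseteq> carrier G" using X Z subgroup.subset by auto
    have "generate G (X \<union> (?M \<inter> Z)) \<subseteq> Z" using G.generate_mono_sub[OF Z] XZ by simp
    moreover have "generate G (X \<union> (?M \<inter> Z)) \<subseteq> generate G (X \<union> ?M)" by (rule G.mono_generate) blast
    ultimately show "generate G (X \<union> (?M \<inter> Z)) \<subseteq> generate G (X \<union> ?M) \<inter> Z" by blast
    show "generate G (X \<union> ?M) \<inter> Z \<subseteq> generate G (X \<union> (?M \<inter> Z))"
    proof
      fix z assume z: "z \<in> generate G (X \<union> ?M) \<inter> Z"
      have "h z \<in> h ` generate G (X \<union> ?M)" using z by blast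
      also have "\<dots> = generate H (h ` X \<union> M)" using XG by (subst image_generate) (auto simp only: image_Un hM)
      finally have "h z \<in> generate H (h ` X \<union> M) \<inter> h ` Z" using z by blast
      also have "\<dots> = generate H (h ` X \<union> (M \<inter> h ` Z))"
        using H.modular_law1[OF M] X Z XZ subgroup_img_is_subgroup by blast
      also have "\<dots> = h ` generate G (X \<union> (?M \<inter> Z))"
        using XG ZG by (subst image_generate) (auto simp only: image_Un hMi)
      finally obtain w where w: "w \<in> generate G (X \<union> (?M \<inter> Z))" "h z = h w" by blast
      have wZ: "w \<in> Z" using w(1) G.generate_mono_sub[OF Z, of "X \<union> (?M \<inter> Z)"] XZ by blast
      have c: "w \<in> carrier G" "z \<in> carrier G" using wZ z ZG by auto
      have "inv w \<otimes> z \<in> ?M" using kM c w(2) by metis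
      moreover have "inv w \<otimes> z \<in> Z" using wZ z subgroup.m_closed[OF Z] subgroup.m_inv_closed[OF Z] by blast
      ultimately have "w \<otimes> (inv w \<otimes> z) \<in> generate G (X \<union> (?M \<inter> Z))"
        by (intro generate.eng[OF w(1) generate.incl]) blast
      then show "z \<in> generate G (X \<union> (?M \<inter> Z))" using c by simp
    qed
  qed
  have 2: "generate G (?M \<union> (Y \<inter> Z)) = generate G (?M \<union> Y) \<inter> Z"
    if Y: "subgroup Y G" and Z: "subgroup Z G" and MZ: "?M \<subseteq> Z" for Y Z
  proof
    have YG: "Y \<subseteq> carrier G" and ZG: "Z \<subseteq> carrier G" using Y Z subgroup.subset by auto
    have "generate G (?M \<union> (Y \<inter> Z)) \<subseteq> Z" using G.generate_mono_sub[OF Z] MZ by simp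
    moreover have "generate G (?M \<union> (Y \<inter> Z)) \<subseteq> generate G (?M \<union> Y)" by (rule G.mono_generate) blast
    ultimately show "generate G (?M \<union> (Y \<inter> Z)) \<subseteq> generate G (?M \<union> Y) \<inter> Z" by blast
    have hYZ: "h ` (Y \<inter> Z) = h ` Y \<inter> h ` Z"
    proof
      show "h ` Y \<inter> h ` Z \<subseteq> h ` (Y \<inter> Z)"
      proof
        fix u assume "u \<in> h ` Y \<inter> h ` Z"
        then obtain y z where yz: "y \<in> Y" "z \<in> Z" "u = h y" "u = h z" by blast
        have c: "y \<in> carrier G" "z \<in> carrier G" using yz YG ZG by auto
        have "inv z \<otimes> y \<in> Z" using kM(1)[OF c(2,1)] yz MZ by auto
        then have "z \<otimes> (inv z \<otimes> y) \<in> Z" using yz subgroup.m_closed[OF Z] by blast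
        then have "y \<in> Z" using c by simp
        then show "u \<in> h ` (Y \<inter> Z)" using yz by blast
      qed
    qed blast
    show "generate G (?M \<union> Y) \<inter> Z \<subseteq> generate G (?M \<union> (Y \<inter> Z))"
    proof
      fix z assume z: "z \<in> generate G (?M \<union> Y) \<inter> Z"
      have "h z \<in> h ` generate G (?M \<union> Y)" using z by blast
      also have "\<dots> = generate H (M \<union> h ` Y)" using YG by (subst image_generate) (auto simp only: image_Un hM)
      finally have "h z \<in> generate H (M \<union> h ` Y) \<inter> h ` Z" using z by blast
      also have "\<dots> = generate H (M \<union> (h ` Y \<inter> h ` Z))"
      proof (rule H.modular_law2[OF M, symmetric])
        show "M \<subseteq> h ` Z" using hM MZ by blast
      qed (use Y Z subgroup_img_is_subgroup in blast)+
      also have "\<dots> = h ` generate G (?M \<union> (Y \<inter> Z))"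
        using YG ZG by (subst image_generate) (auto simp only: image_Un hM hYZ)
      finally obtain w where w: "w \<in> generate G (?M \<union> (Y \<inter> Z))" "h z = h w" by blast
      have wZ: "w \<in> Z" using w(1) G.generate_mono_sub[OF Z, of "?M \<union> (Y \<inter> Z)"] MZ by blast
      have c: "w \<in> carrier G" "z \<in> carrier G" using wZ z ZG by auto
      have "inv w \<otimes> z \<in> ?M" using kM c w(2) by metis
      then have "w \<otimes> (inv w \<otimes> z) \<in> generate G (?M \<union> (Y \<inter> Z))"
        by (intro generate.eng[OF w(1) generate.incl]) blast
      then show "z \<in> generate G (?M \<union> (Y \<inter> Z))" using c by simp
    qed
  qed
  show ?thesis using 1 2 sM' by (simp add: modular_subgroup_def)
qed

lemma restrict_hom:
  assumes "subgroup L G" "subgroup L' H" "h ` L \<subseteq> L'"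
  shows "group_hom (G\<lparr>carrier := L\<rparr>) (H\<lparr>carrier := L'\<rparr>) h"
  using assms G.subgroup_imp_group H.subgroup_imp_group subgroup.mem_carrier[OF assms(1)]
  by (auto simp: group_hom_def group_hom_axioms_def hom_def)

end

section \<open>Chains of modular subgroups\<close>

context group
begin

lemma submodular_self: "submodular_subgroup (carrier G) G"
  unfolding submodular_subgroup_def
  by (rule exI[of _ 0], rule exI[of _ "\<lambda>_. carrier G"]) (auto simp: subgroup_self)

lemma submodular_subgroup_subgroup: "submodular_subgroup H G \<Longrightarrow> subgroup H G"
  by (auto simp: submodular_subgroup_def)

text \<open>Induction climbs the chain from \<open>H\<close> to the whole group.\<close>

lemma submodular_induct [consumes 1, case_names base step]:
  assumes "submodular_subgroup H G" "P H"
    and "\<And>M K. subgroup M G \<Longrightarrow> subgroup K G \<Longrightarrow> H \<subseteq> M \<Longrightarrow> M \<subseteq> K \<Longrightarrow> modular_subgroup M (G\<lparr>carrier := K\<rparr>) \<Longrightarrow> P M \<Longrightarrow> P K"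
  shows "P (carrier G)"
proof -
  obtain n K where K: "K 0 = H" "K n = carrier G" "\<forall>i\<le>n. subgroup (K i) G"
    "\<forall>i<n. modular_subgroup (K i) (G\<lparr>carrier := K (Suc i)\<rparr>)"
    using assms(1) unfolding submodular_subgroup_def by blast
  have "i \<le> n \<Longrightarrow> H \<subseteq> K i \<and> P (K i)" for i
  proof (induction i)
    case (Suc i)
    have m: "modular_subgroup (K i) (G\<lparr>carrier := K (Suc i)\<rparr>)" using K Suc by simp
    then have "K i \<subseteq> K (Suc i)" using modular_sub_subset(2) K(3) Suc.prems by simp
    then show ?case using Suc K(3) m assms(3)[of "K i" "K (Suc i)"] by auto
  qed (use K assms(2) in auto)
  then show ?thesis using K(2) by force
qed

lemma submodular_step:
  assumes H: "submodular_subgroup H (G\<lparr>carrier := M\<rparr>)" and M: "modular_subgroup M (G\<lparr>carrier := L\<rparr>)" and L: "subgroup L G"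
  shows "submodular_subgroup H (G\<lparr>carrier := L\<rparr>)"
proof -
  have sM: "subgroup M G" "M \<subseteq> L" using modular_sub_subset[OF M L] by auto
  obtain n K where K: "K 0 = H" "K n = M" "\<forall>i\<le>n. subgroup (K i) (G\<lparr>carrier := M\<rparr>)"
    "\<forall>i<n. modular_subgroup (K i) (G\<lparr>carrier := K (Suc i)\<rparr>)"
    using H unfolding submodular_subgroup_def by auto
  show ?thesis unfolding submodular_subgroup_def
  proof (intro exI[of _ "Suc n"] exI[of _ "\<lambda>i. if i \<le> n then K i else L"] conjI allI impI)
    fix i assume "i \<le> Suc n"
    then show "subgroup (if i \<le> n then K i else L) (G\<lparr>carrier := L\<rparr>)"
      using K(3) sM L subgroup_subset_iff by auto
  next
    fix i assume "i < Suc n"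
    then show "modular_subgroup (if i \<le> n then K i else L) (G\<lparr>carrier := L, carrier := (if Suc i \<le> n then K (Suc i) else L)\<rparr>)"
      using K M by (cases "i = n") auto
  qed (use K in auto)
qed

lemma submodular_trans:
  assumes H: "submodular_subgroup H (G\<lparr>carrier := L\<rparr>)" and L: "submodular_subgroup L G"
  shows "submodular_subgroup H G"
proof -
  have "submodular_subgroup H (G\<lparr>carrier := carrier G\<rparr>)"
    using L
  proof (induction rule: submodular_induct)
    case base show ?case by (rule H)
  next
    case (step M K)
    show ?case by (rule submodular_step[OF step(6,5,2)])
  qed
  then show ?thesis by simp
qed

lemma modular_submodular: "modular_subgroup H G \<Longrightarrow> submodular_subgroup H G"
  using submodular_step[of H H "carrier G"] group.submodular_self[OF subgroup_imp_group, of H] subgroup_self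
  by (auto simp: modular_subgroup_def)

lemma submodular_restrict:
  assumes "submodular_subgroup H G" and L: "subgroup L G"
  shows "submodular_subgroup (H \<inter> L) (G\<lparr>carrier := L\<rparr>)"
proof -
  obtain n K where K: "K 0 = H" "K n = carrier G" "\<forall>i\<le>n. subgroup (K i) G"
    "\<forall>i<n. modular_subgroup (K i) (G\<lparr>carrier := K (Suc i)\<rparr>)"
    using assms(1) unfolding submodular_subgroup_def by blast
  show ?thesis unfolding submodular_subgroup_def
  proof (intro exI[of _ n] exI[of _ "\<lambda>i. K i \<inter> L"] conjI allI impI)
    fix i assume "i \<le> n"
    then show "subgroup (K i \<inter> L) (G\<lparr>carrier := L\<rparr>)"
      using K(3) L subgroup_subset_iff subgroup_Int by auto
  next
    fix i assume i: "i < n"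
    then have s: "subgroup (K i) G" "subgroup (K (Suc i)) G" using K(3) by auto
    have m: "modular_subgroup (K i) (G\<lparr>carrier := K (Suc i)\<rparr>)" using K i by blast
    then have sub: "K i \<subseteq> K (Suc i)" using modular_sub_subset(2) s(2) by simp
    have "modular_subgroup (K i \<inter> (K (Suc i) \<inter> L)) (G\<lparr>carrier := K (Suc i), carrier := K (Suc i) \<inter> L\<rparr>)"
      using group.modular_restrict[OF subgroup_imp_group[OF s(2)] m, of "K (Suc i) \<inter> L"]
        subgroup_subset_iff[OF s(2)] subgroup_Int[OF s(2) L] by auto
    moreover have "K i \<inter> (K (Suc i) \<inter> L) = K i \<inter> L" using sub by blast
    ultimately show "modular_subgroup (K i \<inter> L) (G\<lparr>carrier := L, carrier := K (Suc i) \<inter> L\<rparr>)" by simp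
  qed (use K subgroup.subset[OF L] in auto)
qed

lemma submodular_sub:
  assumes "submodular_subgroup H G" "subgroup L G" "H \<subseteq> L"
  shows "submodular_subgroup H (G\<lparr>carrier := L\<rparr>)"
  using submodular_restrict[OF assms(1,2)] assms(3) by (simp add: Int_absorb2)

end

context group_hom
begin

lemma submodular_image:
  assumes sur: "h ` carrier G = carrier H" and L: "submodular_subgroup L G"
  shows "submodular_subgroup (h ` L) H"
proof -
  obtain n K where K: "K 0 = L" "K n = carrier G" "\<forall>i\<le>n. subgroup (K i) G"
    "\<forall>i<n. modular_subgroup (K i) (G\<lparr>carrier := K (Suc i)\<rparr>)"
    using L unfolding submodular_subgroup_def by blast
  show ?thesis unfolding submodular_subgroup_def
  proof (intro exI[of _ n] exI[of _ "\<lambda>i. h ` K i"] conjI allI impI)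
    fix i assume i: "i < n"
    then have s: "subgroup (K (Suc i)) G" using K(3) by auto
    have "group_hom (G\<lparr>carrier := K (Suc i)\<rparr>) (H\<lparr>carrier := h ` K (Suc i)\<rparr>) h"
      using restrict_hom[OF s subgroup_img_is_subgroup[OF s]] by simp
    then show "modular_subgroup (h ` K i) (H\<lparr>carrier := h ` K (Suc i)\<rparr>)"
      using group_hom.modular_image K(4) i by fastforce
  qed (use K sur subgroup_img_is_subgroup in auto)
qed

lemma submodular_preimage:
  assumes sur: "h ` carrier G = carrier H" and L: "submodular_subgroup L H"
  shows "submodular_subgroup {x \<in> carrier G. h x \<in> L} G"
proof -
  let ?p = "\<lambda>X. {x \<in> carrier G. h x \<in> X}"
  obtain n K where K: "K 0 = L" "K n = carrier H" "\<forall>i\<le>n. subgroup (K i) H"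
    "\<forall>i<n. modular_subgroup (K i) (H\<lparr>carrier := K (Suc i)\<rparr>)"
    using L unfolding submodular_subgroup_def by blast
  have sp: "subgroup (?p X) G" if "subgroup X H" for X
    using preimage_subgroup[OF that] .
  show ?thesis unfolding submodular_subgroup_def
  proof (intro exI[of _ n] exI[of _ "\<lambda>i. ?p (K i)"] conjI allI impI)
    fix i assume i: "i < n"
    then have s: "subgroup (K (Suc i)) H" using K(3) by auto
    have m: "modular_subgroup (K i) (H\<lparr>carrier := K (Suc i)\<rparr>)" using K(4) i by blast
    have sub: "K i \<subseteq> K (Suc i)" using H.modular_sub_subset(2)[OF m s] .
    interpret r: group_hom "G\<lparr>carrier := ?p (K (Suc i))\<rparr>" "H\<lparr>carrier := K (Suc i)\<rparr>" h
      using restrict_hom[OF sp[OF s] s] by auto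
    have "h ` ?p (K (Suc i)) = K (Suc i)"
      using image_preimage[OF sur subgroup.subset[OF s]] .
    then have "modular_subgroup {x \<in> ?p (K (Suc i)). h x \<in> K i} (G\<lparr>carrier := ?p (K (Suc i))\<rparr>)"
      using r.modular_preimage[OF _ m] by simp
    moreover have "{x \<in> ?p (K (Suc i)). h x \<in> K i} = ?p (K i)" using sub by auto
    ultimately show "modular_subgroup (?p (K i)) (G\<lparr>carrier := ?p (K (Suc i))\<rparr>)" by simp
  qed (use K sur sp in auto)
qed

end

section \<open>A maximal modular subgroup with a normal subgroup of order p\<close>

lemma only_prime_divisor_power:
  fixes n p :: nat
  assumes "n > 0" "prime p" "\<And>q. prime q \<Longrightarrow> q dvd n \<Longrightarrow> q = p"
  shows "\<exists>k. n = p ^ k"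
proof -
  obtain m where m: "n = p ^ multiplicity p n * m" "\<not> p dvd m"
    using multiplicity_decompose'[of n p] assms not_prime_unit by (metis less_irrefl)
  then have "m = 1" using prime_factor_nat[of m] assms(3) by (metis dvd_mult)
  then show ?thesis using m by (metis mult.right_neutral)
qed

context fin_group
begin

lemma subgroup_pow: "subgroup H G \<Longrightarrow> x \<in> H \<Longrightarrow> x [^] (n::nat) \<in> H"
  by (induction n) (auto intro: subgroup.one_closed subgroup.m_closed)

lemma subgroup_eqI: "subgroup K G \<Longrightarrow> H \<subseteq> K \<Longrightarrow> card H = card K \<Longrightarrow> H = K"
  using sub_finite card_subset_eq by blast

lemma card_one_iff: "subgroup H G \<Longrightarrow> card H = 1 \<longleftrightarrow> H = {\<one>}"
  using subgroup.one_closed by (metis card_1_singletonE is_singletonI is_singleton_altdef singletonD)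

lemma prime_card_sub:
  assumes "subgroup C G" "prime (card C)" "subgroup V G" "V \<subseteq> C"
  shows "V = {\<one>} \<or> V = C"
proof -
  have "card V dvd card C" using card_dvd assms by blast
  then have "card V = 1 \<or> card V = card C" using assms(2) prime_nat_iff by blast
  then show ?thesis using card_one_iff[OF assms(3)] subgroup_eqI[OF assms(1,4)] by blast
qed

lemma prime_card_cyclic:
  assumes C: "subgroup C G" "prime (card C)" and c: "c \<in> C" "c \<noteq> \<one>" 
  shows "C = generate G {c}" "y \<in> C \<Longrightarrow> \<exists>k::nat. y = c [^] k"
proof -
  have cG: "c \<in> carrier G" using c C subgroup.mem_carrier by metis
  have "generate G {c} \<subseteq> C" using generate_mono_sub[OF C(1)] c by blast
  moreover have "generate G {c} \<noteq> {\<one>}" using c generate.incl[of c "{c}" G] by auto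
  ultimately show 1: "C = generate G {c}"
    using prime_card_sub[OF C generate_is_subgroup[of "{c}"]] cG by blast
  have "ord c \<noteq> 0" using generate_pow_card[OF cG] 1 C(2) by (metis not_prime_0)
  then show "\<exists>k::nat. y = c [^] k" if "y \<in> C"
    using generate_pow_nat[OF cG] 1 that by blast
qed

lemma prime_card_no_subgroups:
  assumes H: "subgroup H G" "H \<noteq> {\<one>}" and V: "\<And>V. subgroup V G \<Longrightarrow> V \<subseteq> H \<Longrightarrow> V \<noteq> {\<one>} \<Longrightarrow> V = H"
  shows "prime (card H)"
proof -
  have "card H \<noteq> 1" using H card_one_iff by blast
  then obtain q where q: "prime q" "q dvd card H" using prime_factor_nat by blast
  then obtain x where x: "x \<in> H" "x \<noteq> \<one>" "card (generate G {x}) = q" using cauchy[OF H(1)] by metis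
  have "x \<in> carrier G" using x H subgroup.mem_carrier by metis
  then have s: "subgroup (generate G {x}) G" "x \<in> generate G {x}" 
    using generate_is_subgroup[of "{x}"] generate.incl[of x "{x}" G] by auto
  moreover have "generate G {x} \<subseteq> H" using generate_mono_sub[OF H(1)] x by simp
  ultimately have "generate G {x} = H" using V[OF s(1)] x by blast
  then show ?thesis using q x by simp
qed

text \<open>The number of nonidentity elements of \<open>C\<close> is not a multiple of
  \<open>s\<close>, so \<open>d\<close> fixes one of them. That element generates
  \<open>C\<close>.\<close>

lemma prime_card_aut_trivial:
  assumes C: "subgroup C G" "prime (card C)"
    and d: "p_elem G s d" "prime s" "\<not> s dvd card C - 1" "\<And>c. c \<in> C \<Longrightarrow> cj G d c \<in> C"
    and c: "c \<in> C"
  shows "cj G d c = c"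
proof -
  have dG: "d \<in> carrier G" using d(1) by (simp add: p_elem_def)
  have CG: "c \<in> carrier G" if "c \<in> C" for c using that C subgroup.mem_carrier by metis
  let ?R = "generate G {d}"
  have R: "subgroup ?R G" using generate_is_subgroup[of "{d}"] dG by simp
  have "?R \<subseteq> normr G C"
  proof (rule generate_mono_sub[OF normr_subgroup])
    have "cj G d ` C = C" using d(4) dG CG sub_finite[OF C(1)] 
      by (intro normalizes_eq[of C "{d}"]) (auto simp: normalizes_def)
    then show "{d} \<subseteq> normr G C" using dG by (simp add: normr_def)
  qed (use CG in blast)
  then have cl: "cj G g c \<in> C" if "g \<in> ?R" "c \<in> C" for g c using that by (auto simp: normr_def)
  have RG: "g \<in> carrier G" if "g \<in> ?R" for g using that R subgroup.mem_carrier by metis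
  let ?F = "{e \<in> C - {\<one>}. \<forall>g\<in>?R. cj G g e = e}"
  have "[card (C - {\<one>}) = card ?F] (mod s)"
  proof (rule fixed_points_cong[OF R d(2)])
    show "prime_power_card s ?R" using p_elem_iff[OF d(2) dG] d(1) by blast
    show "cj G g e \<in> C - {\<one>}" if "g \<in> ?R" "e \<in> C - {\<one>}" for g e
    proof -
      have "cj G g e \<noteq> cj G g \<one>" using that RG CG cj_eq_iff by blast
      then show ?thesis using cl that RG by simp
    qed
  qed (use sub_finite[OF C(1)] CG RG in \<open>auto simp: cj_mult\<close>)
  moreover have "card (C - {\<one>}) = card C - 1" using subgroup.one_closed[OF C(1)] by simp
  ultimately have "\<not> s dvd card ?F" using d(3) by (simp add: cong_def dvd_eq_mod_eq_0)
  then have "card ?F \<noteq> 0" by (metis dvd_0_right)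
  then have "?F \<noteq> {}" by (metis card.empty)
  then obtain e where e: "e \<in> C" "e \<noteq> \<one>" "\<forall>g\<in>?R. cj G g e = e" by blast
  then have de: "cj G d e = e" using generate.incl[of d "{d}" G] by blast
  obtain k :: nat where "c = e [^] k" using prime_card_cyclic(2)[OF C e(1,2) c] by blast
  then show ?thesis using de dG CG[OF e(1)] by (metis cj_pow)
qed

text \<open>Subgroups of the quotient correspond to subgroups above \<open>N\<close>, so the
  quotient has only the two trivial ones and its order is prime.\<close>

lemma prime_index:
  assumes N: "N \<lhd> G" "N \<noteq> carrier G"
    and V: "\<And>V. subgroup V G \<Longrightarrow> N \<subseteq> V \<Longrightarrow> V = N \<or> V = carrier G"
  shows "\<exists>r. prime r \<and> order G = r * card N"
proof -
  interpret N: normal N G by fact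
  interpret Q: group "G Mod N" by (rule N.factorgroup_is_group)
  have finQ: "finite (carrier (G Mod N))" using fin by (simp add: carrier_FactGroup)
  interpret Q: fin_group "G Mod N" by (unfold_locales) (rule finQ)
  interpret f: group_hom G "G Mod N" "\<lambda>x. N #> x"
    by (unfold_locales) (rule N.r_coset_hom_Mod)
  have sur: "(\<lambda>x. N #> x) ` carrier G = carrier (G Mod N)" by (simp add: carrier_FactGroup)
  have l: "card (carrier (G Mod N)) * card N = order G" 
    using lagrange[OF N.subgroup_axioms] by (simp add: FactGroup_def)
  have "card N < order G" using N(2) N.subset fin unfolding order_def by (simp add: psubset_card_mono psubsetI)
  then have n1: "card (carrier (G Mod N)) \<noteq> 1" using l by auto
  have "prime (card (carrier (G Mod N)))"
  proof (rule Q.prime_card_no_subgroups[OF Q.subgroup_self])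
    show "carrier (G Mod N) \<noteq> {\<one>\<^bsub>G Mod N\<^esub>}" using n1 by (metis card_1_singleton_iff One_nat_def)
    fix W assume W: "subgroup W (G Mod N)" "W \<subseteq> carrier (G Mod N)" "W \<noteq> {\<one>\<^bsub>G Mod N\<^esub>}"
    let ?V = "{x \<in> carrier G. N #> x \<in> W}"
    have im: "(\<lambda>x. N #> x) ` ?V = W" by (rule f.image_preimage[OF sur W(2)])
    have "N \<subseteq> ?V"
    proof
      fix n assume n: "n \<in> N"
      then have "N #> n = \<one>\<^bsub>G Mod N\<^esub>" using N.rcos_const[OF is_group] by simp
      then show "n \<in> ?V" using n subgroup.one_closed[OF W(1)] N.mem_carrier by simp
    qed
    then have "?V = N \<or> ?V = carrier G" using V[OF f.preimage_subgroup[OF W(1)]] by blast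
    then show "W = carrier (G Mod N)"
    proof
      assume "?V = N"
      then have "W = (\<lambda>x. N #> x) ` N" using im by simp
      also have "\<dots> = {N}" using N.rcos_const[OF is_group] N.one_closed by (metis (no_types, lifting) image_cong image_constant)
      finally show ?thesis using W(3) by simp
    next
      assume "?V = carrier G"
      then show ?thesis using im sur by simp
    qed
  qed
  then show ?thesis using l by metis
qed

end

text \<open>What remains of a minimal counterexample, with \<open>X\<close> the
  \<open>p\<close>-core of the modular subgroup \<open>M\<close>. Assumption \<open>h2\<close> is
  the first modular law for a maximal subgroup; \<open>h1\<close> and \<open>h4\<close> are traces
  of the fact that \<open>M\<close> is the only maximal subgroup containing any given nonidentity
  element of \<open>X\<close>. The aim is to show that these assumptions are contradictory.\<close>

locale maximal_modular_configuration = fin_group +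
  fixes p :: nat and M X :: "'a set"
  assumes p: "prime p" and largest: "\<And>q. prime q \<Longrightarrow> q dvd order G \<Longrightarrow> q \<le> p"
    and M: "subgroup M G" and X: "subgroup X G" and XM: "X \<subseteq> M" and cX: "card X = p"
    and normX: "normr G X = M" and proper: "M \<noteq> carrier G"
    and h1: "\<And>g. g \<in> carrier G \<Longrightarrow> g \<notin> M \<Longrightarrow> cj G g ` X \<inter> M = {\<one>}"
    and h2: "\<And>V Z. subgroup V G \<Longrightarrow> subgroup Z G \<Longrightarrow> V \<subseteq> Z \<Longrightarrow> \<not> V \<subseteq> M \<Longrightarrow> M \<inter> Z \<subseteq> V \<Longrightarrow> V = Z"
    and h4: "\<And>Z. subgroup Z G \<Longrightarrow> X \<subseteq> Z \<Longrightarrow> Z \<noteq> carrier G \<Longrightarrow> Z \<subseteq> M"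
    and center: "\<And>z. z \<in> carrier G \<Longrightarrow> (\<And>g. g \<in> carrier G \<Longrightarrow> cj G g z = z) \<Longrightarrow> z = \<one>"
begin

lemma MG: "M \<subseteq> carrier G" and XG: "X \<subseteq> carrier G"
  using M X subgroup.subset by auto

lemma pX: "prime (card X)" using p cX by simp

lemma Mconj: "g \<in> carrier G \<Longrightarrow> subgroup (cj G g ` M) G"
  using cj_subgroup M by blast

lemma h2':
  assumes g: "g \<in> carrier G" and V: "subgroup V G" and Z: "subgroup Z G" and VZ: "V \<subseteq> Z"
    and nV: "\<not> V \<subseteq> cj G g ` M" and ZV: "cj G g ` M \<inter> Z \<subseteq> V"
  shows "V = Z"
proof -
  let ?i = "\<lambda>S. cj G (inv g) ` S"
  have VG: "V \<subseteq> carrier G" and ZG: "Z \<subseteq> carrier G" using V Z subgroup.subset by auto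
  have ig: "inv g \<in> carrier G" using g by simp
  have "?i V = ?i Z"
  proof (rule h2)
    show "subgroup (?i V) G" "subgroup (?i Z) G" using cj_subgroup[OF ig] V Z by auto
    show "?i V \<subseteq> ?i Z" using VZ by blast
    show "\<not> ?i V \<subseteq> M"
    proof
      assume "?i V \<subseteq> M"
      then have "cj G g ` ?i V \<subseteq> cj G g ` M" by blast
      then show False using nV cj_image_cancel(2)[OF g VG] by simp
    qed
    show "M \<inter> ?i Z \<subseteq> ?i V"
    proof
      fix y assume y: "y \<in> M \<inter> ?i Z"
      then have yG: "y \<in> carrier G" using MG by blast
      have "cj G g y \<in> Z" using y cj_image_iff[OF ig yG ZG] g by simp
      then have "cj G g y \<in> V" using y ZV by blast
      then show "y \<in> ?i V" using cj_image_iff[OF ig yG VG] g by simp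
    qed
  qed
  then have "cj G g ` ?i V = cj G g ` ?i Z" by simp
  then show ?thesis using cj_image_cancel(2)[OF g] VG ZG by simp
qed

lemma X_conj_notin:
  assumes "g \<in> carrier G" "g \<notin> M"
  shows "\<not> cj G g ` X \<subseteq> M" "X \<inter> cj G g ` M = {\<one>}"
proof -
  have "card (cj G g ` X) = p" using cj_card[OF assms(1) XG] cX by simp
  then show "\<not> cj G g ` X \<subseteq> M" using h1[OF assms] p
    by (metis Int_absorb2 card_1_singleton_iff One_nat_def not_prime_1)
  have i: "inv g \<in> carrier G" "inv g \<notin> M"
    using assms subgroup.m_inv_closed[OF M, of "inv g"] by auto
  have "x = \<one>" if "x \<in> X" "x \<in> cj G g ` M" for x
  proof -
    have xG: "x \<in> carrier G" using that XG by blast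
    have "cj G (inv g) x \<in> cj G (inv g) ` X \<inter> M"
      using that cj_image_iff[OF assms(1) xG MG] by blast
    then have "cj G (inv g) x = \<one>" using h1[OF i] by blast
    then show ?thesis using xG assms(1) by (metis cj_cancel(2) cj_one(2))
  qed
  moreover have "\<one> \<in> X \<inter> cj G g ` M"
    using subgroup.one_closed[OF X] subgroup.one_closed[OF Mconj[OF assms(1)]] by blast
  ultimately show "X \<inter> cj G g ` M = {\<one>}" by blast
qed

lemma M_acts_X: "m \<in> M \<Longrightarrow> x \<in> X \<Longrightarrow> cj G m x \<in> X"
  using normX by (auto simp: normr_def)

text \<open>By \<open>h4\<close> no proper subgroup contains both \<open>X\<close> and its conjugate
  by \<open>g\<close>, so an element commuting with both is central.\<close>

lemma commuting_conjugates:
  assumes g: "g \<in> carrier G" "g \<notin> M" and k: "k \<in> carrier G"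
    and "\<And>x. x \<in> X \<Longrightarrow> cj G k x = x" "\<And>x. x \<in> X \<Longrightarrow> cj G k (cj G g x) = cj G g x"
  shows "k = \<one>"
proof -
  let ?Z = "{z \<in> carrier G. cj G k z = z}"
  have sZ: "subgroup ?Z G"
    by (rule subgroupI) (use k in \<open>auto simp: cj_mult cj_inv\<close>)
  have "X \<subseteq> ?Z" using assms(4) XG by blast
  moreover have "cj G g ` X \<subseteq> ?Z" using assms(5) XG g by auto
  ultimately have "?Z = carrier G" using h4[OF sZ] X_conj_notin(1)[OF g] by blast
  then have "\<And>z. z \<in> carrier G \<Longrightarrow> cj G z k = k" using cj_fix_sym[OF k] by blast
  then show ?thesis using center k by blast
qed

definition D :: "'a \<Rightarrow> 'a set" where "D g = M \<inter> cj G g ` M"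

lemma D_sub: "g \<in> carrier G \<Longrightarrow> subgroup (D g) G" "D g \<subseteq> M"
  unfolding D_def using subgroup_Int[OF M Mconj] by auto

lemma D_acts_conj:
  assumes g: "g \<in> carrier G" and d: "d \<in> D g" and y: "y \<in> cj G g ` X"
  shows "cj G d y \<in> cj G g ` X"
proof -
  have "cj G g ` M = normr G (cj G g ` X)" using normr_cj[OF g XG] normX by simp
  then have "d \<in> normr G (cj G g ` X)" using d by (auto simp: D_def)
  then show ?thesis using y by (auto simp: normr_def)
qed

context
  fixes g assumes g: "g \<in> carrier G" "g \<notin> M"
begin

lemma DX: "D g \<inter> X = {\<one>}"
  using X_conj_notin(2)[OF g] subgroup.one_closed[OF D_sub(1)[OF g(1)]] XM by (auto simp: D_def)

text \<open>Here \<open>h2'\<close> is applied to the conjugate of \<open>M\<close> by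
  \<open>g\<close>, with \<open>Z = M\<close> and the product as \<open>V\<close>. The product is
  not inside that conjugate because it contains \<open>X\<close>, which meets the conjugate
  trivially.\<close>

lemma M_eq: "M = D g <#> X"
proof -
  have n: "normalizes G (D g) X" using M_acts_X D_sub(2) by (auto simp: normalizes_def)
  have s: "subgroup (D g <#> X) G" using set_mult_subgroupI[OF D_sub(1)[OF g(1)] X n] .
  have c: "D g \<subseteq> D g <#> X" "X \<subseteq> D g <#> X" using set_mult_contains[OF D_sub(1)[OF g(1)] X] by auto
  have "D g <#> X = M"
  proof (rule h2'[OF g(1) s M])
    show "D g <#> X \<subseteq> M" using set_mult_least[OF M D_sub(2) XM] .
    have "X \<noteq> {\<one>}" using pX by auto
    then show "\<not> D g <#> X \<subseteq> cj G g ` M" using X_conj_notin(2)[OF g] c by blast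
    show "cj G g ` M \<inter> M \<subseteq> D g <#> X" using c by (auto simp: D_def)
  qed
  then show ?thesis by simp
qed

lemma card_M: "card M = card (D g) * p"
  using card_set_mult[OF D_sub(1)[OF g(1)] X] DX M_eq cX by simp

text \<open>An element of order \<open>p\<close> in \<open>D g\<close> would normalize
  \<open>X\<close> and its conjugate by \<open>g\<close>. Both have order \<open>p\<close>, and
  \<open>p\<close> does not divide \<open>p - 1\<close>, so it would centralize both.\<close>

lemma p_notdvd_D: "\<not> p dvd card (D g)"
proof
  assume "p dvd card (D g)"
  then obtain d where d: "d \<in> D g" "d \<noteq> \<one>" "d [^] p = \<one>" using cauchy[OF D_sub(1)[OF g(1)] p] by metis
  have dG: "d \<in> carrier G" using d D_sub(2) MG by blast
  have pe: "p_elem G p d" unfolding p_elem_def using d dG by (metis power_one_right)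
  have np: "\<not> p dvd p - 1" using p by (metis diff_less dvd_imp_le leD prime_gt_0_nat prime_gt_1_nat zero_less_diff zero_less_one)
  have "d = \<one>"
  proof (rule commuting_conjugates[OF g dG])
    show "cj G d x = x" if "x \<in> X" for x
      by (rule prime_card_aut_trivial[OF X pX pe p]) (use np cX M_acts_X D_sub(2) d that in auto)
    have "subgroup (cj G g ` X) G" "prime (card (cj G g ` X))"
      using cj_subgroup[OF g(1) X] cj_card[OF g(1) XG] pX by auto
    then show "cj G d (cj G g x) = cj G g x" if "x \<in> X" for x
      by (rule prime_card_aut_trivial[OF _ _ pe p]) 
        (use np cX D_acts_conj[OF g(1) d(1)] that cj_card[OF g(1) XG] in auto)
  qed
  then show False using d by simp
qed

end

lemma exists_outside: obtains g where "g \<in> carrier G" "g \<notin> M"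
  using proper MG by blast

text \<open>Commutators of the core of \<open>M\<close> with \<open>X\<close> lie in
  \<open>X\<close> and in another conjugate of \<open>M\<close>, so they are trivial. The core is
  normal, so it centralizes the conjugates of \<open>X\<close> as well.\<close>

lemma core_trivial:
  assumes e: "\<And>h. h \<in> carrier G \<Longrightarrow> e \<in> cj G h ` M"
  shows "e = \<one>"
proof -
  obtain g where g: "g \<in> carrier G" "g \<notin> M" by (rule exists_outside)
  let ?K = "{e. \<forall>h\<in>carrier G. e \<in> cj G h ` M}"
  have KM: "k \<in> M" if "k \<in> ?K" for k using that cj_image_one[OF MG] by fastforce
  have Kcj: "cj G u k \<in> ?K" if "k \<in> ?K" "u \<in> carrier G" for k u
  proof clarify
    fix h assume h: "h \<in> carrier G"
    have kG: "k \<in> carrier G" using KM[OF that(1)] MG by blast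
    have "k \<in> cj G (inv u \<otimes> h) ` M" using that h by simp
    then have "cj G (inv (inv u \<otimes> h)) k \<in> M" using cj_image_iff[of "inv u \<otimes> h" k M] that h kG MG by simp
    then have "cj G (inv h) (cj G u k) \<in> M" using that h kG by (simp add: inv_mult_group cj_mult)
    then show "cj G u k \<in> cj G h ` M" using cj_image_iff[of h "cj G u k" M] that h kG MG by simp
  qed
  have comm: "cj G k x = x" if k: "k \<in> ?K" and x: "x \<in> X" for k x
  proof -
    have kG: "k \<in> carrier G" using KM[OF k] MG by blast
    have xG: "x \<in> carrier G" using x XG by blast
    let ?c = "cj G k x \<otimes> inv x"
    have "?c \<in> X" using M_acts_X[OF KM[OF k] x] x subgroup.m_closed[OF X] subgroup.m_inv_closed[OF X] by blast
    moreover have "?c \<in> cj G g ` M"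
    proof -
      have "?c = k \<otimes> inv (cj G x k)" using kG xG by (simp add: cj_def inv_mult_group m_assoc)
      moreover have "k \<in> cj G g ` M" "cj G x k \<in> cj G g ` M" using k Kcj[OF k xG] g by auto
      ultimately show ?thesis using subgroup.m_closed[OF Mconj[OF g(1)]] subgroup.m_inv_closed[OF Mconj[OF g(1)]] by simp
    qed
    ultimately have "?c = \<one>" using X_conj_notin(2)[OF g] by blast
    then have "?c \<otimes> x = \<one> \<otimes> x" by simp
    then show ?thesis using kG xG by (simp add: m_assoc)
  qed
  have eK: "e \<in> ?K" using e by blast
  then have eG: "e \<in> carrier G" using KM MG by blast
  show ?thesis
  proof (rule commuting_conjugates[OF g eG comm[OF eK]])
    fix x assume x: "x \<in> X"
    have xG: "x \<in> carrier G" using x XG by blast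
    have "cj G (cj G (inv g) e) x = x" using comm[OF Kcj[OF eK] x] g by simp
    then have "cj G g (cj G (cj G (inv g) e) x) = cj G g x" by simp
    moreover have "cj G g (cj G (cj G (inv g) e) x) = cj G e (cj G g x)"
      using g eG xG by (simp add: cj_def m_assoc inv_mult_group)
    ultimately show "cj G e (cj G g x) = cj G g x" by simp
  qed
qed

text \<open>Such an element lies in every conjugate of \<open>M\<close>: for \<open>h\<close>
  outside \<open>M\<close> write \<open>e = d x\<close> with \<open>d\<close> in \<open>D h\<close>.
  The factors commute, and raising to the power \<open>card (D g)\<close>, which is prime to
  \<open>p\<close>, forces \<open>x\<close> to be trivial.\<close>

lemma D_faithful:
  assumes g: "g \<in> carrier G" "g \<notin> M" and e: "e \<in> D g" and comm: "\<And>x. x \<in> X \<Longrightarrow> cj G e x = x"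
  shows "e = \<one>"
proof (rule core_trivial)
  fix h assume h: "h \<in> carrier G"
  have eM: "e \<in> M" using e D_sub(2) by blast
  show "e \<in> cj G h ` M"
  proof (cases "h \<in> M")
    case True
    then show ?thesis using cj_self_image[OF M True] eM by simp
  next
    case False
    have "e \<in> D h <#> X" using eM M_eq[OF h False] by simp
    then obtain d x where dx: "d \<in> D h" "x \<in> X" "e = d \<otimes> x"
      by (auto simp: set_mult_def)
    have c: "d \<in> carrier G" "x \<in> carrier G" "e \<in> carrier G" using dx XG D_sub(2) MG eM by blast+
    let ?m = "card (D g)"
    have em: "e [^] ?m = \<one>" using pow_card_one[OF D_sub(1)[OF g(1)] e] .
    have ex: "e \<otimes> x = x \<otimes> e" using comm[OF dx(2)] cj_fix_iff c by simp
    have "d \<otimes> x = x \<otimes> d"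
    proof -
      have "x \<otimes> d \<otimes> x = d \<otimes> x \<otimes> x" using ex dx(3) c by (simp add: m_assoc)
      then show ?thesis using c by simp
    qed
    then have "e [^] ?m = d [^] ?m \<otimes> x [^] ?m" using pow_mult_distrib[OF _ c(1,2)] dx(3) by blast
    then have "d [^] ?m = inv (x [^] ?m)" using em c by (metis inv_equality inv_inv nat_pow_closed inv_closed)
    moreover have "d [^] ?m \<in> D h" using subgroup_pow[OF D_sub(1)[OF h] dx(1)] .
    moreover have "inv (x [^] ?m) \<in> X" using subgroup.m_inv_closed[OF X subgroup_pow[OF X dx(2)]] .
    ultimately have "inv (x [^] ?m) = \<one>" using DX[OF h False] by auto
    then have "x [^] ?m = \<one>" using c by simp
    moreover have "p_elem G p x" using p_elem_in[OF X _ dx(2)] cX unfolding prime_power_card_def by (metis power_one_right)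
    ultimately have "x = \<one>" using p_elem_coprime[OF _ _ p p_notdvd_D[OF g]] by blast
    then show ?thesis using dx c by (auto simp: D_def)
  qed
qed

lemma X_p_elem: "x \<in> X \<Longrightarrow> p_elem G p x"
  using p_elem_in[OF X] cX unfolding prime_power_card_def by (metis power_one_right)

lemma exists_generator: obtains x where "x \<in> X" "x \<noteq> \<one>"
  using pX card_one_iff[OF X] subgroup.one_closed[OF X] by (metis not_prime_1 singletonI subsetI subset_singletonD subset_antisym empty_iff)

context
  fixes g assumes g: "g \<in> carrier G" "g \<notin> M"
begin

text \<open>The commutator of \<open>x\<close> and \<open>d\<close> lies in \<open>D g\<close> and,
  as \<open>M\<close> normalizes \<open>X\<close>, also in \<open>X\<close>, so it is trivial. Then
  \<open>d\<close> centralizes the cyclic group \<open>X\<close>, and \<open>D_faithful\<close>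
  applies.\<close>

lemma X_not_normalizes_D:
  assumes x: "x \<in> X" "x \<noteq> \<one>" and d: "d \<in> D g" "cj G x d \<in> D g"
  shows "d = \<one>"
proof -
  have c: "x \<in> carrier G" "d \<in> carrier G" using x d XG D_sub(2) MG by blast+
  have dM: "d \<in> M" using d D_sub(2) by blast
  have "cj G x d \<otimes> inv d \<in> D g"
    using d subgroup.m_closed[OF D_sub(1)[OF g(1)]] subgroup.m_inv_closed[OF D_sub(1)[OF g(1)]] by blast
  moreover have "cj G x d \<otimes> inv d \<in> X"
  proof -
    have "cj G x d \<otimes> inv d = x \<otimes> inv (cj G d x)" using c by (simp add: cj_def inv_mult_group m_assoc)
    then show ?thesis using x M_acts_X[OF dM x(1)] subgroup.m_closed[OF X] subgroup.m_inv_closed[OF X] by simp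
  qed
  ultimately have "cj G x d \<otimes> inv d = \<one>" using DX[OF g] by blast
  then have "cj G x d \<otimes> inv d \<otimes> d = \<one> \<otimes> d" by simp
  then have "cj G x d = d" using c by (simp add: m_assoc)
  then have dx: "cj G d x = x" using cj_fix_sym c by simp
  show "d = \<one>"
  proof (rule D_faithful[OF g d(1)])
    fix y assume y: "y \<in> X"
    obtain k :: nat where "y = x [^] k" using prime_card_cyclic(2)[OF X pX x y] by blast
    then show "cj G d y = y" using dx c by (metis cj_pow)
  qed
qed

text \<open>In \<open>M = D g <#> X\<close> the factor from \<open>X\<close> of an element
  normalizing \<open>D g\<close> normalizes it too, and is therefore trivial.\<close>

lemma normr_D_Int_M:
  assumes "D g \<noteq> {\<one>}"
  shows "normr G (D g) \<inter> M = D g"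
proof
  show "D g \<subseteq> normr G (D g) \<inter> M" using normr_super D_sub(1)[OF g(1)] D_sub(2) by blast
  show "normr G (D g) \<inter> M \<subseteq> D g"
  proof
    fix u assume u: "u \<in> normr G (D g) \<inter> M"
    then have "u \<in> D g <#> X" using M_eq[OF g] by simp
    then obtain d x where dx: "d \<in> D g" "x \<in> X" "u = d \<otimes> x" by (auto simp: set_mult_def)
    have c: "d \<in> carrier G" "x \<in> carrier G" using dx XG D_sub(2) MG by blast+
    have DG: "D g \<subseteq> carrier G" using D_sub(2) MG by blast
    obtain e where e: "e \<in> D g" "e \<noteq> \<one>" using assms subgroup.one_closed[OF D_sub(1)[OF g(1)]] by blast
    have "x = inv d \<otimes> u" using dx c by simp
    moreover have "inv d \<in> normr G (D g)" 
      using dx(1) normr_super[OF D_sub(1)[OF g(1)]] subgroup.m_inv_closed[OF D_sub(1)[OF g(1)]] by blast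
    ultimately have "x \<in> normr G (D g)" using u subgroup.m_closed[OF normr_subgroup[OF DG]] by blast
    then have "cj G x e \<in> D g" using e by (auto simp: normr_def)
    then have "x = \<one>" using X_not_normalizes_D[OF dx(2) _ e(1)] e(2) by blast
    then show "u \<in> D g" using dx c by simp
  qed
qed

text \<open>The conjugate of \<open>D g\<close> by \<open>x\<close> lies in \<open>M\<close> and
  meets the conjugate of \<open>M\<close> by \<open>g\<close> trivially. By \<open>h2'\<close> each
  of its nontrivial subgroups is already the whole of it.\<close>

lemma D_prime:
  assumes "D g \<noteq> {\<one>}"
  shows "prime (card (D g))"
proof -
  obtain x where x: "x \<in> X" "x \<noteq> \<one>" by (rule exists_generator)
  have xG: "x \<in> carrier G" using x XG by blast
  have DG: "D g \<subseteq> carrier G" using D_sub(2) MG by blast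
  let ?E = "cj G x ` D g"
  have E: "subgroup ?E G" using cj_subgroup[OF xG D_sub(1)[OF g(1)]] .
  have cE: "card ?E = card (D g)" using cj_card[OF xG DG] .
  have EM: "?E \<subseteq> M" using cj_self_image[OF M, of x] x XM D_sub(2) by blast
  have int: "y = \<one>" if y: "y \<in> ?E" "y \<in> D g" for y
  proof -
    obtain d where d: "d \<in> D g" "y = cj G x d" using y by blast
    then have "d = \<one>" using X_not_normalizes_D[OF x d(1)] y by simp
    then show ?thesis using d xG by simp
  qed
  have "prime (card ?E)"
  proof (rule prime_card_no_subgroups[OF E])
    show "?E \<noteq> {\<one>}" using assms cE card_one_iff[OF E] card_one_iff[OF D_sub(1)[OF g(1)]] by simp
    fix V assume V: "subgroup V G" "V \<subseteq> ?E" "V \<noteq> {\<one>}"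
    show "V = ?E"
    proof (rule h2'[OF g(1) V(1) E V(2)])
      show "\<not> V \<subseteq> cj G g ` M"
      proof
        assume "V \<subseteq> cj G g ` M"
        then have "V \<subseteq> D g" using V(2) EM unfolding D_def by blast
        then have "V \<subseteq> {\<one>}" using int V(2) by blast
        then show False using V(3) subgroup.one_closed[OF V(1)] by blast
      qed
      show "cj G g ` M \<inter> ?E \<subseteq> V" 
      proof
        fix y assume y: "y \<in> cj G g ` M \<inter> ?E"
        then have "y \<in> D g" using EM unfolding D_def by blast
        then have "y = \<one>" using int y by blast
        then show "y \<in> V" using subgroup.one_closed[OF V(1)] by simp
      qed
    qed
  qed
  then show ?thesis using cE by simp
qed

end

section \<open>Counting conjugates\<close>

lemma X_TI: "g \<in> carrier G \<Longrightarrow> g \<notin> normr G X \<Longrightarrow> cj G g ` X \<inter> X = {\<one>}"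
proof -
  assume g: "g \<in> carrier G" "g \<notin> normr G X"
  have "cj G g ` X \<inter> X \<subseteq> {\<one>}" using h1[of g] g normX XM by blast
  then show "cj G g ` X \<inter> X = {\<one>}"
    using subgroup.one_closed[OF X] subgroup.one_closed[OF cj_subgroup[OF g(1) X]] by blast
qed

lemma count_X: "card (\<Union>g\<in>carrier G. cj G g ` (X - {\<one>})) * card M = order G * (p - 1)"
  using card_conjugates_of_TI[OF X X_TI] normX cX by simp

text \<open>Conjugates of elements of \<open>T\<close> are \<open>t\<close>-elements and those of
  elements of \<open>X\<close> are \<open>p\<close>-elements, so the two unions are disjoint, and
  both avoid the identity.\<close>

lemma count_two_TI:
  assumes T: "subgroup T G" and TI: "\<And>g. g \<in> carrier G \<Longrightarrow> g \<notin> normr G T \<Longrightarrow> cj G g ` T \<inter> T = {\<one>}"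
    and t: "prime t" "t \<noteq> p" "\<And>x. x \<in> T \<Longrightarrow> p_elem G t x"
  obtains a b where "a * card (normr G T) = order G * (card T - 1)" "b * card M = order G * (p - 1)" "a + b < order G"
proof -
  let ?A = "\<Union>g\<in>carrier G. cj G g ` (T - {\<one>})" and ?B = "\<Union>g\<in>carrier G. cj G g ` (X - {\<one>})"
  have TG: "T \<subseteq> carrier G" using T subgroup.subset by blast
  have ne: "cj G g x \<noteq> \<one>" if "g \<in> carrier G" "x \<in> carrier G" "x \<noteq> \<one>" for g x
    using that cj_eq_iff[of g x \<one>] by simp
  have "(\<Union>g\<in>carrier G. cj G g ` (S - {\<one>})) \<subseteq> carrier G - {\<one>}" if S: "S \<subseteq> carrier G" for S
  proof (rule UN_least)
    fix g assume g: "g \<in> carrier G"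
    show "cj G g ` (S - {\<one>}) \<subseteq> carrier G - {\<one>}"
      using ne[OF g] cj_closed[OF g] S by auto
  qed
  from this[OF TG] this[OF XG] have sub: "?A \<subseteq> carrier G - {\<one>}" "?B \<subseteq> carrier G - {\<one>}" .
  have "?A \<inter> ?B = {}"
  proof -
    have A: "p_elem G t y" if "y \<in> ?A" for y using that p_elem_cj[OF t(3)] by auto
    have B: "p_elem G p y" if "y \<in> ?B" for y using that p_elem_cj[OF X_p_elem] by auto
    have "y \<notin> ?B" if y: "y \<in> ?A" for y
    proof
      assume "y \<in> ?B"
      then have "y = \<one>" using p_elem_disjoint[OF A[OF y] B t(1) p t(2)] by simp
      then show False using sub(1) y by blast
    qed
    then show ?thesis by blast
  qed
  moreover have "finite ?A" "finite ?B"
    by (rule finite_subset[OF sub(1)], use fin in simp, rule finite_subset[OF sub(2)], use fin in simp)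
  ultimately have "card ?A + card ?B = card (?A \<union> ?B)" by (simp add: card_Un_disjoint)
  also have "\<dots> \<le> card (carrier G - {\<one>})" using sub fin by (intro card_mono) auto
  also have "\<dots> < order G" using fin order_gt_0_iff_finite unfolding order_def by simp
  finally show ?thesis by (rule that[OF card_conjugates_of_TI[OF T TI] count_X, rotated -1])
qed

lemma prime_le_not_dvd: "t \<noteq> p \<Longrightarrow> prime t \<Longrightarrow> t dvd order G \<Longrightarrow> \<not> p dvd t - 1"
  using largest[of t] prime_gt_1_nat[of t] by (auto dest!: dvd_imp_le)

lemma fixes_X_imp_M:
  assumes "u \<in> carrier G" "\<And>x. x \<in> X \<Longrightarrow> cj G x u = u"
  shows "u \<in> M"
proof -
  have "cj G u x = x" if "x \<in> X" for x using assms that XG cj_fix_sym by blast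
  then have "cj G u ` X = X" by simp
  then show ?thesis using normX assms(1) by (auto simp: normr_def)
qed

text \<open>Otherwise \<open>M = X\<close> has order \<open>p\<close>. A subgroup of another prime
  order \<open>t\<close> is then self-normalizing, and the nonidentity elements of its conjugates
  and of those of \<open>X\<close> would each make up at least half of the group.\<close>

lemma D_nontrivial:
  assumes g: "g \<in> carrier G" "g \<notin> M"
  shows "D g \<noteq> {\<one>}"
proof
  assume "D g = {\<one>}"
  then have cM: "card M = p" using card_M[OF g] by simp
  then have MX: "M = X" using subgroup_eqI[OF M XM] cX by simp
  have pM: "prime (card M)" using cM p by simp
  \<comment> \<open>If \<open>p\<close> were the only prime divisor, the normalizer of
    \<open>X\<close> would be larger than \<open>X\<close>.\<close>
  have "\<exists>t. prime t \<and> t dvd order G \<and> t \<noteq> p"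
  proof (rule ccontr)
    assume "\<not> ?thesis"
    then have "prime_power_card p (carrier G)"
      using only_prime_divisor_power[of "order G" p] p fin order_gt_0_iff_finite
      unfolding prime_power_card_def order_def by metis
    then obtain u where "u \<in> carrier G" "u \<notin> X" "cj G u ` X = X"
      using normalizer_grows[OF subgroup_self p _ X] XG proper MX by blast
    then show False using normX MX by (auto simp: normr_def)
  qed
  then obtain t where t: "prime t" "t dvd order G" "t \<noteq> p" by blast
  obtain u where u: "u \<in> carrier G" "u \<noteq> \<one>" "card (generate G {u}) = t"
    using cauchy[OF subgroup_self t(1)] t(2) unfolding order_def by metis
  let ?T = "generate G {u}"
  have T: "subgroup ?T G" using generate_is_subgroup[of "{u}"] u by simp
  have TG: "?T \<subseteq> carrier G" using subgroup.subset[OF T] .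
  have pT: "prime (card ?T)" using u t by simp
  have Tne: "?T \<noteq> {\<one>}" using pT by auto
  have TM: "\<not> ?T \<subseteq> M" 
    using card_dvd[OF T M] u(3) cM t(1,3) p primes_dvd_imp_eq by auto
  have TM1: "M \<inter> ?T = {\<one>}" using prime_card_sub[OF T pT subgroup_Int[OF M T]] TM by blast
  let ?Z = "normr G ?T"
  have Z: "subgroup ?Z G" using normr_subgroup[OF TG] .
  have TZ: "?T \<subseteq> ?Z" using normr_super[OF T] .
  have nT: "normr G ?T = ?T"
  proof (cases "M \<inter> ?Z = {\<one>}")
    case True
    have "?T = ?Z"
      by (rule h2[OF T Z TZ TM]) (use True subgroup.one_closed[OF T] in simp)
    then show ?thesis by simp
  next
    case False
    \<comment> \<open>Here \<open>X\<close> normalizes \<open>?T\<close> and centralizes it, since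
      \<open>p\<close> does not divide \<open>t - 1\<close>. This would put \<open>?T\<close> into
      the normalizer of \<open>X\<close>, which is \<open>M\<close>.\<close>
    then have XZ: "X \<subseteq> ?Z" using prime_card_sub[OF M pM subgroup_Int[OF M Z]] MX by blast
    have "cj G x v = v" if "x \<in> X" "v \<in> ?T" for x v
    proof (rule prime_card_aut_trivial[OF T pT X_p_elem[OF that(1)] p])
      show "\<not> p dvd card ?T - 1" using prime_le_not_dvd t u(3) by simp
      show "cj G x c \<in> ?T" if "c \<in> ?T" for c using XZ \<open>x \<in> X\<close> that by (auto simp: normr_def)
    qed (use that in auto)
    then have "?T \<subseteq> M" using fixes_X_imp_M TG by blast
    then show ?thesis using TM by blast
  qed
  have TI: "cj G h ` ?T \<inter> ?T = {\<one>}" if "h \<in> carrier G" "h \<notin> normr G ?T" for h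
  proof -
    have "cj G h ` ?T \<noteq> ?T" using that by (simp add: normr_def)
    then have "\<not> ?T \<subseteq> cj G h ` ?T" using subgroup_eqI[OF cj_subgroup[OF that(1) T], of ?T] cj_card[OF that(1) TG] by auto
    then show ?thesis using prime_card_sub[OF T pT subgroup_Int[OF cj_subgroup[OF that(1) T] T]] by blast
  qed
  have pe: "p_elem G t v" if "v \<in> ?T" for v
    using p_elem_in[OF T _ that] u(3) unfolding prime_power_card_def by (metis power_one_right)
  obtain a b where ab: "a * card (normr G ?T) = order G * (card ?T - 1)" "b * card M = order G * (p - 1)" "a + b < order G"
    using count_two_TI[OF T TI t(1) t(3) pe] by blast
  have half: "n \<le> 2 * c" if h: "c * s = n * (s - 1)" "prime s" for c s n :: nat
  proof -
    obtain r where r: "s = r + 2" using prime_ge_2_nat[OF h(2)] by (metis add.commute le_Suc_ex)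
    have "n * s \<le> n * (2 * (s - 1))" unfolding r by (intro mult_left_mono) auto
    also have "\<dots> = (2 * c) * s" using h(1) by simp
    finally show ?thesis using prime_gt_0_nat[OF h(2)] by simp
  qed
  have "order G \<le> 2 * a" using half[of a t "order G"] ab(1) nT u(3) t(1) by simp
  moreover have "order G \<le> 2 * b" using half[of b p "order G"] ab(2) cM p by simp
  ultimately show False using ab(3) by simp
qed

text \<open>With \<open>D g\<close> of prime order \<open>q\<close> and \<open>M\<close> of order
  \<open>q p\<close>, the normalizer \<open>N\<close> of \<open>D g\<close> turns out to be
  self-normalizing of order \<open>q^2\<close> with trivially intersecting conjugates. The
  conjugates of \<open>N\<close> and \<open>X\<close> then contain too many elements.\<close>

lemma contradiction: False
proof -
  obtain g where g: "g \<in> carrier G" "g \<notin> M" by (rule exists_outside)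
  obtain x where x: "x \<in> X" "x \<noteq> \<one>" by (rule exists_generator)
  have xG: "x \<in> carrier G" using x XG by blast
  define E where "E = D g"
  define q where "q = card E"
  note Dne = D_nontrivial[OF g]
  have E: "subgroup E G" "E \<subseteq> M" using D_sub(1)[OF g(1)] D_sub(2) by (auto simp: E_def)
  have EG: "E \<subseteq> carrier G" using E MG by blast
  have q: "prime q" using D_prime[OF g Dne] by (simp add: q_def E_def)
  have cE: "prime (card E)" using q by (simp add: q_def)
  have Ene: "E \<noteq> {\<one>}" using Dne E_def by simp
  have cM: "card M = q * p" using card_M[OF g] by (simp add: q_def E_def)
  have qp: "q \<noteq> p" using p_notdvd_D[OF g] by (auto simp: q_def E_def)
  have q_elem: "p_elem G q d" if "d \<in> E" for d
    using p_elem_in[OF E(1) _ that] q_def unfolding prime_power_card_def by (metis power_one_right)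
  have qd: "q dvd p - 1"
  proof (rule ccontr)
    assume n: "\<not> q dvd p - 1"
    obtain d where d: "d \<in> E" "d \<noteq> \<one>" using Ene subgroup.one_closed[OF E(1)] by blast
    have "d = \<one>"
    proof (rule D_faithful[OF g])
      show "d \<in> D g" using d E_def by simp
      show "cj G d y = y" if "y \<in> X" for y
        by (rule prime_card_aut_trivial[OF X pX q_elem[OF d(1)] q]) (use n cX M_acts_X E(2) d that in auto)
    qed
    then show False using d by simp
  qed
  then have qlt: "q < p" using prime_gt_1_nat[OF p] by (auto dest: dvd_imp_le)
  have pq: "\<not> p dvd q - 1" using qlt prime_gt_1_nat[OF q] by (auto dest: dvd_imp_le)
  define N where "N = normr G E"
  have N: "subgroup N G" using normr_subgroup[OF EG] N_def by simp
  have EN: "E \<subseteq> N" using normr_super[OF E(1)] N_def by simp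
  have NM: "N \<inter> M = E" using normr_D_Int_M[OF g Dne] by (simp add: N_def E_def)
  have xN: "\<not> cj G x ` E \<subseteq> E"
    using X_not_normalizes_D[OF g x] Ene subgroup.one_closed[OF E(1)] unfolding E_def by blast
  \<comment> \<open>\<open>E\<close> and its conjugate by \<open>inv g\<close> are Sylow
    \<open>q\<close>-subgroups of \<open>M\<close>, so some \<open>m\<close> in \<open>M\<close>
    conjugates one to the other. Then \<open>g \<otimes> m\<close> normalizes \<open>E\<close> and
    lies outside \<open>M\<close>.\<close>
  have "\<exists>w. w \<in> N \<and> w \<notin> M"
  proof -
    let ?E' = "cj G (inv g) ` E"
    have ig: "inv g \<in> carrier G" using g by simp
    have E': "subgroup ?E' G" "card ?E' = q" using cj_subgroup[OF ig E(1)] cj_card[OF ig EG] q_def by auto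
    have E'M: "?E' \<subseteq> M"
    proof -
      have "E \<subseteq> cj G g ` M" by (auto simp: E_def D_def)
      then have "?E' \<subseteq> cj G (inv g) ` cj G g ` M" by blast
      then show ?thesis using cj_image_cancel(1)[OF g(1) MG] by simp
    qed
    interpret Mg: fin_group "G\<lparr>carrier := M\<rparr>" using fin_group_sub[OF M] .
    have "multiplicity q (q * p) = 1"
      using q p qp primes_dvd_imp_eq by (intro multiplicity_eqI) auto
    then have syl: "sylow_subgroup q E (G\<lparr>carrier := M\<rparr>)"
      using q E cM subgroup_subset_iff[OF M] q_def by (simp add: sylow_subgroup_def order_def)
    have "prime_power_card q ?E'" using E'(2) unfolding prime_power_card_def by (metis power_one_right)
    moreover have "subgroup ?E' (G\<lparr>carrier := M\<rparr>)" using E' E'M subgroup_subset_iff[OF M] by simp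
    ultimately obtain m where m: "m \<in> M" "?E' \<subseteq> cj (G\<lparr>carrier := M\<rparr>) m ` E"
      using Mg.sylow_contains[OF _ _ syl] by auto
    have mG: "m \<in> carrier G" using m MG by blast
    have "?E' \<subseteq> cj G m ` E" using m cj_consistent[OF M m(1)] by simp
    then have "?E' = cj G m ` E"
      using subgroup_eqI[OF cj_subgroup[OF mG E(1)]] E'(2) cj_card[OF mG EG] q_def by simp
    then have "cj G g ` cj G (inv g) ` E = cj G (g \<otimes> m) ` E" using g mG EG by (simp add: cj_image_comp)
    then have "cj G (g \<otimes> m) ` E = E" using cj_image_cancel(2)[OF g(1) EG] by simp
    then have "g \<otimes> m \<in> N" using g mG by (simp add: N_def normr_def)
    moreover have "g \<otimes> m \<notin> M"
    proof
      assume "g \<otimes> m \<in> M"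
      then have "g \<otimes> m \<otimes> inv m \<in> M" using m subgroup.m_closed[OF M] subgroup.m_inv_closed[OF M] by blast
      then show False using g mG by (simp add: m_assoc)
    qed
    ultimately show ?thesis by blast
  qed
  then have NnM: "\<not> N \<subseteq> M" by blast
  interpret Ng: fin_group "G\<lparr>carrier := N\<rparr>" using fin_group_sub[OF N] .
  \<comment> \<open>A subgroup between \<open>E\<close> and \<open>N\<close> that lies in
    \<open>M\<close> is \<open>N \<inter> M = E\<close>; any other equals \<open>N\<close> by
    \<open>h2\<close>.\<close>
  have "\<exists>r. prime r \<and> order (G\<lparr>carrier := N\<rparr>) = r * card E"
  proof (rule Ng.prime_index)
    have "cj G n e \<in> E" if "n \<in> N" "e \<in> E" for n e using that by (auto simp: N_def normr_def)
    then show "E \<lhd> G\<lparr>carrier := N\<rparr>"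
      unfolding Ng.normal_iff_normalizes using E EN subgroup_subset_iff[OF N] cj_consistent[OF N]
      by (auto simp: normalizes_def)
    show "E \<noteq> carrier (G\<lparr>carrier := N\<rparr>)" using NnM E by auto
    show "V = E \<or> V = carrier (G\<lparr>carrier := N\<rparr>)" if "subgroup V (G\<lparr>carrier := N\<rparr>)" "E \<subseteq> V" for V
    proof (cases "V \<subseteq> M")
      case True
      then show ?thesis using that subgroup_subset_iff[OF N] NM by auto
    next
      case False
      have V: "subgroup V G" "V \<subseteq> N" using that subgroup_subset_iff[OF N] by auto
      show ?thesis using h2[OF V(1) N V(2) False] NM that(2) by auto
    qed
  qed
  then obtain r where r: "prime r" "card N = r * q" by (auto simp: order_def q_def)
  \<comment> \<open>Since the core of \<open>M\<close> is trivial, some conjugate of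
    \<open>M\<close> does not contain \<open>E\<close>. Its intersection \<open>U\<close> with
    \<open>N\<close> will be a complement of \<open>E\<close> in \<open>N\<close>, so that
    \<open>r\<close> divides the order of \<open>M\<close>.\<close>
  have "\<exists>h\<in>carrier G. \<not> E \<subseteq> cj G h ` M"
  proof (rule ccontr)
    assume "\<not> ?thesis"
    then have "E \<subseteq> {\<one>}" using core_trivial by blast
    then show False using Ene subgroup.one_closed[OF E(1)] by blast
  qed
  then obtain h where h: "h \<in> carrier G" "\<not> E \<subseteq> cj G h ` M" by blast
  define U where "U = cj G h ` M \<inter> N"
  have U: "subgroup U G" using subgroup_Int[OF Mconj[OF h(1)] N] U_def by simp
  have Une: "U \<noteq> {\<one>}"
  proof
    assume "U = {\<one>}"
    then have "cj G h ` M \<inter> N \<subseteq> E" using subgroup.one_closed[OF E(1)] U_def by simp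
    then have "E = N" by (rule h2'[OF h(1) E(1) N EN h(2)])
    then show False using NnM E by blast
  qed
  have UE: "U \<inter> E = {\<one>}" 
    using prime_card_sub[OF E(1) cE subgroup_Int[OF U E(1)]] h(2) U_def by blast
  have "card U = r"
  proof -
    have n: "normalizes G U E" unfolding normalizes_def U_def N_def normr_def by auto
    have s: "subgroup (U <#> E) G" using set_mult_subgroupI[OF U E(1) n] .
    have "U <#> E \<subseteq> N" using set_mult_least[OF N] EN U_def by blast
    then have "card (U <#> E) dvd r * q" using card_dvd[OF s N] r by simp
    moreover have "card (U <#> E) = card U * q" using card_set_mult[OF U E(1)] UE q_def by simp
    ultimately have "card U dvd r" using q by (simp add: prime_gt_0_nat)
    then show ?thesis using r(1) Une card_one_iff[OF U] prime_nat_iff by blast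
  qed
  have "r dvd q * p"
  proof -
    have "card U dvd card (cj G h ` M)" using card_dvd[OF U Mconj[OF h(1)]] U_def by blast
    then show ?thesis using \<open>card U = r\<close> cj_card[OF h(1) MG] cM by simp
  qed
  then have "r = q \<or> r = p" using r(1) p q primes_dvd_imp_eq prime_dvd_mult_iff by blast
  \<comment> \<open>For \<open>r = p\<close> the complement \<open>U\<close> is the conjugate of
    \<open>X\<close> by \<open>h\<close>. It normalizes \<open>E\<close> and centralizes it, as
    \<open>p\<close> does not divide \<open>q - 1\<close>. Thus \<open>E\<close> normalizes that
    conjugate of \<open>X\<close> and lies in the conjugate of \<open>M\<close> by \<open>h\<close>,
    against the choice of \<open>h\<close>.\<close>
  moreover have "r \<noteq> p"
  proof
    assume rp: "r = p"
    let ?U' = "cj G (inv h) ` U"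
    have ih: "inv h \<in> carrier G" using h by simp
    have UG: "U \<subseteq> carrier G" using subgroup.subset[OF U] .
    have U': "subgroup ?U' G" "card ?U' = p" using cj_subgroup[OF ih U] cj_card[OF ih UG] \<open>card U = r\<close> rp by auto
    have "?U' \<subseteq> cj G (inv h) ` cj G h ` M" using U_def by blast
    then have U'M: "?U' \<subseteq> M" using cj_image_cancel(1)[OF h(1) MG] by simp
    have "?U' = X"
    proof (rule ccontr)
      assume ne: "?U' \<noteq> X"
      then have "?U' \<inter> X = {\<one>}"
        using prime_card_sub[OF X pX subgroup_Int[OF U'(1) X]] subgroup_eqI[OF U'(1), of X] U'(2) cX by auto
      then have c: "card (?U' <#> X) = p * p" using card_set_mult[OF U'(1) X] U'(2) cX by simp
      have n: "normalizes G ?U' X" using M_acts_X U'M by (auto simp: normalizes_def)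
      have "p * p dvd q * p"
        using card_dvd[OF set_mult_subgroupI[OF U'(1) X n] M set_mult_least[OF M U'M XM]] c cM by simp
      then have "p dvd q" using p by (simp add: prime_gt_0_nat)
      then show False using qp p q primes_dvd_imp_eq by blast
    qed
    then have UX: "U = cj G h ` X" using cj_image_cancel(2)[OF h(1) UG] by simp
    have "E \<subseteq> cj G h ` M"
    proof
      fix d assume d: "d \<in> E"
      have dG: "d \<in> carrier G" using d EG by blast
      have "cj G u d = d" if u: "u \<in> U" for u
      proof (rule prime_card_aut_trivial[OF E(1) cE _ p _ _ d])
        show "p_elem G p u" using p_elem_cj X_p_elem u UX h(1) by blast
        show "\<not> p dvd card E - 1" using pq q_def by simp
        show "cj G u c \<in> E" if "c \<in> E" for c using u that unfolding U_def N_def normr_def by auto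
      qed
      then have "cj G d u = u" if "u \<in> U" for u using that cj_fix_sym[OF dG] UG by blast
      then have "cj G d ` cj G h ` X = cj G h ` X" using UX by simp
      then have "d \<in> normr G (cj G h ` X)" using dG by (simp add: normr_def)
      then show "d \<in> cj G h ` M" using normr_cj[OF h(1) XG] normX by simp
    qed
    then show False using h by blast
  qed
  ultimately have cN: "card N = q ^ 2" using r by (simp add: power2_eq_square)
  have ppN: "prime_power_card q N" unfolding prime_power_card_def using cN by blast
  have NG: "N \<subseteq> carrier G" using subgroup.subset[OF N] .
  have H1: "Z \<inter> M = E \<or> M \<subseteq> Z" if Z: "subgroup Z G" "E \<subseteq> Z" for Z
  proof -
    have s: "subgroup (Z \<inter> M) G" using subgroup_Int[OF Z(1) M] .
    obtain j where j: "card (Z \<inter> M) = q * j" using card_dvd[OF E(1) s] Z(2) E(2) q_def by (auto simp: dvd_def)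
    moreover have "card (Z \<inter> M) dvd q * p" using card_dvd[OF s M] cM by simp
    ultimately have "j dvd p" using q by (simp add: prime_gt_0_nat)
    then have "j = 1 \<or> j = p" using p prime_nat_iff by blast
    then show ?thesis
    proof
      assume "j = 1"
      then have "E = Z \<inter> M" using subgroup_eqI[OF s, of E] j Z(2) E(2) q_def by auto
      then show ?thesis by simp
    next
      assume "j = p"
      then have "Z \<inter> M = M" using subgroup_eqI[OF M, of "Z \<inter> M"] j cM by auto
      then show ?thesis by blast
    qed
  qed
  \<comment> \<open>As \<open>E\<close> has prime index in \<open>M\<close>, the group
    \<open>Z\<close> meets \<open>M\<close> in \<open>E\<close> or contains \<open>M\<close>. In the
    first case \<open>h2\<close> gives \<open>Z = N\<close>.\<close>
  have H2: "M \<subseteq> Z" if Z: "subgroup Z G" "N \<subseteq> Z" "Z \<noteq> N" for Z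
  proof (rule ccontr)
    assume "\<not> M \<subseteq> Z"
    then have "Z \<inter> M = E" using H1[OF Z(1)] EN Z(2) by blast
    then have "N = Z" using h2[OF N Z(1,2) NnM] EN by blast
    then show False using Z(3) by simp
  qed
  \<comment> \<open>Otherwise \<open>M\<close> normalizes \<open>N\<close>, hence also
    \<open>E = N \<inter> M\<close>, which \<open>x\<close> does not normalize.\<close>
  have nN: "normr G N = N"
  proof (rule ccontr)
    assume "normr G N \<noteq> N"
    then have "M \<subseteq> normr G N" using H2[OF normr_subgroup[OF NG] normr_super[OF N]] by blast
    then have "cj G x ` N = N" using x XM by (auto simp: normr_def)
    moreover have "cj G x ` M = M" using cj_self_image[OF M] x XM by blast
    ultimately have "cj G x ` E \<subseteq> E" using NM by blast
    then show False using xN by blast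
  qed
  \<comment> \<open>A nontrivial intersection has order \<open>q\<close> and is normalized by two
    different groups of order \<open>q^2\<close>, so its normalizer contains \<open>M\<close>. Then
    \<open>X\<close> centralizes it, which forces it to be \<open>E\<close>; but \<open>X\<close>
    does not normalize \<open>E\<close>.\<close>
  have TI: "cj G k ` N \<inter> N = {\<one>}" if k: "k \<in> carrier G" "k \<notin> normr G N" for k
  proof (rule ccontr)
    assume ne: "cj G k ` N \<inter> N \<noteq> {\<one>}"
    let ?W = "cj G k ` N \<inter> N"
    have N': "subgroup (cj G k ` N) G" "card (cj G k ` N) = q ^ 2" using cj_subgroup[OF k(1) N] cj_card[OF k(1) NG] cN by auto
    have W: "subgroup ?W G" using subgroup_Int[OF N'(1) N] .
    have kN: "cj G k ` N \<noteq> N" using k by (simp add: normr_def)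
    have WN: "?W \<noteq> N" using subgroup_eqI[OF N'(1), of N] N'(2) cN kN by auto
    have WN': "?W \<noteq> cj G k ` N" using subgroup_eqI[OF N, of "cj G k ` N"] N'(2) cN kN by auto
    have WG: "?W \<subseteq> carrier G" using NG by blast
    obtain i where i: "i \<le> 2" "card ?W = q ^ i" using card_dvd[OF W N] cN divides_primepow_nat[OF q] by auto
    have cW: "card ?W = q"
    proof -
      have "i \<noteq> 0" using i ne card_one_iff[OF W] by auto
      moreover have "i \<noteq> 2" using i subgroup_eqI[OF N, of ?W] cN WN by auto
      ultimately have "i = 1" using i(1) by simp
      then show ?thesis using i by simp
    qed
    have norm: "R \<subseteq> normr G ?W" if R: "subgroup R G" "card R = q ^ 2" "?W \<subset> R" for R
    proof -
      have ppR: "prime_power_card q R" unfolding prime_power_card_def using R by blast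
      obtain y where y: "y \<in> R" "y \<notin> ?W" "cj G y ` ?W = ?W"
        using normalizer_grows[OF R(1) q ppR W R(3)] by blast
      let ?V = "normr G ?W \<inter> R"
      have V: "subgroup ?V G" using subgroup_Int[OF normr_subgroup[OF WG] R(1)] .
      have "y \<in> ?V" using y subgroup.mem_carrier[OF R(1)] by (simp add: normr_def)
      moreover have "?W \<subseteq> ?V" using normr_super[OF W] R(3) by blast
      ultimately have "card ?W < card ?V" using y(2) sub_finite[OF V] by (intro psubset_card_mono) auto
      moreover obtain j where j: "j \<le> 2" "card ?V = q ^ j" using card_dvd[OF V R(1)] R(2) divides_primepow_nat[OF q] by auto
      ultimately have "q ^ 1 < q ^ j" using cW by simp
      then have "1 < j" using prime_gt_1_nat[OF q] power_strict_increasing_iff by blast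
      then have "j = 2" using j(1) by simp
      then have "?V = R" using subgroup_eqI[OF R(1) Int_lower2] j R(2) by simp
      then show ?thesis by blast
    qed
    have "N \<subseteq> normr G ?W" "cj G k ` N \<subseteq> normr G ?W"
      using norm[OF N cN] norm[OF N'] WN WN' by blast+
    moreover from this have "normr G ?W \<noteq> N" using subgroup_eqI[OF N, of "cj G k ` N"] N'(2) cN kN by auto
    ultimately have MZ: "M \<subseteq> normr G ?W" using H2[OF normr_subgroup[OF WG]] by blast
    have pW: "prime (card ?W)" using cW q by simp
    have "cj G y u = u" if "y \<in> X" "u \<in> ?W" for y u
    proof (rule prime_card_aut_trivial[OF W pW X_p_elem[OF that(1)] p _ _ that(2)])
      show "\<not> p dvd card ?W - 1" using pq cW by simp
      show "cj G y c \<in> ?W" if "c \<in> ?W" for c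
      proof -
        have "y \<in> normr G ?W" using \<open>y \<in> X\<close> XM MZ by blast
        then show ?thesis using that unfolding normr_def by blast
      qed
    qed
    then have "?W \<subseteq> M" using fixes_X_imp_M WG by blast
    then have "?W \<subseteq> E" using NM by blast
    then have "?W = E" using subgroup_eqI[OF E(1)] cW q_def by simp
    moreover have "cj G x ` ?W = ?W" using x XM MZ unfolding normr_def by blast
    ultimately show False using xN by simp
  qed
  have pe: "p_elem G q v" if "v \<in> N" for v using p_elem_in[OF N ppN that] .
  obtain a b where ab: "a * card (normr G N) = order G * (card N - 1)" "b * card M = order G * (p - 1)" "a + b < order G"
    using count_two_TI[OF N TI q qp pe] by blast
  define n where "n = order G"
  have 1: "a * (q * q) = n * (q * q - 1)" using ab(1) nN cN by (simp add: n_def power2_eq_square)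
  have 2: "b * (q * p) = n * (p - 1)" using ab(2) cM by (simp add: n_def)
  \<comment> \<open>The count is contradictory once \<open>1/q^2\<close> is at most
    \<open>(p - 1)/(q p)\<close>. Cleared of denominators this is \<open>p \<le> (p - 1) q\<close>,
    which holds because both primes are at least 2.\<close>
  have "n * p \<le> n * ((p - 1) * q)"
  proof -
    obtain s where s: "q = s + 2" using prime_ge_2_nat[OF q] by (metis add.commute le_Suc_ex)
    obtain t where t: "p = t + 2" using prime_ge_2_nat[OF p] by (metis add.commute le_Suc_ex)
    show ?thesis unfolding s t by (intro mult_left_mono) (auto simp: algebra_simps)
  qed
  also have "\<dots> = b * (q * q * p)" using arg_cong[OF 2, of "\<lambda>x. q * x"] by (simp only: ac_simps)
  finally have "n * p \<le> (b * (q * q)) * p" by (simp add: ac_simps)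
  then have 3: "n \<le> b * (q * q)" using prime_gt_0_nat[OF p] by simp
  have "a * (q * q) + n = n * (q * q)" using 1 prime_gt_0_nat[OF q] by (simp add: algebra_simps diff_mult_distrib2)
  then have "n * (q * q) \<le> (a + b) * (q * q)" using 3 by (simp add: algebra_simps)
  then have "n \<le> a + b" using prime_gt_0_nat[OF q] by simp
  then show False using ab(3) n_def by simp
qed

end

section \<open>The p-core\<close>

text \<open>The group \<open>O\<^sub>p(H)\<close>: for finite \<open>H\<close> the union is itself
  one of its members, as \<open>p_core\<close> shows. Keeping the ambient \<open>G\<close> allows
  cores of different subgroups to be compared.\<close>

definition p_core :: "('a, 'b) monoid_scheme \<Rightarrow> nat \<Rightarrow> 'a set \<Rightarrow> 'a set" where
  "p_core G p H = \<Union>{N. subgroup N G \<and> N \<subseteq> H \<and> normalizes G H N \<and> prime_power_card p N}"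

context fin_group
begin

lemma ex_max_card:
  assumes "Q H" "\<And>N. Q N \<Longrightarrow> N \<subseteq> carrier G"
  obtains N where "Q N" "\<And>L. Q L \<Longrightarrow> card L \<le> card N"
proof -
  have "\<forall>y. Q y \<longrightarrow> card y < Suc (order G)"
    using assms(2) card_mono[OF fin] by (auto simp: order_def less_Suc_eq_le)
  then show ?thesis using ex_has_greatest_nat[of Q H card "Suc (order G)"] assms(1) that by blast
qed

text \<open>Each coset is replaced by a chosen representative, so the quotient has elements of the
  same type as \<open>G\<close>. This is what lets inductions on the order pass to
  quotients.\<close>

lemma exists_quotient:
  assumes "N \<lhd> G"
  obtains K :: "'a monoid" and f where "fin_group K" "group_hom G K f" "f ` carrier G = carrier K"
    "\<And>x. x \<in> carrier G \<Longrightarrow> f x = \<one>\<^bsub>K\<^esub> \<longleftrightarrow> x \<in> N" "order G = order K * card N"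
proof -
  interpret N: normal N G by fact
  let ?r = "\<lambda>U. SOME g. g \<in> U"
  let ?K = "flatten (G Mod N) ?r"
  have inj: "inj_on ?r (carrier (G Mod N))" by (rule N.flatten_set_group_mod_inj)
  have car: "carrier ?K = ?r ` carrier (G Mod N)" by (simp add: flatten_def)
  have gK: "group ?K" by (rule N.flatten_set_group_mod)
  have h1: "(\<lambda>x. N #> x) \<in> hom G (G Mod N)" by (rule N.r_coset_hom_Mod)
  have h2: "?r \<in> hom (G Mod N) ?K"
    using flatten_set_group_hom[OF N.factorgroup_is_group inj] .
  let ?f = "\<lambda>x. ?r (N #> x)"
  have h: "?f \<in> hom G ?K" using h1 h2 by (auto simp: hom_def Pi_iff)
  then interpret f: group_hom G ?K ?f using gK is_group by (simp add: group_hom_def group_hom_axioms_def)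
  have sur: "?f ` carrier G = carrier ?K" unfolding car carrier_FactGroup by (simp add: image_image)
  have finK: "finite (carrier ?K)" using fin sur by (metis finite_imageI)
  have oneK: "\<one>\<^bsub>?K\<^esub> = ?r N" by (simp add: flatten_def)
  have N1: "N \<in> carrier (G Mod N)" using monoid.one_closed[OF group.is_monoid[OF N.factorgroup_is_group]] by simp
  have ker: "?f x = \<one>\<^bsub>?K\<^esub> \<longleftrightarrow> x \<in> N" if x: "x \<in> carrier G" for x
  proof -
    have "?f x = \<one>\<^bsub>?K\<^esub> \<longleftrightarrow> N #> x = N" unfolding oneK using inj_on_eq_iff[OF inj _ N1, of "N #> x"] x
      by (auto simp: carrier_FactGroup)
    also have "\<dots> \<longleftrightarrow> x \<in> N" using coset_join1[OF _ x N.subgroup_axioms] coset_join2[OF x N.subgroup_axioms] N.subset by blast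
    finally show ?thesis .
  qed
  have "card (carrier ?K) = card (carrier (G Mod N))" unfolding car using inj by (rule card_image)
  then have "order G = order ?K * card N" using lagrange[OF N.subgroup_axioms] by (simp add: order_def FactGroup_def)
  then show ?thesis using that[of ?K ?f] gK finK f.group_hom_axioms sur ker
    by (auto simp: fin_group_def fin_group_axioms_def)
qed

lemma p_core_greatest:
  "subgroup N G \<Longrightarrow> N \<subseteq> H \<Longrightarrow> normalizes G H N \<Longrightarrow> prime_power_card p N \<Longrightarrow> N \<subseteq> p_core G p H"
  unfolding p_core_def by blast

text \<open>The product of two normal \<open>p\<close>-subgroups of \<open>H\<close> is again one,
  so one of largest order contains all the others.\<close>

lemma p_core:
  assumes H: "subgroup H G" and p: "prime p"
  shows "subgroup (p_core G p H) G" "p_core G p H \<subseteq> H" "normalizes G H (p_core G p H)"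
    "prime_power_card p (p_core G p H)"
proof -
  let ?Q = "\<lambda>N. subgroup N G \<and> N \<subseteq> H \<and> normalizes G H N \<and> prime_power_card p N"
  have "\<one> \<in> H" using subgroup.one_closed[OF H] .
  then have base: "?Q {\<one>}" using subgroup.mem_carrier[OF H]
    by (auto simp: normalizes_def prime_power_card_def triv_subgroup intro: exI[of _ 0])
  obtain N where N: "?Q N" and max: "\<And>L. ?Q L \<Longrightarrow> card L \<le> card N"
    by (rule ex_max_card[of ?Q, OF base]) (auto dest: subgroup.subset)
  have "L \<subseteq> N" if L: "?Q L" for L
  proof -
    have nLN: "normalizes G L N" using N L by (auto simp: normalizes_def)
    have s: "subgroup (L <#> N) G" using set_mult_subgroupI nLN N L by blast
    have c: "L \<subseteq> L <#> N" "N \<subseteq> L <#> N" using set_mult_contains N L by blast+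
    have "?Q (L <#> N)"
    proof (intro conjI s)
      show "L <#> N \<subseteq> H" using set_mult_least[OF H] N L by blast
      show "normalizes G H (L <#> N)" unfolding normalizes_def
      proof (intro ballI)
        fix h u assume h: "h \<in> H" and "u \<in> L <#> N"
        then obtain l n where ln: "l \<in> L" "n \<in> N" "u = l \<otimes> n" by (auto simp: set_mult_def)
        have "cj G h u = cj G h l \<otimes> cj G h n"
          using ln h N L subgroup.mem_carrier[OF H] by (auto simp: cj_mult subset_iff)
        moreover have "cj G h l \<in> L" "cj G h n \<in> N" using N L h ln by (auto simp: normalizes_def)
        ultimately show "cj G h u \<in> L <#> N" using set_multI by simp
      qed
      obtain i j where ij: "card L = p ^ i" "card N = p ^ j" using N L prime_power_card_def by blast
      have "card (L <#> N) * card (L \<inter> N) = p ^ (i + j)" using card_set_mult[of L N] N L ij by (simp add: power_add)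
      then show "prime_power_card p (L <#> N)" unfolding prime_power_card_def
        using divides_primepow_nat[OF p] by (metis dvd_triv_left)
    qed
    then have "card (L <#> N) \<le> card N" by (rule max)
    then have "N = L <#> N" using c(2) card_seteq[OF sub_finite[OF s] c(2)] by blast
    then show ?thesis using c(1) by blast
  qed
  then have "p_core G p H = N" using N unfolding p_core_def by blast
  then show "subgroup (p_core G p H) G" "p_core G p H \<subseteq> H" "normalizes G H (p_core G p H)"
    "prime_power_card p (p_core G p H)" using N by auto
qed

lemma p_core_cj_closed:
  assumes H: "subgroup H G" and p: "prime p" and g: "g \<in> carrier G"
  shows "cj G g ` p_core G p H \<subseteq> p_core G p (cj G g ` H)"
proof (rule p_core_greatest)
  note c = p_core[OF H p]
  have cG: "p_core G p H \<subseteq> carrier G" and HG: "H \<subseteq> carrier G" using c(1) H subgroup.subset by auto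
  show "subgroup (cj G g ` p_core G p H) G" using cj_subgroup[OF g c(1)] .
  show "cj G g ` p_core G p H \<subseteq> cj G g ` H" using c(2) by blast
  show "prime_power_card p (cj G g ` p_core G p H)" using c(4) cj_card[OF g cG] by (simp add: prime_power_card_def)
  have "cj G (cj G g h) (cj G g n) = cj G g (cj G h n)" if "h \<in> carrier G" "n \<in> carrier G" for h n
    using that g by (simp add: cj_def inv_mult_group m_assoc)
  then show "normalizes G (cj G g ` H) (cj G g ` p_core G p H)"
    using c(3) cG HG by (auto simp: normalizes_def subset_iff)
qed

text \<open>The core of \<open>L\<close> is preserved by every conjugation that preserves
  \<open>L\<close>, in particular by those with elements of \<open>H\<close>.\<close>

lemma p_core_normal:
  assumes H: "subgroup H G" and p: "prime p" and L: "subgroup L G" "L \<subseteq> H" "normalizes G H L"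
  shows "p_core G p L \<subseteq> p_core G p H"
proof (rule p_core_greatest)
  note c = p_core[OF L(1) p]
  show "subgroup (p_core G p L) G" "p_core G p L \<subseteq> H" "prime_power_card p (p_core G p L)" using c L by auto
  have "cj G h ` p_core G p L \<subseteq> p_core G p L" if h: "h \<in> H" for h
  proof -
    have hG: "h \<in> carrier G" using h subgroup.mem_carrier[OF H] by blast
    have "cj G h ` L = L"
      using normalizes_eq[OF sub_finite[OF L(1)] _ _ L(3) h] subgroup.subset[OF H] subgroup.subset[OF L(1)] by blast
    then show ?thesis using p_core_cj_closed[OF L(1) p hG] by simp
  qed
  then show "normalizes G H (p_core G p L)" by (auto simp: normalizes_def)
qed

lemma p_core_Int:
  assumes H: "subgroup H G" and p: "prime p" and L: "subgroup L G" "L \<subseteq> H"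
  shows "p_core G p H \<inter> L \<subseteq> p_core G p L"
proof (rule p_core_greatest)
  note c = p_core[OF H p]
  show s: "subgroup (p_core G p H \<inter> L) G" using subgroup_Int[OF c(1) L(1)] .
  show "prime_power_card p (p_core G p H \<inter> L)" using prime_power_card_sub[OF s c(1) _ p c(4)] by blast
  have "cj G l ` L = L" if "l \<in> L" for l using cj_self_image[OF L(1) that] .
  then show "normalizes G L (p_core G p H \<inter> L)" using c(3) L(2) by (auto simp: normalizes_def)
qed blast

lemma p_core_consistent:
  assumes Z: "subgroup Z G" and H: "H \<subseteq> Z"
  shows "p_core (G\<lparr>carrier := Z\<rparr>) p H = p_core G p H"
proof -
  have "subgroup N (G\<lparr>carrier := Z\<rparr>) \<and> N \<subseteq> H \<and> normalizes (G\<lparr>carrier := Z\<rparr>) H N \<and> prime_power_card p N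
    \<longleftrightarrow> subgroup N G \<and> N \<subseteq> H \<and> normalizes G H N \<and> prime_power_card p N" for N
    using subgroup_subset_iff[OF Z, of N] H cj_consistent[OF Z subsetD[OF H]] by (auto simp: normalizes_def)
  then show ?thesis by (simp add: p_core_def)
qed

lemma exists_maximal_subgroup:
  assumes "subgroup H G" "H \<noteq> carrier G"
  obtains W where "subgroup W G" "W \<noteq> carrier G" "H \<subseteq> W"
    "\<And>Y. subgroup Y G \<Longrightarrow> W \<subseteq> Y \<Longrightarrow> Y = W \<or> Y = carrier G"
proof -
  let ?Q = "\<lambda>W. subgroup W G \<and> W \<noteq> carrier G \<and> H \<subseteq> W"
  have base: "?Q H" using assms by simp
  obtain W where W: "?Q W" and max: "\<And>L. ?Q L \<Longrightarrow> card L \<le> card W"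
    by (rule ex_max_card[of ?Q, OF base]) (auto dest: subgroup.subset)
  have "Y = W \<or> Y = carrier G" if Y: "subgroup Y G" "W \<subseteq> Y" for Y
  proof (rule ccontr)
    assume "\<not> ?thesis"
    then have "?Q Y" "Y \<noteq> W" using Y W by auto
    then have "card Y \<le> card W" using max by blast
    then show False using \<open>Y \<noteq> W\<close> card_seteq[OF sub_finite[OF Y(1)] Y(2)] by simp
  qed
  then show ?thesis using that W by blast
qed

end

lemma (in group_hom) cj_hom_image: "x \<in> carrier G \<Longrightarrow> y \<in> carrier G \<Longrightarrow> h (cj G x y) = cj H (h x) (h y)"
  by (simp add: cj_def)

lemma p_core_image:
  assumes "group_hom G K f" "fin_group G" "fin_group K" and H: "subgroup H G" and p: "prime p"
  shows "f ` p_core G p H \<subseteq> p_core K p (f ` H)"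
proof -
  interpret f: group_hom G K f by fact
  interpret G: fin_group G by fact
  interpret K: fin_group K by fact
  note c = G.p_core[OF H p]
  show ?thesis
  proof (rule K.p_core_greatest)
    show "subgroup (f ` p_core G p H) K" using f.subgroup_img_is_subgroup[OF c(1)] .
    show "f ` p_core G p H \<subseteq> f ` H" using c(2) by blast
    show "normalizes K (f ` H) (f ` p_core G p H)"
      using c(3) subgroup.mem_carrier[OF H] subgroup.mem_carrier[OF c(1)]
      by (auto simp: normalizes_def simp flip: f.cj_hom_image)
    show "prime_power_card p (f ` p_core G p H)"
    proof (rule K.prime_power_cardI[OF _ p])
      show "subgroup (f ` p_core G p H) K" using f.subgroup_img_is_subgroup[OF c(1)] .
      fix y assume "y \<in> f ` p_core G p H"
      then obtain x where x: "x \<in> p_core G p H" "y = f x" by blast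
      have "p_elem G p x" using G.p_elem_in[OF c(1) c(4) x(1)] .
      then show "p_elem K p y" unfolding p_elem_def x(2) by (metis f.hom_closed f.hom_nat_pow f.hom_one)
    qed
  qed
qed

section \<open>The p-core of a modular subgroup for the largest prime p\<close>

context fin_group
begin

lemma p_core_carrier_normal: "prime p \<Longrightarrow> p_core G p (carrier G) \<lhd> G"
  using p_core[OF subgroup_self] by (simp add: normal_iff_normalizes)

text \<open>Wielandt's zipper lemma, for elements that lie in the \<open>p\<close>-core of every proper
  subgroup containing them.\<close>

lemma unique_maximal_subgroup:
  assumes p: "prime p" and core: "p_core G p (carrier G) = {\<one>}"
    and local_core: "\<Gamma> = {y \<in> carrier G. \<forall>Z. subgroup Z G \<longrightarrow> Z \<noteq> carrier G \<longrightarrow> y \<in> Z \<longrightarrow> y \<in> p_core G p Z}"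
    and maxi: "\<And>W. maxi W \<longleftrightarrow> subgroup W G \<and> W \<noteq> carrier G \<and> (\<forall>Y. subgroup Y G \<longrightarrow> W \<subseteq> Y \<longrightarrow> Y = W \<or> Y = carrier G)"
    and y: "y \<in> \<Gamma>" "y \<noteq> \<one>" and W: "maxi W1" "maxi W2" "y \<in> W1" "y \<in> W2"
  shows "W1 = W2"
proof (rule ccontr)
  assume ne: "W1 \<noteq> W2"
  have GC: "\<Gamma> \<subseteq> carrier G" using local_core by blast
  have Gcore: "\<Gamma> \<inter> Z \<subseteq> p_core G p Z" if "subgroup Z G" "Z \<noteq> carrier G" for Z
    using that local_core by blast
  \<comment> \<open>Conjugation permutes the proper subgroups together with their cores.\<close>
  have Gcj: "cj G g z \<in> \<Gamma>" if g: "g \<in> carrier G" and z: "z \<in> \<Gamma>" for g z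
  proof -
    have zG: "z \<in> carrier G" using z GC by blast
    have "cj G g z \<in> p_core G p Z" if Z: "subgroup Z G" "Z \<noteq> carrier G" "cj G g z \<in> Z" for Z
    proof -
      have ig: "inv g \<in> carrier G" using g by simp
      have ZG: "Z \<subseteq> carrier G" using Z subgroup.subset by blast
      let ?Z = "cj G (inv g) ` Z"
      have sZ: "subgroup ?Z G" using cj_subgroup[OF ig Z(1)] .
      have "?Z \<noteq> carrier G" using cj_image_cancel(2)[OF g ZG] cj_carrier_image[OF g] Z(2) by auto
      moreover have "z \<in> ?Z" using cj_image_iff[OF ig zG ZG] g Z(3) by simp
      ultimately have "z \<in> p_core G p ?Z" using z sZ local_core by blast
      then have "cj G g z \<in> p_core G p (cj G g ` ?Z)" using p_core_cj_closed[OF sZ p g] by blast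
      then show ?thesis using cj_image_cancel(2)[OF g ZG] by simp
    qed
    then show ?thesis using local_core g zG by simp
  qed
  \<comment> \<open>The zipper argument starts from two different maximal subgroups whose
    intersection inside \<Gamma> is nontrivial and as large as possible.\<close>
  define Q where "Q S \<longleftrightarrow> (\<exists>Z1 Z2. S = \<Gamma> \<inter> Z1 \<inter> Z2 \<and> maxi Z1 \<and> maxi Z2 \<and> Z1 \<noteq> Z2 \<and> \<not> S \<subseteq> {\<one>})" for S
  have "\<not> \<Gamma> \<inter> W1 \<inter> W2 \<subseteq> {\<one>}" using W(3,4) y by blast
  then have base: "Q (\<Gamma> \<inter> W1 \<inter> W2)" unfolding Q_def using W(1,2) ne by metis
  have QG: "N \<subseteq> carrier G" if "Q N" for N using that GC unfolding Q_def by auto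
  obtain S where S: "Q S" and max: "\<And>L. Q L \<Longrightarrow> card L \<le> card S"
    by (rule ex_max_card[of Q, OF base QG]) blast+
  obtain Z1 Z2 where Z: "S = \<Gamma> \<inter> Z1 \<inter> Z2" "maxi Z1" "maxi Z2" "Z1 \<noteq> Z2" "\<not> S \<subseteq> {\<one>}" using S unfolding Q_def by (elim exE conjE) auto
  have SG: "S \<subseteq> carrier G" using Z GC by blast
  have finS: "finite S" using SG fin finite_subset by blast
  let ?T = "generate G S"
  have T: "subgroup ?T G" using generate_is_subgroup[OF SG] .
  have TG: "?T \<subseteq> carrier G" using subgroup.subset[OF T] .
  have normT: "g \<in> normr G ?T" if g: "g \<in> carrier G" and gS: "cj G g ` S = S" for g
  proof -
    interpret c: group_hom G G "cj G g" using cj_hom[OF g] .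
    have "cj G g ` ?T = generate G (cj G g ` S)" using c.image_generate[OF SG] .
    then show ?thesis using g gS by (simp add: normr_def)
  qed
  have fixS: "cj G g ` S = S" if g: "g \<in> carrier G" and L: "cj G g ` L = L" "\<Gamma> \<inter> L = S" for g L
  proof -
    have "cj G g ` S \<subseteq> S" using Gcj[OF g] L by blast
    moreover have "card (cj G g ` S) = card S" using cj_card[OF g SG] .
    ultimately show ?thesis using finS card_subset_eq by blast
  qed
  have step: "Y1 \<subseteq> normr G ?T \<or> (\<exists>c\<in>\<Gamma> \<inter> Y1. c \<notin> Y2 \<and> c \<in> normr G ?T)"
    if Y: "S = \<Gamma> \<inter> Y1 \<inter> Y2" "maxi Y1" "maxi Y2" for Y1 Y2
  proof (cases "\<Gamma> \<inter> Y1 \<subseteq> Y2")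
    case True
    have sY: "subgroup Y1 G" using Y(2) unfolding maxi by simp
    have "Y1 \<subseteq> normr G ?T"
    proof
      fix g assume g: "g \<in> Y1"
      have gG: "g \<in> carrier G" using subgroup.mem_carrier[OF sY g] .
      have "\<Gamma> \<inter> Y1 = S" using True Y by blast
      then show "g \<in> normr G ?T" using normT[OF gG fixS[OF gG cj_self_image[OF sY g]]] by blast
    qed
    then show ?thesis by simp
  next
    case False
    have sY: "subgroup Y1 G" "Y1 \<noteq> carrier G" "subgroup Y2 G" using Y(2,3) unfolding maxi by simp_all
    let ?P = "p_core G p Y1"
    note P = p_core[OF sY(1) p]
    have GP: "\<Gamma> \<inter> Y1 \<subseteq> ?P" using Gcore sY by blast
    \<comment> \<open>Among the subgroups of \<open>?P\<close> that meet \<Gamma> exactly in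
      \<open>S\<close> a largest one \<open>L\<close> is taken. It is proper in \<open>?P\<close>,
      so its normalizer there is larger and contains a new element of \<Gamma>, which preserves
      \<open>\<Gamma> \<inter> L = S\<close>.\<close>
    define R where "R L \<longleftrightarrow> subgroup L G \<and> L \<subseteq> ?P \<and> \<Gamma> \<inter> L = S" for L
    have "?T \<subseteq> ?P" by (rule generate_mono_sub[OF P(1)]) (use GP Y(1) in blast)
    moreover have "?T \<subseteq> Y1 \<inter> Y2" by (rule generate_mono_sub[OF subgroup_Int[OF sY(1,3)]]) (use Y(1) in blast)
    moreover have "S \<subseteq> ?T" using generate_subset[OF SG] .
    ultimately have base: "R ?T" unfolding R_def using T Y(1) by auto
    have RG: "N \<subseteq> carrier G" if "R N" for N using that subgroup.subset unfolding R_def by auto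
    obtain L where L: "R L" and maxL: "\<And>L'. R L' \<Longrightarrow> card L' \<le> card L"
      by (rule ex_max_card[of R, OF base RG]) blast+
    have sL: "subgroup L G" and LP: "L \<subseteq> ?P" and LS: "\<Gamma> \<inter> L = S" using L unfolding R_def by auto
    have LG: "L \<subseteq> carrier G" using subgroup.subset[OF sL] .
    have "L \<subset> ?P" using LP LS False GP Y(1) by blast
    then obtain g where g: "g \<in> ?P" "g \<notin> L" "cj G g ` L = L"
      using normalizer_grows[OF P(1) p P(4) sL] by blast
    let ?L = "normr G L \<inter> ?P"
    have sL': "subgroup ?L G" using subgroup_Int[OF normr_subgroup[OF LG] P(1)] .
    have gL: "g \<in> ?L" using g subgroup.mem_carrier[OF P(1)] by (simp add: normr_def)
    have LL: "L \<subseteq> ?L" using normr_super[OF sL] LP by blast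
    have "card L < card ?L" using gL LL g(2) by (intro psubset_card_mono[OF sub_finite[OF sL']]) blast
    then have "\<not> R ?L" using maxL by (meson leD)
    then have "\<Gamma> \<inter> ?L \<noteq> S" using sL' unfolding R_def by simp
    moreover have "S \<subseteq> \<Gamma> \<inter> ?L" using LL LS by blast
    ultimately obtain c where c: "c \<in> \<Gamma>" "c \<in> ?L" "c \<notin> S" by blast
    have cY: "c \<in> Y1" using c P(2) by blast
    then have "c \<notin> Y2" using c Y(1) by blast
    moreover have cG: "c \<in> carrier G" using c GC by blast
    have "c \<in> normr G ?T" 
      using normT[OF cG fixS[OF cG, of L]] c(2) LS by (simp add: normr_def)
    ultimately show ?thesis using c cY by blast
  qed
  have sZ: "subgroup Z1 G" "Z1 \<noteq> carrier G" "subgroup Z2 G" "Z2 \<noteq> carrier G" using Z(2,3) unfolding maxi by simp_all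
  have TZ: "?T \<subseteq> Z1" by (rule generate_mono_sub[OF sZ(1)]) (use Z(1) in blast)
  \<comment> \<open>Otherwise \<open>?T\<close>, a \<open>p\<close>-group inside the core of
    \<open>Z1\<close>, would be normal in \<open>G\<close>.\<close>
  have "normr G ?T \<noteq> carrier G"
  proof
    assume a: "normr G ?T = carrier G"
    have "S \<subseteq> p_core G p Z1" using Z(1) Gcore[OF sZ(1,2)] by blast
    then have "?T \<subseteq> p_core G p Z1" by (rule generate_mono_sub[OF p_core(1)[OF sZ(1) p]])
    then have "prime_power_card p ?T" using prime_power_card_sub[OF T _ _ p] p_core[OF sZ(1) p] by blast
    moreover have "normalizes G (carrier G) ?T" using a unfolding normalizes_def normr_def by blast
    ultimately have "?T \<subseteq> {\<one>}" using p_core_greatest[OF T TG] core by blast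
    then show False using Z(5) generate_subset[OF SG] by blast
  qed
  \<comment> \<open>This maximal subgroup will equal both \<open>Z1\<close> and \<open>Z2\<close>:
    otherwise one of them would share with it a larger part of \<Gamma> than
    \<open>S\<close>.\<close>
  then obtain Z3 where Z3: "subgroup Z3 G" "Z3 \<noteq> carrier G" "normr G ?T \<subseteq> Z3"
    "\<And>Y. subgroup Y G \<Longrightarrow> Z3 \<subseteq> Y \<Longrightarrow> Y = Z3 \<or> Y = carrier G"
    using exists_maximal_subgroup[OF normr_subgroup[OF TG]] by blast
  have mZ3: "maxi Z3" unfolding maxi using Z3 by simp
  have SZ3: "S \<subseteq> Z3" using generate_subset[OF SG] normr_super[OF T] Z3(3) by blast
  have eq: "Y1 = Z3" if Y: "S = \<Gamma> \<inter> Y1 \<inter> Y2" "maxi Y1" "maxi Y2" for Y1 Y2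
  proof (rule ccontr)
    assume n: "Y1 \<noteq> Z3"
    from step[OF Y] show False
    proof
      assume "Y1 \<subseteq> normr G ?T"
      then have "Y1 \<subseteq> Z3" using Z3(3) by blast
      then show False using Y(2) Z3(1,2) n unfolding maxi by metis
    next
      assume "\<exists>c\<in>\<Gamma> \<inter> Y1. c \<notin> Y2 \<and> c \<in> normr G ?T"
      then obtain c where c: "c \<in> \<Gamma>" "c \<in> Y1" "c \<notin> Y2" "c \<in> Z3" using Z3(3) by blast
      have sub: "S \<subseteq> \<Gamma> \<inter> Y1 \<inter> Z3" using Y(1) SZ3 by blast
      have "\<not> \<Gamma> \<inter> Y1 \<inter> Z3 \<subseteq> {\<one>}" using sub Z(5) by blast
      then have "Q (\<Gamma> \<inter> Y1 \<inter> Z3)" unfolding Q_def using Y(2) mZ3 n by metis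
      then have le: "card (\<Gamma> \<inter> Y1 \<inter> Z3) \<le> card S" by (rule max)
      have "finite (\<Gamma> \<inter> Y1 \<inter> Z3)" using GC fin finite_subset by blast
      then have "S = \<Gamma> \<inter> Y1 \<inter> Z3" using card_seteq sub le by blast
      then show False using c Y(1) by blast
    qed
  qed
  have "Z1 = Z3" using eq[OF Z(1,2,3)] .
  moreover have "Z2 = Z3" using eq[of Z2 Z1] Z by blast
  ultimately show False using Z(4) by simp
qed

end

text \<open>The induction hypothesis reaches proper subgroups through
  \<open>modular_restrict\<close> and proper quotients through \<open>modular_image\<close>. What
  survives these reductions is a \<open>maximal_modular_configuration\<close>.\<close>

lemma p_core_modular_step:
  fixes G :: "'a monoid" (structure)
  assumes "fin_group G" and p: "prime p" and largest: "\<And>q. prime q \<Longrightarrow> q dvd order G \<Longrightarrow> q \<le> p"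
    and M: "modular_subgroup M G"
    and IH: "\<And>(K :: 'a monoid) M. order K < order G \<Longrightarrow> fin_group K \<Longrightarrow>
      (\<And>q. prime q \<Longrightarrow> q dvd order K \<Longrightarrow> q \<le> p) \<Longrightarrow> modular_subgroup M K \<Longrightarrow>
      p_core K p M \<subseteq> p_core K p (carrier K)"
  shows "p_core G p M \<subseteq> p_core G p (carrier G)"
proof -
  interpret fin_group G by fact
  have sM: "subgroup M G" using M by (auto simp: modular_subgroup_def)
  have MG: "M \<subseteq> carrier G" using subgroup.subset[OF sM] .
  have order0: "order G > 0" using fin order_gt_0_iff_finite by simp
  define X where "X = p_core G p M"
  define P0 where "P0 = p_core G p (carrier G)"
  note cX = p_core[OF sM p, folded X_def] and cP0 = p_core[OF subgroup_self p, folded P0_def]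
  have XG: "X \<subseteq> carrier G" using cX MG by blast
  show ?thesis
  proof (rule ccontr)
    assume "\<not> ?thesis"
    then have nX: "\<not> X \<subseteq> P0" by (simp add: X_def P0_def)
    have one0: "\<one> \<in> P0" using subgroup.one_closed[OF cP0(1)] .
    have X_local: "X \<inter> Z \<subseteq> p_core G p Z" if Z: "subgroup Z G" "Z \<noteq> carrier G" for Z
    proof -
      let ?Z = "G\<lparr>carrier := Z\<rparr>"
      have ZG: "Z \<subseteq> carrier G" using subgroup.subset[OF Z(1)] .
      have "order ?Z < order G" using Z(2) ZG fin by (simp add: order_def psubset_card_mono psubset_eq)
      moreover have "q \<le> p" if "prime q" "q dvd order ?Z" for q
      proof -
        have "order ?Z dvd order G" using card_dvd_order[OF Z(1)] by (simp add: order_def)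
        then show ?thesis using that largest by (meson dvd_trans)
      qed
      ultimately have "p_core ?Z p (M \<inter> Z) \<subseteq> p_core ?Z p (carrier ?Z)"
        using IH[of ?Z "M \<inter> Z"] fin_group_sub[OF Z(1)] modular_restrict[OF M Z(1)] by blast
      then have 1: "p_core G p (M \<inter> Z) \<subseteq> p_core G p Z" using p_core_consistent[OF Z(1)] by simp
      have "X \<inter> (M \<inter> Z) \<subseteq> p_core G p (M \<inter> Z)"
        using p_core_Int[OF sM p subgroup_Int[OF sM Z(1)]] by (simp add: X_def)
      then show ?thesis using 1 cX(2) by blast
    qed
    have p_group: "X \<subseteq> P0" if "order G = p ^ k" for k
    proof -
      have "carrier G \<subseteq> P0" unfolding P0_def
        using that by (intro p_core_greatest subgroup_self) (auto simp: normalizes_def prime_power_card_def order_def)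
      then show ?thesis using XG by blast
    qed
    \<comment> \<open>\<open>X\<close> lies in the preimage \<open>L\<close> of the core of the
      quotient. If \<open>L\<close> were proper, \<open>X\<close> would lie in the core of this
      normal subgroup and so in that of \<open>G\<close>. Hence the quotient is a
      \<open>p\<close>-group.\<close>
    have quot: "\<exists>k. order G = p ^ k * card N" if N: "N \<lhd> G" "N \<noteq> {\<one>}" for N
    proof -
      have sN: "subgroup N G" using normal_imp_subgroup[OF N(1)] .
      obtain K :: "'a monoid" and f where K: "fin_group K" "group_hom G K f" "f ` carrier G = carrier K"
        "\<And>x. x \<in> carrier G \<Longrightarrow> f x = \<one>\<^bsub>K\<^esub> \<longleftrightarrow> x \<in> N" "order G = order K * card N"
        by (rule exists_quotient[OF N(1)]) blast
      interpret K: fin_group K by fact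
      interpret f: group_hom G K f by fact
      have "card N \<noteq> 1" using card_one_iff[OF sN] N(2) by simp
      then have "card N > 1" using card_pos[OF sN] by simp
      moreover have "order K > 0" using K(5) order0 by (cases "order K") auto
      ultimately have lt: "order K < order G" using K(5) by simp
      have "p_core K p (f ` M) \<subseteq> p_core K p (carrier K)"
        by (rule IH[OF lt K(1) _ f.modular_image[OF K(3) M]]) (use largest K(5) in simp)
      moreover have "f ` X \<subseteq> p_core K p (f ` M)"
        using p_core_image[OF K(2) fin_group_axioms K(1) sM p] by (simp add: X_def)
      ultimately have fX: "f ` X \<subseteq> p_core K p (carrier K)" by blast
      note cK = K.p_core[OF K.subgroup_self p]
      define L where "L = {x \<in> carrier G. f x \<in> p_core K p (carrier K)}"
      have L: "subgroup L G" unfolding L_def using f.preimage_subgroup[OF cK(1)] .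
      have XL: "X \<subseteq> L" using fX XG L_def by blast
      have "L = carrier G"
      proof (rule ccontr)
        assume n: "L \<noteq> carrier G"
        have "X \<subseteq> p_core G p L" using X_local[OF L n] XL by blast
        also have "\<dots> \<subseteq> P0" unfolding P0_def
        proof (rule p_core_normal[OF subgroup_self p L])
          show "normalizes G (carrier G) L"
            using cK(3) by (auto simp: normalizes_def L_def f.cj_hom_image)
        qed (use L_def in blast)
        finally show False using nX by simp
      qed
      then have "f ` L = carrier K" using K(3) by simp
      moreover have "f ` L \<subseteq> p_core K p (carrier K)" by (auto simp: L_def)
      ultimately have "carrier K = p_core K p (carrier K)" using cK(2) by simp
      then obtain k where "order K = p ^ k" using cK(4) unfolding prime_power_card_def order_def by metis
      then show ?thesis using K(5) by auto
    qed
    have P01: "P0 = {\<one>}"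
    proof (rule ccontr)
      assume "P0 \<noteq> {\<one>}"
      then obtain k where k: "order G = p ^ k * card P0" using quot p_core_carrier_normal[OF p] P0_def by blast
      obtain j where "card P0 = p ^ j" using cP0(4) prime_power_card_def by blast
      then have "order G = p ^ (k + j)" using k by (simp add: power_add)
      then show False using p_group nX by blast
    qed
    \<comment> \<open>A central subgroup of prime order \<open>r\<close> would have
      \<open>p\<close>-power index. For \<open>r = p\<close> the whole group is a
      \<open>p\<close>-group. Otherwise a Sylow \<open>p\<close>-subgroup is a complement normalized
      by everything, hence trivial, and \<open>X\<close> is trivial as well.\<close>
    have centre: "z = \<one>" if z: "z \<in> carrier G" "\<And>g. g \<in> carrier G \<Longrightarrow> cj G g z = z" for z
    proof (rule ccontr)
      assume z1: "z \<noteq> \<one>"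
      let ?C = "generate G {z}"
      have C: "subgroup ?C G" using generate_is_subgroup[of "{z}"] z by simp
      have "card ?C \<noteq> 1" using card_one_iff[OF C] z1 generate.incl[of z "{z}" G] by auto
      then obtain r where r: "prime r" "r dvd card ?C" using prime_factor_nat by blast
      obtain c where c: "c \<in> ?C" "c \<noteq> \<one>" "card (generate G {c}) = r" using cauchy[OF C r] by metis
      have cG: "c \<in> carrier G" using subgroup.mem_carrier[OF C c(1)] .
      have central: "cj G g u = u" if g: "g \<in> carrier G" and u: "u \<in> generate G {v}" and v: "v \<in> carrier G" "\<And>g. g \<in> carrier G \<Longrightarrow> cj G g v = v" for g u v
      proof -
        have s: "subgroup {y \<in> carrier G. cj G g y = y} G"
          by (rule subgroupI) (use g in \<open>auto simp: cj_mult cj_inv\<close>)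
        have "generate G {v} \<subseteq> {y \<in> carrier G. cj G g y = y}"
          by (rule generate_mono_sub[OF s]) (use v g in simp)
        then show ?thesis using u by blast
      qed
      let ?N = "generate G {c}"
      have N: "subgroup ?N G" using generate_is_subgroup[of "{c}"] cG by simp
      have "cj G g c = c" if "g \<in> carrier G" for g using central[OF that c(1) z] .
      then have "cj G g u = u" if "g \<in> carrier G" "u \<in> ?N" for g u using central[OF that cG] by blast
      then have "?N \<lhd> G" using N by (simp add: normal_iff_normalizes normalizes_def)
      moreover have "?N \<noteq> {\<one>}" using c(2) generate.incl[of c "{c}" G] by auto
      ultimately obtain k where k: "order G = p ^ k * r" using quot c(3) by metis
      have rp: "r \<noteq> p"
      proof
        assume "r = p"
        then have "order G = p ^ Suc k" using k by simp
        then show False using p_group nX by blast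
      qed
      obtain S where S: "subgroup S G" "card S = p ^ k" using sylow_thm[OF p is_group k fin] by blast
      have SG: "S \<subseteq> carrier G" using subgroup.subset[OF S(1)] .
      have NG: "?N \<subseteq> carrier G" using subgroup.subset[OF N] .
      have cc: "cj G g u = u" if "g \<in> carrier G" "u \<in> ?N" for g u using central[OF that cG] \<open>\<And>g. g \<in> carrier G \<Longrightarrow> cj G g c = c\<close> by blast
      have "coprime (card S) (card ?N)" using S(2) c(3) rp r(1) p by (simp add: primes_coprime)
      then have "card (S \<inter> ?N) = 1"
        using card_dvd[OF subgroup_Int[OF S(1) N] S(1)] card_dvd[OF subgroup_Int[OF S(1) N] N]
        by (metis Int_lower1 Int_lower2 coprime_common_divisor_nat)
      then have "card (S <#> ?N) = card (carrier G)" using card_set_mult[OF S(1) N] S(2) c(3) k by (simp add: order_def)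
      moreover have "S <#> ?N \<subseteq> carrier G" using setmult_subset_G[OF SG NG] .
      ultimately have SN: "S <#> ?N = carrier G" using fin card_subset_eq by blast
      have "normalizes G (carrier G) S" unfolding normalizes_def
      proof (intro ballI)
        fix g s assume g: "g \<in> carrier G" and s: "s \<in> S"
        have "g \<in> S <#> ?N" using g SN by simp
        then obtain t n where tn: "t \<in> S" "n \<in> ?N" "g = t \<otimes> n" by (auto simp: set_mult_def)
        have c3: "t \<in> carrier G" "n \<in> carrier G" "s \<in> carrier G" using tn s SG NG by auto
        have "cj G n s = s" using cc[OF c3(3) tn(2)] cj_fix_sym c3 by blast
        then have "cj G g s = cj G t s" using tn c3 by (simp add: cj_mult)
        then show "cj G g s \<in> S" using cj_self_image[OF S(1) tn(1)] s by blast
      qed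
      then have "S \<subseteq> P0" unfolding P0_def using S SG by (intro p_core_greatest) (auto simp: prime_power_card_def)
      then have "S = {\<one>}" using P01 subgroup.one_closed[OF S(1)] by blast
      then have "card S = 1" by simp
      then have "order G = r" using k S(2) by simp
      obtain j where j: "card X = p ^ j" using cX(4) prime_power_card_def by blast
      have "p ^ j dvd r" using card_dvd_order[OF cX(1)] j \<open>order G = r\<close> by simp
      then have "j = 0" using r(1) p rp by (metis dvd_power neq0_conv primes_dvd_imp_eq dvd_trans)
      then have "X = {\<one>}" using j card_one_iff[OF cX(1)] by simp
      then show False using nX one0 by simp
    qed
    define \<Gamma> where "\<Gamma> = {y \<in> carrier G. \<forall>Z. subgroup Z G \<longrightarrow> Z \<noteq> carrier G \<longrightarrow> y \<in> Z \<longrightarrow> y \<in> p_core G p Z}"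
    define maxi where "maxi W \<longleftrightarrow> subgroup W G \<and> W \<noteq> carrier G \<and> (\<forall>Y. subgroup Y G \<longrightarrow> W \<subseteq> Y \<longrightarrow> Y = W \<or> Y = carrier G)" for W
    note uniq = unique_maximal_subgroup[OF p P01[unfolded P0_def] \<Gamma>_def maxi_def]
    have X\<Gamma>: "X \<subseteq> \<Gamma>" using X_local XG \<Gamma>_def by blast
    have "M \<noteq> carrier G" using nX X_def P0_def by auto
    then obtain W where W: "subgroup W G" "W \<noteq> carrier G" "M \<subseteq> W"
      "\<And>Y. subgroup Y G \<Longrightarrow> W \<subseteq> Y \<Longrightarrow> Y = W \<or> Y = carrier G"
      using exists_maximal_subgroup[OF sM] by blast
    have mW: "maxi W" unfolding maxi_def using W by simp
    obtain y where y: "y \<in> X" "y \<noteq> \<one>" using nX one0 by blast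
    have only: "Z \<subseteq> W" if Z: "subgroup Z G" "Z \<noteq> carrier G" "v \<in> X" "v \<noteq> \<one>" "v \<in> Z" for Z v
    proof -
      obtain V where V: "subgroup V G" "V \<noteq> carrier G" "Z \<subseteq> V"
        "\<And>Y. subgroup Y G \<Longrightarrow> V \<subseteq> Y \<Longrightarrow> Y = V \<or> Y = carrier G"
        using exists_maximal_subgroup[OF Z(1,2)] by blast
      have "maxi V" unfolding maxi_def using V by simp
      then have "V = W" using uniq[of v V W] Z X\<Gamma> V(3) W(3) cX(2) mW by blast
      then show ?thesis using V(3) by simp
    qed
    have WG: "W \<subseteq> carrier G" using subgroup.subset[OF W(1)] .
    have nW: "normr G W = W"
    proof -
      have "normr G W \<noteq> carrier G"
      proof
        assume "normr G W = carrier G"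
        then have "normalizes G (carrier G) W" unfolding normalizes_def normr_def by blast
        then have "p_core G p W \<subseteq> {\<one>}" using p_core_normal[OF subgroup_self p W(1) WG] P01 P0_def by simp
        moreover have "y \<in> p_core G p W" using X_local[OF W(1,2)] y W(3) cX(2) by blast
        ultimately show False using y by blast
      qed
      then show ?thesis using W(4)[OF normr_subgroup[OF WG] normr_super[OF W(1)]] by blast
    qed
    have conj_out: "cj G g v \<notin> W" if g: "g \<in> carrier G" "g \<notin> W" and v: "v \<in> X" "v \<noteq> \<one>" for g v
    proof
      assume a: "cj G g v \<in> W"
      have vG: "v \<in> carrier G" using v XG by blast
      have ig: "inv g \<in> carrier G" using g by simp
      let ?V = "cj G (inv g) ` W"
      have sV: "subgroup ?V G" using cj_subgroup[OF ig W(1)] .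
      have cV: "card ?V = card W" using cj_card[OF ig WG] .
      have "?V \<noteq> carrier G" using cj_image_cancel(2)[OF g(1) WG] cj_carrier_image[OF g(1)] W(2) by auto
      moreover have "v \<in> ?V" using a cj_image_iff[OF ig vG WG] g(1) by simp
      ultimately have "?V \<subseteq> W" using only[OF sV _ v] by blast
      then have "?V = W" using subgroup_eqI[OF W(1)] cV by blast
      then have "inv g \<in> W" using nW ig unfolding normr_def by blast
      then have "inv (inv g) \<in> W" using subgroup.m_inv_closed[OF W(1)] by blast
      then show False using g by simp
    qed
    obtain g where g: "g \<in> carrier G" "g \<notin> W" using W(2) WG by blast
    let ?Y = "cj G g ` X"
    have sY: "subgroup ?Y G" using cj_subgroup[OF g(1) cX(1)] .
    have YG: "?Y \<subseteq> carrier G" using subgroup.subset[OF sY] .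
    have meet: "cj G u ` X \<inter> W = {\<one>}" if u: "u \<in> carrier G" "u \<notin> W" for u
    proof -
      have "z = \<one>" if "z \<in> cj G u ` X" "z \<in> W" for z
        using that conj_out[OF u] u(1) by (metis imageE cj_one(2))
      then show ?thesis using subgroup.one_closed[OF cj_subgroup[OF u(1) cX(1)]] subgroup.one_closed[OF W(1)] by blast
    qed
    have YW: "?Y \<inter> W = {\<one>}" using meet[OF g] .
    have MYG: "M \<union> ?Y \<subseteq> carrier G" using MG YG by blast
    \<comment> \<open>A proper subgroup containing \<open>M\<close> and \<open>?Y\<close> contains
      \<open>y\<close> and so lies in \<open>W\<close>, but the conjugate of \<open>y\<close> in
      \<open>?Y\<close> does not.\<close>
    have top: "generate G (M \<union> ?Y) = carrier G"
    proof (rule ccontr)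
      assume n: "generate G (M \<union> ?Y) \<noteq> carrier G"
      have s: "subgroup (generate G (M \<union> ?Y)) G" using generate_is_subgroup[OF MYG] .
      have "y \<in> generate G (M \<union> ?Y)" "cj G g y \<in> generate G (M \<union> ?Y)" 
        using generate_subset[OF MYG] y cX(2) by blast+
      then have "cj G g y \<in> W" using only[OF s n y] by blast
      then show False using conj_out[OF g y] by blast
    qed
    \<comment> \<open>With \<open>?Y \<inter> W\<close> trivial and the join everything, the second
      modular law collapses to \<open>M = W\<close>: the subgroup \<open>M\<close> is
      maximal.\<close>
    have "generate G (M \<union> (?Y \<inter> W)) = generate G (M \<union> ?Y) \<inter> W" by (rule modular_law2[OF M sY W(1) W(3)])
    moreover have "M \<union> (?Y \<inter> W) = M" using YW subgroup.one_closed[OF sM] by (simp add: insert_absorb)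
    ultimately have MW: "M = W" using top WG generate_id[OF sM] by auto
    have h2: "V = Z" if V: "subgroup V G" "subgroup Z G" "V \<subseteq> Z" "\<not> V \<subseteq> M" "M \<inter> Z \<subseteq> V" for V Z
    proof -
      have VMG: "V \<union> M \<subseteq> carrier G" using V(1) MG subgroup.subset by blast
      have "generate G (V \<union> (M \<inter> Z)) = generate G (V \<union> M) \<inter> Z" by (rule modular_law1[OF M V(1,2,3)])
      moreover have "V \<union> (M \<inter> Z) = V" using V by blast
      moreover have "generate G (V \<union> M) = carrier G"
        using W(4)[OF generate_is_subgroup[OF VMG]] generate_subset[OF VMG] MW V(4) by blast
      moreover have "Z \<subseteq> carrier G" using subgroup.subset[OF V(2)] .
      ultimately show ?thesis using generate_id[OF V(1)] by auto
    qed
    \<comment> \<open>\<open>?Y\<close> meets \<open>M\<close> trivially, so by \<open>h2\<close>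
      each nontrivial subgroup of it is all of \<open>?Y\<close>.\<close>
    have "prime (card ?Y)"
    proof (rule prime_card_no_subgroups[OF sY])
      have "cj G g y \<in> ?Y" "cj G g y \<noteq> \<one>" using y conj_out[OF g y] subgroup.one_closed[OF W(1)] by auto
      then show "?Y \<noteq> {\<one>}" by blast
      fix V assume V: "subgroup V G" "V \<subseteq> ?Y" "V \<noteq> {\<one>}"
      show "V = ?Y"
      proof (rule h2[OF V(1) sY V(2)])
        have "V \<subseteq> {\<one>}" if "V \<subseteq> W" using that V(2) YW by (metis Int_greatest)
        then show "\<not> V \<subseteq> M" using V(3) MW subgroup.one_closed[OF V(1)] by blast
        show "M \<inter> ?Y \<subseteq> V" using YW MW subgroup.one_closed[OF V(1)] by (simp add: Int_commute)
      qed
    qed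
    then have prX: "prime (card X)" using cj_card[OF g(1) XG] by simp
    obtain j where j: "card X = p ^ j" using cX(4) prime_power_card_def by blast
    then have cXp: "card X = p" using prX p by (metis prime_power_iff power_one_right prime_dvd_power primes_dvd_imp_eq dvd_refl)
    have nXM: "normr G X = M"
    proof -
      have "M \<subseteq> normr G X"
        using normalizes_normr[OF MG] normalizes_eq[OF sub_finite[OF cX(1)] MG XG cX(3)] by blast
      moreover have "normr G X \<noteq> carrier G"
      proof
        assume "normr G X = carrier G"
        then have "normalizes G (carrier G) X" unfolding normalizes_def normr_def by blast
        then have "X \<subseteq> P0" unfolding P0_def using cX XG by (intro p_core_greatest) auto
        then show False using nX by simp
      qed
      ultimately show ?thesis using W(4)[OF normr_subgroup[OF XG]] MW by blast
    qed
    have h1: "cj G u ` X \<inter> M = {\<one>}" if "u \<in> carrier G" "u \<notin> M" for u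
      using meet[of u] that MW by simp
    have h4: "Z \<subseteq> M" if "subgroup Z G" "X \<subseteq> Z" "Z \<noteq> carrier G" for Z
      using only[OF that(1,3) y] that(2) y(1) MW by blast
    have "maximal_modular_configuration G p M X"
    proof (rule maximal_modular_configuration.intro[OF fin_group_axioms maximal_modular_configuration_axioms.intro])
      show "M \<noteq> carrier G" using MW W(2) by simp
    qed (fact p | fact sM | fact cX | fact cXp | fact nXM | erule (1) largest | erule (1) h1 | erule (4) h2 | erule (2) h4 | (erule centre, blast))+
    then show False by (rule maximal_modular_configuration.contradiction)
  qed
qed

lemma p_core_modular:
  fixes G :: "'a monoid"
  assumes "fin_group G" "prime p" "\<And>q. prime q \<Longrightarrow> q dvd order G \<Longrightarrow> q \<le> p" "modular_subgroup M G"
  shows "p_core G p M \<subseteq> p_core G p (carrier G)"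
  using assms(1,3,4)
proof (induction "order G" arbitrary: G M rule: less_induct)
  case less
  show ?case by (rule p_core_modular_step[OF less.prems(1) assms(2) less.prems(2,3) less.hyps])
qed

text \<open>For every member of the chain \<open>p\<close> still bounds the prime divisors of its
  order, so the modular case applies at each step.\<close>

lemma p_core_submodular:
  fixes G :: "'a monoid" (structure)
  assumes "fin_group G" "prime p" "\<And>q. prime q \<Longrightarrow> q dvd order G \<Longrightarrow> q \<le> p" "submodular_subgroup H G"
  shows "p_core G p H \<subseteq> p_core G p (carrier G)"
proof -
  interpret fin_group G by fact
  show ?thesis using assms(4)
  proof (induction rule: submodular_induct)
    case (step M K)
    have "p_core (G\<lparr>carrier := K\<rparr>) p M \<subseteq> p_core (G\<lparr>carrier := K\<rparr>) p (carrier (G\<lparr>carrier := K\<rparr>))"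
    proof (rule p_core_modular[OF fin_group_sub[OF step(2)] assms(2) _ step(5)])
      show "q \<le> p" if "prime q" "q dvd order (G\<lparr>carrier := K\<rparr>)" for q
        using that assms(3) card_dvd_order[OF step(2)] by (auto simp: order_def intro: dvd_trans)
    qed
    then show ?case using step(6) p_core_consistent[OF step(2)] step(4) by simp
  qed simp
qed

section \<open>Coprime action of a submodular cyclic subgroup\<close>

context fin_group
begin

lemma pow_cong:
  assumes x: "x \<in> carrier G" "x [^] (n::nat) = \<one>" and ab: "[a = b] (mod n)"
  shows "x [^] a = x [^] b"
proof -
  obtain k1 k2 where "b + k1 * n = a + k2 * n" using ab cong_iff_lin_nat by blast
  moreover have "x [^] (c + k * n) = x [^] c" for c k :: nat
  proof -
    have "x [^] (c + k * n) = x [^] c \<otimes> (x [^] n) [^] k"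
      using x(1) by (simp add: nat_pow_mult nat_pow_pow mult.commute)
    then show ?thesis using x by simp
  qed
  ultimately show ?thesis by metis
qed

lemma generate_nat_pow: "x \<in> carrier G \<Longrightarrow> generate G {x} = {x [^] k | k. k \<in> (UNIV :: nat set)}"
  using generate_pow_nat[of x] ord_ge_1[OF fin, of x] by force

lemma cyclic_subgroup: "x \<in> carrier G \<Longrightarrow> subgroup (generate G {x}) G"
  using generate_is_subgroup[of "{x}"] by simp

lemma cyclic_self: "x \<in> generate G {x}"
  by (simp add: generate.incl)

lemma cyclic_least: "subgroup U G \<Longrightarrow> x \<in> U \<Longrightarrow> generate G {x} \<subseteq> U"
  using generate_mono_sub[of U "{x}"] by simp

text \<open>An exponent prime to \<open>q\<close> is invertible modulo a power of \<open>q\<close>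
  that annihilates \<open>x\<close>, so that power of \<open>x\<close> would give back
  \<open>x\<close>. A proper subgroup thus contains only powers with exponent divisible by
  \<open>q\<close>.\<close>

lemma cyclic_primary_proper_subgroup:
  assumes q: "prime q" and x: "p_elem G q x" and U: "subgroup U G" "U \<subseteq> generate G {x}" "U \<noteq> generate G {x}"
  shows "U \<subseteq> generate G {x [^] q}"
proof
  have xG: "x \<in> carrier G" using x p_elem_def by metis
  obtain m where m: "x [^] (q ^ m) = \<one>" using x by (auto simp: p_elem_def)
  fix u assume u: "u \<in> U"
  then obtain k :: nat where k: "u = x [^] k" using U(2) generate_nat_pow[OF xG] by blast
  have "q dvd k"
  proof (rule ccontr)
    assume "\<not> q dvd k"
    then have "coprime k (q ^ m)" using q by (metis coprime_commute coprime_power_left_iff prime_imp_coprime)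
    then obtain j where "[k * j = Suc 0] (mod (q ^ m))" using cong_solve_coprime_nat[of k "q ^ m"] by auto
    then have "x [^] (k * j) = x [^] Suc 0" by (rule pow_cong[OF xG m])
    then have "u [^] j = x" using k xG by (simp add: nat_pow_pow)
    then have "x \<in> U" using subgroup_pow[OF U(1) u] by metis
    then show False using cyclic_least[OF U(1)] U(2,3) by blast
  qed
  then obtain j where "k = q * j" by auto
  then have "u = (x [^] q) [^] j" using k xG by (simp add: nat_pow_pow)
  then show "u \<in> generate G {x [^] q}" using subgroup_pow[OF cyclic_subgroup[OF nat_pow_closed[OF xG]] cyclic_self] by simp
qed

lemma cyclic_power_proper:
  assumes q: "prime q" and x: "p_elem G q x" and "x \<in> generate G {x [^] q}"
  shows "x = \<one>"
proof -
  have xG: "x \<in> carrier G" using x p_elem_def by metis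
  obtain k :: nat where "x = (x [^] q) [^] k" using assms(3) generate_nat_pow[of "x [^] q"] xG by auto
  then have e: "x [^] (q * k) = x" using xG by (simp add: nat_pow_pow)
  show ?thesis
  proof (cases "q * k = 0")
    case False
    have "x [^] (q * k) = x [^] (q * k - 1) \<otimes> x" using False by (metis Suc_diff_1 nat_pow_Suc neq0_conv)
    then have "x [^] (q * k - 1) = \<one>" using e xG by (metis nat_pow_closed r_cancel_one)
    moreover have "\<not> q dvd q * k - 1"
    proof
      assume "q dvd q * k - 1"
      then obtain j where "q * k - 1 = q * j" by (rule dvdE)
      then have "q * k = q * j + 1" using False by linarith
      then have "1 = q * k - q * j" by simp
      then have "1 = q * (k - j)" by (simp add: diff_mult_distrib2)
      then show False using q by (metis nat_mult_eq_1_iff not_prime_1)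
    qed
    ultimately show ?thesis using p_elem_coprime[OF x _ q] by blast
  next
    case True
    then show ?thesis using e by (metis nat_pow_0)
  qed
qed

lemma cj_generate:
  assumes "g \<in> carrier G" "x \<in> carrier G"
  shows "cj G g ` generate G {x} = generate G {cj G g x}"
proof -
  interpret c: group_hom G G "cj G g" using cj_hom[OF assms(1)] .
  show ?thesis using c.image_generate[of "{x}"] assms by simp
qed

lemma coprime_Int_trivial:
  assumes "subgroup P G" "prime_power_card p P" "subgroup Q G" "prime_power_card q Q" "prime p" "prime q" "p \<noteq> q"
  shows "P \<inter> Q = {\<one>}"
proof -
  have "x = \<one>" if "x \<in> P" "x \<in> Q" for x
    using p_elem_disjoint p_elem_in[OF assms(1,2) that(1)] p_elem_in[OF assms(3,4) that(2)] assms by blast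
  then show ?thesis using subgroup.one_closed[OF assms(1)] subgroup.one_closed[OF assms(3)] by blast
qed

lemma set_mult_normal_commute:
  assumes H: "subgroup H G" and P: "subgroup P G" and n: "normalizes G H P"
  shows "H <#> P = P <#> H"
proof -
  note [simp] = subgroup.mem_carrier[OF H] subgroup.mem_carrier[OF P]
  have "h \<otimes> v = cj G h v \<otimes> h" "v \<otimes> h = h \<otimes> cj G (inv h) v" if "h \<in> H" "v \<in> P" for h v
    using that by (simp_all add: cj_def m_assoc)
  moreover have "cj G h v \<in> P" "cj G (inv h) v \<in> P" if "h \<in> H" "v \<in> P" for h v
    using n that subgroup.m_inv_closed[OF H] by (auto simp: normalizes_def)
  ultimately show ?thesis unfolding set_mult_def by (auto; metis)
qed

lemma complement_conjugate:
  assumes P: "subgroup P G" "prime_power_card p P" and Q: "subgroup Q G" "prime_power_card q Q"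
    and pq: "prime p" "prime q" "p \<noteq> q" and n: "normalizes G Q P" and G: "carrier G = Q <#> P"
    and R: "subgroup R G" "prime_power_card q R"
  obtains u where "u \<in> P" "R \<subseteq> cj G u ` Q"
proof -
  obtain i j where ij: "card P = p ^ i" "card Q = q ^ j" using P Q prime_power_card_def by metis
  have "card (Q <#> P) * card (Q \<inter> P) = q ^ j * p ^ i" using card_set_mult[OF Q(1) P(1)] ij by simp
  moreover have "Q \<inter> P = {\<one>}" using coprime_Int_trivial[OF Q P pq(2,1)] pq(3) by simp
  ultimately have ord: "order G = q ^ j * p ^ i" using G by (simp add: order_def)
  have "\<not> q dvd p ^ i" using pq by (metis prime_dvd_power primes_dvd_imp_eq)
  then have "multiplicity q (order G) = j" using ord pq(2) by (intro multiplicity_eqI) (auto simp: prime_gt_0_nat)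
  then have "sylow_subgroup q Q G" using Q pq(2) ij by (simp add: sylow_subgroup_def)
  then obtain g where g: "g \<in> carrier G" "R \<subseteq> cj G g ` Q" using sylow_contains[OF R] by blast
  have "g \<in> P <#> Q" using g(1) G set_mult_normal_commute[OF Q(1) P(1) n] by simp
  then obtain u h where uh: "u \<in> P" "h \<in> Q" "g = u \<otimes> h" by (auto simp: set_mult_def)
  have c: "u \<in> carrier G" "h \<in> carrier G" using uh subgroup.mem_carrier[OF P(1)] subgroup.mem_carrier[OF Q(1)] by auto
  have "cj G g ` Q = cj G u ` cj G h ` Q" using uh(3) c cj_image_comp[OF c subgroup.subset[OF Q(1)]] by simp
  then have "cj G g ` Q = cj G u ` Q" using cj_self_image[OF Q(1) uh(2)] by simp
  then show ?thesis using that uh(1) g(2) by simp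
qed

lemma normalizes_Int_sub:
  assumes J: "subgroup J G" and L: "L \<subseteq> J" and n: "normalizes G (carrier G) P"
  shows "normalizes (G\<lparr>carrier := J\<rparr>) L (P \<inter> J)"
  unfolding normalizes_def
proof (intro ballI)
  fix l v assume l: "l \<in> L" and v: "v \<in> P \<inter> J"
  have lJ: "l \<in> J" using l L by blast
  have "cj G l v \<in> P" using n subgroup.mem_carrier[OF J lJ] v by (simp add: normalizes_def)
  moreover have "cj G l v \<in> J" using cj_self_image[OF J lJ] v by blast
  ultimately show "cj (G\<lparr>carrier := J\<rparr>) l v \<in> P \<inter> J" using cj_consistent[OF J lJ] by simp
qed

lemma dedekind:
  assumes A: "subgroup A G" and J: "subgroup J G" "A \<subseteq> J" "J \<subseteq> A <#> P" and PG: "P \<subseteq> carrier G"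
  shows "J = A <#> (P \<inter> J)"
proof
  show "A <#> (P \<inter> J) \<subseteq> J" using set_mult_least[OF J(1)] J(2) by blast
  show "J \<subseteq> A <#> (P \<inter> J)"
  proof
    fix z assume z: "z \<in> J"
    then have "z \<in> A <#> P" using J(3) by blast
    then obtain a v where av: "a \<in> A" "v \<in> P" "z = a \<otimes> v" by (auto simp: set_mult_def)
    have c: "a \<in> carrier G" "v \<in> carrier G" using av PG subgroup.mem_carrier[OF A] by auto
    have "v = inv a \<otimes> z" using av c by simp
    then have "v \<in> J" using subgroup.m_closed[OF J(1) subgroup.m_inv_closed[OF J(1)] z] av(1) J(2) by blast
    then show "z \<in> A <#> (P \<inter> J)" using av by (auto simp: set_mult_def)
  qed
qed

text \<open>A power of \<open>q\<close> annihilates \<open>y\<close> and hence also its conjugate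
  \<open>c \<otimes> y\<close>. Since \<open>c\<close> and \<open>y\<close> commute, it annihilates
  the \<open>p\<close>-element \<open>c\<close>.\<close>

lemma coprime_action_trivial:
  assumes y: "p_elem G q y" and c: "p_elem G p c" "cj G y c = c" and g: "g \<in> carrier G" "cj G g y = c \<otimes> y"
    and pq: "prime p" "prime q" "p \<noteq> q"
  shows "c = \<one>"
proof -
  have G: "y \<in> carrier G" "c \<in> carrier G" using y c p_elem_def by metis+
  obtain k where k: "y [^] (q ^ k) = \<one>" using y by (auto simp: p_elem_def)
  have "cj G g y [^] (q ^ k) = cj G g (y [^] (q ^ k))" using cj_pow[OF g(1) G(1)] .
  then have "(c \<otimes> y) [^] (q ^ k) = \<one>" using k g by simp
  moreover have "c \<otimes> y = y \<otimes> c" using c(2) cj_fix_iff G by simp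
  ultimately have "c [^] (q ^ k) \<otimes> y [^] (q ^ k) = \<one>" using pow_mult_distrib[OF _ G(2,1)] by metis
  then have "c [^] (q ^ k) = \<one>" using k G by simp
  moreover have "\<not> p dvd q ^ k" using pq by (metis prime_dvd_power primes_dvd_imp_eq)
  ultimately show ?thesis using p_elem_coprime[OF c(1) _ pq(1)] by blast
qed

text \<open>If a conjugate \<open>g y g\<inverse>\<close> of \<open>y = x\<^sup>q\<close> were outside \<open>M\<close>, the interval above \<open>M\<close> in
  \<open>\<langle>M, g x g\<inverse>\<rangle>\<close>, a chain by modularity, would contain two different atoms.\<close>

lemma modular_power_centralizes_step:
  assumes M: "modular_subgroup M G" and P: "subgroup P G" "prime_power_card p P" "normalizes G (carrier G) P"
    and pq: "prime p" "prime q" "p \<noteq> q" and x: "p_elem G q x" "x \<in> M"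
    and G: "carrier G = generate G {x} <#> P"
    and cent: "\<And>v. v \<in> M \<inter> P \<Longrightarrow> cj G (x [^] q) v = v" and v: "v \<in> P"
  shows "cj G (x [^] q) v = v"
proof -
  have xG: "x \<in> carrier G" using x p_elem_def by metis
  have PG: "P \<subseteq> carrier G" using subgroup.subset[OF P(1)] .
  have sM: "subgroup M G" using M by (auto simp: modular_subgroup_def)
  have MG: "M \<subseteq> carrier G" using subgroup.subset[OF sM] .
  let ?H = "\<lambda>g. generate G {cj G g x}" and ?V = "\<lambda>g. generate G {cj G g (x [^] q)}"
  let ?y = "x [^] q"
  have yG: "?y \<in> carrier G" using xG by simp
  have yM: "?y \<in> M" using subgroup_pow[OF sM x(2)] .
  have xg: "p_elem G q (cj G g x)" if "g \<in> carrier G" for g using p_elem_cj[OF x(1) that] .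
  have sH: "subgroup (?H g) G" and sV: "subgroup (?V g) G" and inH: "cj G g x \<in> ?H g" and inV: "cj G g ?y \<in> ?V g" 
    if "g \<in> carrier G" for g
    using cyclic_subgroup cyclic_self that xG yG by auto
  have Vpow: "?V g = generate G {cj G g x [^] q}" if "g \<in> carrier G" for g using cj_pow[OF that xG] by simp
  have VH: "?V g \<subseteq> ?H g" if "g \<in> carrier G" for g
    using cyclic_least[OF sH[OF that] subgroup_pow[OF sH[OF that] inH[OF that]]] Vpow[OF that] by metis
  \<comment> \<open>The subgroup \<open>?V g\<close> is the largest proper subgroup of the cyclic
    \<open>q\<close>-group \<open>?H g\<close>, apart from the case that both are trivial.\<close>
  have proper: "U \<inter> ?H g \<subseteq> ?V g" if g: "g \<in> carrier G" and U: "subgroup U G" "cj G g x \<notin> U" for U g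
  proof -
    have "U \<inter> ?H g \<noteq> ?H g" using inH[OF g] U(2) by blast
    then show ?thesis
      using cyclic_primary_proper_subgroup[OF pq(2) xg[OF g] subgroup_Int[OF U(1) sH[OF g]] Int_lower2] Vpow[OF g] by simp
  qed
  let ?A = "generate G {x}"
  have A: "subgroup ?A G" "x \<in> ?A" "prime_power_card q ?A"
    using cyclic_subgroup[OF xG] cyclic_self p_elem_iff[OF pq(2) xG] x(1) by auto
  have PA: "P \<inter> ?A = {\<one>}" by (rule coprime_Int_trivial[OF P(1,2) A(1,3) pq])
  have conj_in: "cj G g ?y \<in> M" if gP: "g \<in> P" for g
  proof (rule ccontr)
    assume out: "cj G g ?y \<notin> M"
    have g: "g \<in> carrier G" using gP PG by blast
    have VM: "\<not> ?V g \<subseteq> M" using out inV[OF g] by blast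
    have xM: "cj G g x \<notin> M"
      using out subgroup_pow[OF sM, of "cj G g x" q] cj_pow[OF g xG, of q] by metis
    define J1 where "J1 = generate G (?V g \<union> M)"
    define J where "J = generate G (M \<union> ?H g)"
    have s1: "?V g \<union> M \<subseteq> carrier G" and s2: "M \<union> ?H g \<subseteq> carrier G"
      using MG subgroup.subset[OF sV[OF g]] subgroup.subset[OF sH[OF g]] by auto
    have sJ1: "subgroup J1 G" and sJ: "subgroup J G" using generate_is_subgroup s1 s2 J1_def J_def by auto
    have MJ1: "M \<subseteq> J1" "?V g \<subseteq> J1" and MJ: "M \<subseteq> J" "?H g \<subseteq> J" 
      using generate_subset[OF s1] generate_subset[OF s2] by (auto simp: J1_def J_def)
    have J1J: "J1 \<subseteq> J" unfolding J1_def using VH[OF g] MJ by (intro generate_mono_sub[OF sJ]) auto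
    have "generate G (?V g \<union> (M \<inter> ?H g)) = J1 \<inter> ?H g"
      unfolding J1_def by (rule modular_law1[OF M sV[OF g] sH[OF g] VH[OF g]])
    moreover have "?V g \<union> (M \<inter> ?H g) = ?V g" using proper[OF g sM xM] by blast
    ultimately have J1H: "J1 \<inter> ?H g = ?V g" using generate_id[OF sV[OF g]] by simp
    have xJ1: "cj G g x \<notin> J1"
    proof
      assume "cj G g x \<in> J1"
      then have "cj G g x \<in> generate G {cj G g x [^] q}" using J1H inH[OF g] Vpow[OF g] by blast
      then have "cj G g x = \<one>" using cyclic_power_proper[OF pq(2) xg[OF g]] by blast
      then show False using xM subgroup.one_closed[OF sM] by simp
    qed
    have AJ1: "?A \<subseteq> J1" using cyclic_least[OF sJ1] x(2) MJ1(1) by blast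
    \<comment> \<open>\<open>?A\<close> is a complement in \<open>J1\<close>, and the
      \<open>q\<close>-group \<open>?V g\<close> lies in \<open>J1\<close>. So an element
      \<open>u\<close> of \<open>P \<inter> J1\<close> can move the conjugate of \<open>?y\<close>
      back into \<open>?A\<close>.\<close>
    have J1eq: "J1 = ?A <#> (P \<inter> J1)"
      using dedekind[OF A(1) sJ1 AJ1 _ PG] subgroup.subset[OF sJ1] G by simp
    interpret J: fin_group "G\<lparr>carrier := J1\<rparr>" using fin_group_sub[OF sJ1] .
    have sPJ: "subgroup (P \<inter> J1) G" using subgroup_Int[OF P(1) sJ1] .
    have ppPJ: "prime_power_card p (P \<inter> J1)" using prime_power_card_sub[OF sPJ P(1) _ pq(1) P(2)] by blast
    have "normalizes (G\<lparr>carrier := J1\<rparr>) ?A (P \<inter> J1)"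
      by (rule normalizes_Int_sub[OF sJ1 AJ1 P(3)])
    moreover have "subgroup (?V g) (G\<lparr>carrier := J1\<rparr>)" using sV[OF g] MJ1(2) subgroup_subset_iff[OF sJ1] by blast
    moreover have "prime_power_card q (?V g)"
      using p_elem_iff[OF pq(2)] p_elem_cj[OF p_elem_pow[OF x(1)] g] g yG by (metis cj_closed)
    moreover have "subgroup (P \<inter> J1) (G\<lparr>carrier := J1\<rparr>)" "subgroup ?A (G\<lparr>carrier := J1\<rparr>)"
      using subgroup_subset_iff[OF sJ1] sPJ A(1) AJ1 by auto
    moreover have "carrier (G\<lparr>carrier := J1\<rparr>) = ?A <#>\<^bsub>G\<lparr>carrier := J1\<rparr>\<^esub> (P \<inter> J1)" using J1eq by simp
    ultimately obtain u where u: "u \<in> P \<inter> J1" "?V g \<subseteq> cj (G\<lparr>carrier := J1\<rparr>) u ` ?A"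
      using J.complement_conjugate[of "P \<inter> J1" p ?A q "?V g"] ppPJ A(3) pq by metis
    have uG: "u \<in> carrier G" using u PG by blast
    have "cj G g ?y \<in> cj G u ` ?A" using u inV[OF g] cj_consistent[OF sJ1] by auto
    then have uA: "cj G (inv u) (cj G g ?y) \<in> ?A" using cj_image_iff[OF uG _ subgroup.subset[OF A(1)]] g yG by simp
    \<comment> \<open>Correcting \<open>g\<close> by \<open>u\<close> yields a conjugator that
      commutes with \<open>?y\<close>: their commutator lies in \<open>?A\<close> and in
      \<open>P\<close>.\<close>
    define k where "k = inv u \<otimes> g"
    have kP: "k \<in> P" unfolding k_def using u gP subgroup.m_closed[OF P(1)] subgroup.m_inv_closed[OF P(1)] by blast
    have k: "k \<in> carrier G" using kP PG by blast
    have "cj G k ?y \<in> ?A" using uA g uG yG by (simp add: k_def cj_mult)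
    moreover have yA: "?y \<in> ?A" using subgroup_pow[OF A(1,2)] .
    ultimately have "cj G k ?y \<otimes> inv ?y \<in> ?A" using subgroup.m_closed[OF A(1)] subgroup.m_inv_closed[OF A(1)] by blast
    moreover have "cj G k ?y \<otimes> inv ?y \<in> P"
    proof -
      have "cj G k ?y \<otimes> inv ?y = k \<otimes> cj G ?y (inv k)" using k yG by (simp add: cj_def m_assoc)
      moreover have "cj G ?y (inv k) \<in> P" using P(3) yG subgroup.m_inv_closed[OF P(1) kP] by (auto simp: normalizes_def)
      ultimately show ?thesis using subgroup.m_closed[OF P(1) kP] by simp
    qed
    ultimately have "cj G k ?y \<otimes> inv ?y = \<one>" using PA by blast
    then have "cj G k ?y \<otimes> inv ?y \<otimes> ?y = \<one> \<otimes> ?y" by simp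
    then have ky: "cj G k ?y = ?y" using k yG by (simp add: m_assoc)
    have kx: "cj G g x = cj G u (cj G k x)" using g uG xG by (simp add: k_def flip: cj_mult)
    have kx': "cj G k x = cj G (inv u) (cj G g x)" using g uG xG by (simp add: k_def cj_mult)
    have cjJ: "cj G w z \<in> L" if "subgroup L G" "w \<in> L" "z \<in> L" for w z L
      using cj_self_image[OF that(1,2)] that(3) by blast
    have kJ1: "cj G k x \<notin> J1" using cjJ[OF sJ1, of u] u(1) xJ1 kx by auto
    have "inv u \<in> J" using u(1) J1J subgroup.m_inv_closed[OF sJ] by blast
    then have kJ: "cj G k x \<in> J" unfolding kx' using cjJ[OF sJ] MJ(2) inH[OF g] by blast
    \<comment> \<open>\<open>J1\<close> and \<open>J2\<close> lie between \<open>M\<close> and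
      \<open>J\<close> and meet in \<open>M\<close>, because \<open>?V k\<close> is generated by
      \<open>?y\<close>, which is in \<open>M\<close>. The second modular law makes
      \<open>J2\<close> all of \<open>J\<close> or a part of \<open>J1\<close>; both are
      impossible.\<close>
    define J2 where "J2 = generate G (M \<union> ?H k)"
    have s3: "M \<union> ?H k \<subseteq> carrier G" using MG subgroup.subset[OF sH[OF k]] by auto
    have sJ2: "subgroup J2 G" using generate_is_subgroup[OF s3] J2_def by simp
    have MJ2: "M \<subseteq> J2" "?H k \<subseteq> J2" using generate_subset[OF s3] by (auto simp: J2_def)
    have J2J: "J2 \<subseteq> J" unfolding J2_def
      using MJ(1) cyclic_least[OF sJ kJ] by (intro generate_mono_sub[OF sJ]) auto
    have "generate G (M \<union> (?H k \<inter> J1)) = J2 \<inter> J1"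
      unfolding J2_def by (rule modular_law2[OF M sH[OF k] sJ1 MJ1(1)])
    moreover have "?H k \<inter> J1 \<subseteq> M"
      using proper[OF k sJ1 kJ1] ky cyclic_least[OF sM yM] by (simp add: Int_commute)
    ultimately have J21: "J2 \<inter> J1 = M" using generate_id[OF sM] by (simp add: Un_absorb2)
    have law: "generate G (M \<union> (?H g \<inter> J2)) = J \<inter> J2"
      unfolding J_def by (rule modular_law2[OF M sH[OF g] sJ2 MJ2(1)])
    show False
    proof (cases "cj G g x \<in> J2")
      case True
      then have "J \<subseteq> J2" unfolding J_def using MJ2(1) cyclic_least[OF sJ2] by (intro generate_mono_sub[OF sJ2]) auto
      then have "J1 = M" using J21 J1J by blast
      then show False using VM MJ1 by blast
    next
      case False
      then have "?H g \<inter> J2 \<subseteq> J1" using proper[OF g sJ2] MJ1(2) by blast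
      then have "generate G (M \<union> (?H g \<inter> J2)) \<subseteq> J1" using MJ1(1) by (intro generate_mono_sub[OF sJ1]) auto
      then have "J2 \<subseteq> J1" using law J2J by blast
      then show False using kJ1 inH[OF k] MJ2(2) by blast
    qed
  qed
  have vG: "v \<in> carrier G" using v PG by blast
  \<comment> \<open>As \<open>P\<close> conjugates \<open>?y\<close> into \<open>M\<close>, this
    commutator lies in \<open>M \<inter> P\<close>, where \<open>?y\<close> is already known to act
    trivially.\<close>
  define c where "c = cj G v ?y \<otimes> inv ?y"
  have cG: "c \<in> carrier G" using vG yG c_def by simp
  have "c \<in> M" unfolding c_def using conj_in[OF v] subgroup.m_closed[OF sM] subgroup.m_inv_closed[OF sM yM] by blast
  moreover have "c \<in> P"
  proof -
    have "c = v \<otimes> cj G ?y (inv v)" unfolding c_def using vG yG by (simp add: cj_def m_assoc)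
    moreover have "cj G ?y (inv v) \<in> P" using P(3) yG subgroup.m_inv_closed[OF P(1) v] by (auto simp: normalizes_def)
    ultimately show ?thesis using subgroup.m_closed[OF P(1) v] by simp
  qed
  ultimately have "cj G ?y c = c" "p_elem G p c" using cent p_elem_in[OF P(1,2)] by auto
  moreover have cy: "cj G v ?y = c \<otimes> ?y" unfolding c_def using vG yG by (simp add: m_assoc)
  ultimately have "c = \<one>" using coprime_action_trivial[OF p_elem_pow[OF x(1)] _ _ vG cy pq] by blast
  then have "cj G v ?y = ?y" using cy yG by simp
  then show ?thesis using cj_fix_sym vG yG by simp
qed

text \<open>Inside \<open>?L\<close> each member \<open>K\<close> of the chain is the product of
  \<open>?A\<close> and \<open>P \<inter> K\<close> by Dedekind's law, so the modular step applies
  all along the chain. At its lower end \<open>P\<close> is met trivially.\<close>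

lemma submodular_power_centralizes:
  assumes P: "subgroup P G" "prime_power_card p P" "normalizes G (carrier G) P"
    and pq: "prime p" "prime q" "p \<noteq> q" and x: "p_elem G q x"
    and sm: "submodular_subgroup (generate G {x}) G" and v: "v \<in> P"
  shows "cj G (x [^] q) v = v"
proof -
  have xG: "x \<in> carrier G" using x p_elem_def by metis
  have PG: "P \<subseteq> carrier G" using subgroup.subset[OF P(1)] .
  let ?A = "generate G {x}"
  let ?L = "?A <#> P"
  have A: "subgroup ?A G" "x \<in> ?A" "prime_power_card q ?A"
    using cyclic_subgroup[OF xG] cyclic_self p_elem_iff[OF pq(2) xG] x(1) by auto
  have nA: "normalizes G ?A P" using P(3) subgroup.subset[OF A(1)] by (auto simp: normalizes_def)
  have L: "subgroup ?L G" using set_mult_subgroupI[OF A(1) P(1) nA] .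
  have AL: "?A \<subseteq> ?L" "P \<subseteq> ?L" using set_mult_contains[OF A(1) P(1)] by auto
  interpret L: fin_group "G\<lparr>carrier := ?L\<rparr>" using fin_group_sub[OF L] .
  have smL: "submodular_subgroup ?A (G\<lparr>carrier := ?L\<rparr>)" using submodular_sub[OF sm L AL(1)] .
  have "\<forall>v \<in> carrier (G\<lparr>carrier := ?L\<rparr>) \<inter> P. cj G (x [^] q) v = v" using smL
  proof (induction rule: L.submodular_induct)
    case base
    have "P \<inter> ?A = {\<one>}" by (rule coprime_Int_trivial[OF P(1,2) A(1,3) pq])
    then show ?case using xG by (simp add: Int_commute)
  next
    case (step M K)
    have K: "subgroup K G" "K \<subseteq> ?L" using step(2) subgroup_subset_iff[OF L] by auto
    have AK: "?A \<subseteq> K" using step(3,4) by blast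
    have xM: "x \<in> M" using step(3) A(2) by blast
    have Keq: "K = ?A <#> (P \<inter> K)" using dedekind[OF A(1) K(1) AK K(2) PG] .
    interpret K: fin_group "G\<lparr>carrier := K\<rparr>" using fin_group_sub[OF K(1)] .
    have m: "modular_subgroup M (G\<lparr>carrier := K\<rparr>)" using step(5) by simp
    have sPK: "subgroup (P \<inter> K) G" using subgroup_Int[OF P(1) K(1)] .
    have pw: "x [^]\<^bsub>G\<lparr>carrier := K\<rparr>\<^esub> q = x [^] q" by (simp add: nat_pow_consistent[symmetric])
    have gen: "generate (G\<lparr>carrier := K\<rparr>) {x} = ?A" using generate_consistent[of "{x}" K] K(1) AK A(2) by auto
    have yK: "x [^] q \<in> K" using subgroup_pow[OF A(1,2)] AK by blast
    have "cj (G\<lparr>carrier := K\<rparr>) (x [^]\<^bsub>G\<lparr>carrier := K\<rparr>\<^esub> q) v = v" if v: "v \<in> P \<inter> K" for v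
    proof (rule K.modular_power_centralizes_step[OF m _ _ _ pq _ xM _ _ v])
      show "subgroup (P \<inter> K) (G\<lparr>carrier := K\<rparr>)" using subgroup_subset_iff[OF K(1)] sPK by simp
      show "prime_power_card p (P \<inter> K)" using prime_power_card_sub[OF sPK P(1) _ pq(1) P(2)] by blast
      show "normalizes (G\<lparr>carrier := K\<rparr>) (carrier (G\<lparr>carrier := K\<rparr>)) (P \<inter> K)"
        using normalizes_Int_sub[OF K(1) _ P(3), of K] by simp
      show "p_elem (G\<lparr>carrier := K\<rparr>) q x" using p_elem_consistent[OF K(1)] x AK A(2) by blast
      show "carrier (G\<lparr>carrier := K\<rparr>) = generate (G\<lparr>carrier := K\<rparr>) {x} <#>\<^bsub>G\<lparr>carrier := K\<rparr>\<^esub> (P \<inter> K)" using Keq gen by simp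
      show "cj (G\<lparr>carrier := K\<rparr>) (x [^]\<^bsub>G\<lparr>carrier := K\<rparr>\<^esub> q) w = w" if "w \<in> M \<inter> (P \<inter> K)" for w
        using step(6) that pw yK cj_consistent[OF K(1)] by simp
    qed
    then show ?case using pw yK cj_consistent[OF K(1)] by auto
  qed
  then show ?thesis using v AL(2) by auto
qed

end

text \<open>The \<open>q\<close>-th roots of unity modulo \<open>p\<close> form a cyclic group of
  order 1 or \<open>q\<close>, generated by any nontrivial member. In terms of a primitive root both
  exponents are multiples of \<open>(p - 1) / q\<close>.\<close>

lemma power_roots_of_unity_mod_prime:
  fixes p q k l :: nat
  assumes p: "prime p" and q: "prime q" and k: "[k ^ q = 1] (mod p)" and l: "[l ^ q = 1] (mod p)" "\<not> [l = 1] (mod p)"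
  shows "\<exists>i. [k = l ^ i] (mod p)"
proof -
  have p1: "p > 1" using prime_gt_1_nat[OF p] .
  obtain g where "residue_primroot p g" using prime_primitive_root_exists[OF p1 p] by blast
  then have g: "coprime p g" "ord p g = totient p" by (auto simp: residue_primroot_def)
  have tot: "totient p = p - 1" using p by (simp add: totient_prime)
  have ex: "\<exists>s. [a = g ^ s] (mod p)" if a: "[a ^ q = 1] (mod p)" for a
  proof -
    have "\<not> p dvd a"
    proof
      assume "p dvd a"
      then have "p dvd a ^ q" using prime_gt_0_nat[OF q] by (simp add: dvd_power_le dvd_trans)
      then have "a ^ q mod p = 0" by simp
      then show False using a p1 by (simp add: cong_def)
    qed
    then have "a mod p \<noteq> 0" by (simp add: dvd_eq_mod_eq_0)
    then have "a mod p \<in> totatives p" using p1 by (simp add: totatives_prime[OF p])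
    then have "a mod p \<in> (\<lambda>i. g ^ i mod p) ` {..<totient p}"
      using bij_betw_imp_surj_on[OF residue_primroot_is_generator[OF p1 \<open>residue_primroot p g\<close>]] by simp
    then obtain s where "a mod p = g ^ s mod p" by blast
    then show ?thesis by (metis cong_def)
  qed
  obtain s t where s: "[k = g ^ s] (mod p)" and t: "[l = g ^ t] (mod p)" using ex k l(1) by blast
  have dv: "p - 1 dvd a * q" if "[b = g ^ a] (mod p)" "[b ^ q = 1] (mod p)" for a b
  proof -
    have "[g ^ (a * q) = 1] (mod p)" using that by (metis cong_pow cong_sym cong_trans power_mult)
    then show ?thesis using ord_divides[of g "a * q" p] g tot by simp
  qed
  have 1: "p - 1 dvd s * q" "p - 1 dvd t * q" using dv s k t l(1) by blast+
  have nt: "\<not> p - 1 dvd t"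
  proof
    assume "p - 1 dvd t"
    then have "[g ^ t = 1] (mod p)" using ord_divides[of g t p] g tot by simp
    then show False using t l(2) cong_trans by blast
  qed
  have qp: "q dvd p - 1"
  proof (rule ccontr)
    assume "\<not> q dvd p - 1"
    then have "coprime (p - 1) q" using q by (metis coprime_commute prime_imp_coprime)
    then show False using 1(2) nt coprime_dvd_mult_left_iff by blast
  qed
  then obtain m where m: "p - 1 = m * q" by (metis dvd_def mult.commute)
  have "m dvd s" "m dvd t" using 1 m prime_gt_0_nat[OF q] by auto
  then obtain s' t' where st: "s = m * s'" "t = m * t'" by (auto elim!: dvdE)
  have "\<not> q dvd t'" using nt m st by auto
  then have "coprime t' q" using q by (metis coprime_commute prime_imp_coprime)
  then obtain j where "[t' * j = Suc 0] (mod q)" using cong_solve_coprime_nat[of t' q] by auto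
  then have "[t' * j * s' = Suc 0 * s'] (mod q)" by (rule cong_scalar_right)
  then have "[t' * (j * s') = s'] (mod q)" by (simp add: mult.assoc)
  then obtain i where "[t' * i = s'] (mod q)" by blast
  then have "[m * (t' * i) = m * s'] (mod (m * q))" by (rule cong_cmult_leftI)
  then have "[t * i = s] (mod (p - 1))" using m st by (simp add: mult.assoc)
  then have "[g ^ (t * i) = g ^ s] (mod p)" using order_divides_expdiff[of p g "t * i" s] g tot coprime_commute by metis
  moreover have "[l ^ i = g ^ (t * i)] (mod p)" using cong_pow[OF t, of i] by (simp add: power_mult)
  ultimately have "[k = l ^ i] (mod p)" using s by (metis cong_sym cong_trans)
  then show ?thesis by blast
qed

section \<open>Modular complements and invariant cyclic subgroups\<close>

context fin_group
begin

lemma normal_sylow_contains: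
  assumes S: "sylow_subgroup p S G" "normalizes G (carrier G) S" and R: "subgroup R G" "prime_power_card p R"
  shows "R \<subseteq> S"
proof -
  obtain g where g: "g \<in> carrier G" "R \<subseteq> cj G g ` S" using sylow_contains[OF R S(1)] by blast
  then show ?thesis using S(2) by (auto simp: normalizes_def)
qed

lemma prime_card_cj_exponent:
  assumes C: "subgroup C G" "prime (card C)" and c: "c \<in> C" "c \<noteq> \<one>" and u: "u \<in> carrier G" "\<And>c. c \<in> C \<Longrightarrow> cj G u c \<in> C"
    and uq: "cj G (u [^] (q::nat)) c = c"
  obtains k :: nat where "cj G u c = c [^] k" "[k ^ q = 1] (mod (card C))" "\<And>i. cj G (u [^] (i::nat)) c = c [^] (k ^ i)"
proof -
  have cG: "c \<in> carrier G" using c C subgroup.mem_carrier by metis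
  obtain k :: nat where k: "cj G u c = c [^] k" using prime_card_cyclic(2)[OF C c u(2)[OF c(1)]] by blast
  have pw: "cj G (u [^] i) c = c [^] (k ^ i)" for i :: nat
  proof (induction i)
    case (Suc i)
    have "cj G (u [^] Suc i) c = cj G (u [^] i) (cj G u c)" using u(1) cG by (simp add: cj_mult)
    also have "\<dots> = (c [^] (k ^ i)) [^] k" using k Suc u(1) cG by (simp flip: cj_pow)
    finally show ?case using cG by (simp add: nat_pow_pow mult.commute)
  qed (use cG in simp)
  have "ord c = card C" using prime_card_cyclic(1)[OF C c] generate_pow_card[OF cG] by simp
  moreover have "c [^] (k ^ q) = c [^] (1::nat)" using pw[of q] uq cG by simp
  ultimately have "[k ^ q = 1] (mod (card C))"
    using int_pow_eq[OF cG, of "int (k ^ q)" "int 1"] cG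
    by (metis cong_iff_dvd_diff cong_int_iff cong_sym int_pow_int)
  then show ?thesis using that k pw by blast
qed

text \<open>Modulo the centralizer \<open>C\<close> of \<open>V\<close> in \<open>Q\<close> the
  group has order \<open>p\<close> or \<open>p q\<close>. Instead of passing to this quotient, the
  criterion \<open>modular_by_maximality\<close> is verified directly, by cases on whether
  \<open>p\<close> divides the orders of \<open>Y\<close> and \<open>Z\<close>.\<close>

lemma modular_complement_of_prime:
  assumes V: "subgroup V G" "card V = p" "normalizes G (carrier G) V" and p: "prime p"
    and Q: "subgroup Q G" "prime_power_card q Q" and q: "prime q" "p \<noteq> q"
    and G: "carrier G = Q <#> V"
    and pw: "\<And>u v. u \<in> Q \<Longrightarrow> v \<in> V \<Longrightarrow> cj G (u [^] q) v = v"
  shows "modular_subgroup Q G"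
proof (rule modular_by_maximality[OF Q(1)])
  fix Y Z assume Y: "subgroup Y G" and Z: "subgroup Z G" and YZ: "Y \<subseteq> Z" and nYQ: "\<not> Y \<subseteq> Q" and QZ: "Q \<inter> Z \<subseteq> Y"
  have pV: "prime (card V)" and ppV: "prime_power_card p V" using V(2) p by (auto simp: prime_power_card_def intro: exI[of _ 1])
  have VG: "V \<subseteq> carrier G" and QG: "Q \<subseteq> carrier G" using V Q subgroup.subset by auto
  have QV: "Q \<inter> V = {\<one>}" using coprime_Int_trivial[OF Q V(1) ppV q(1) p] q(2) by simp
  have nQV: "normalizes G Q V" using V(3) QG by (auto simp: normalizes_def)
  obtain n where n: "card Q = q ^ n" using Q(2) prime_power_card_def by metis
  have cG: "order G = q ^ n * p" using card_set_mult[OF Q(1) V(1)] QV n V(2) G by (simp add: order_def)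
  have pqn: "\<not> p dvd q ^ n" using p q by (metis prime_dvd_power primes_dvd_imp_eq)
  have "multiplicity p (order G) = 1" using cG p pqn by (intro multiplicity_eqI) auto
  then have sylV: "sylow_subgroup p V G" using V p by (simp add: sylow_subgroup_def)
  define C where "C = {u \<in> Q. \<forall>v\<in>V. cj G u v = v}"
  have commC: "u \<in> C" if u: "u \<in> Q" and v: "v \<in> V" "v \<noteq> \<one>" "cj G u v = v" for u v
  proof -
    have "cj G u w = w" if w: "w \<in> V" for w
    proof -
      obtain k :: nat where "w = v [^] k" using prime_card_cyclic(2)[OF V(1) pV v(1,2) w] by blast
      then show ?thesis using v u QG VG by (metis cj_pow subsetD)
    qed
    then show ?thesis using u C_def by blast
  qed
  have fixC: "cj G v u = u" if "u \<in> C" "v \<in> V" for u v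
    using that cj_fix_sym[of u v] VG QG unfolding C_def by blast
  \<comment> \<open>The commutator of \<open>v\<close> and \<open>w\<close> lies in \<open>V\<close>
    and in \<open>Q\<close>. So \<open>Q\<close> and its conjugate by a nontrivial \<open>v\<close>
    share only elements of \<open>C\<close>.\<close>
  have conjC: "u \<in> C \<and> w = u" if v: "v \<in> V" "v \<noteq> \<one>" and w: "w \<in> Q" "cj G v w = u" "u \<in> Q" for u v w
  proof -
    have c: "v \<in> carrier G" "w \<in> carrier G" using v w VG QG by auto
    have "cj G v w \<otimes> inv w = v \<otimes> cj G w (inv v)" using c by (simp add: cj_def m_assoc)
    moreover have "cj G w (inv v) \<in> V" using nQV w subgroup.m_inv_closed[OF V(1) v(1)] by (simp add: normalizes_def)
    ultimately have "u \<otimes> inv w \<in> V" using w(2) subgroup.m_closed[OF V(1) v(1)] by simp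
    moreover have "u \<otimes> inv w \<in> Q" using w subgroup.m_closed[OF Q(1)] subgroup.m_inv_closed[OF Q(1)] by blast
    ultimately have "u \<otimes> inv w = \<one>" using QV by blast
    then have "u \<otimes> inv w \<otimes> w = \<one> \<otimes> w" by simp
    then have uw: "u = w" using c w QG by (auto simp: m_assoc)
    then have "cj G w v = v" using w(2) cj_fix_sym c by simp
    then show ?thesis using commC[OF w(1) v] uw by simp
  qed
  have q_sub: "\<exists>v\<in>V. R \<subseteq> cj G v ` Q" if R: "subgroup R G" "\<not> p dvd card R" for R
  proof -
    have "card R dvd q ^ n * p" using card_dvd_order[OF R(1)] cG by simp
    moreover have "coprime (card R) p" using R(2) p by (metis coprime_commute prime_imp_coprime)
    ultimately have "card R dvd q ^ n" using coprime_dvd_mult_left_iff by blast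
    then have "prime_power_card q R" using divides_primepow_nat[OF q(1)] unfolding prime_power_card_def by blast
    then show ?thesis using complement_conjugate[OF V(1) ppV Q p q nQV G R(1)] by metis
  qed
  have VsubR: "V \<subseteq> R" if R: "subgroup R G" "p dvd card R" for R
  proof -
    obtain z where z: "z \<in> R" "card (generate G {z}) = p" using cauchy[OF R(1) p R(2)] by metis
    have zG: "z \<in> carrier G" using z R subgroup.mem_carrier by metis
    have s: "subgroup (generate G {z}) G" using cyclic_subgroup[OF zG] .
    have "prime_power_card p (generate G {z})" unfolding prime_power_card_def using z by (metis power_one_right)
    then have "generate G {z} \<subseteq> V" using normal_sylow_contains[OF sylV V(3) s] by blast
    then have "generate G {z} = V" using subgroup_eqI[OF V(1)] z V(2) by simp
    then show ?thesis using cyclic_least[OF R(1) z(1)] by simp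
  qed
  obtain t where t: "t \<in> Y" "t \<notin> C" using nYQ C_def by blast
  show "Y = Z"
  proof
    show "Z \<subseteq> Y"
    proof
      fix z assume z: "z \<in> Z"
      have zG: "z \<in> carrier G" using z Z subgroup.mem_carrier by metis
      show "z \<in> Y"
      proof (cases "p dvd card Y")
        case True
        have VY: "V \<subseteq> Y" using VsubR[OF Y True] .
        have "z \<in> Q <#> V" using zG G by simp
        then obtain u v where uv: "u \<in> Q" "v \<in> V" "z = u \<otimes> v" by (auto simp: set_mult_def)
        have c: "u \<in> carrier G" "v \<in> carrier G" using uv VG QG by auto
        have "u = z \<otimes> inv v" using uv c by (simp add: m_assoc)
        moreover have "inv v \<in> Z" using uv(2) VY YZ subgroup.m_inv_closed[OF Z] by blast
        ultimately have "u \<in> Z" using subgroup.m_closed[OF Z z] by simp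
        then have "u \<in> Y" "v \<in> Y" using uv QZ VY by auto
        then show ?thesis using uv(3) subgroup.m_closed[OF Y] by simp
      next
        case nY: False
        obtain v where v: "v \<in> V" "Y \<subseteq> cj G v ` Q" using q_sub[OF Y nY] by blast
        have v1: "v \<noteq> \<one>" using v(2) nYQ cj_image_one[OF QG] by auto
        have vG: "v \<in> carrier G" using v VG by blast
        show ?thesis
        proof (cases "p dvd card Z")
          case True
          \<comment> \<open>This case cannot occur: \<open>Z\<close> contains \<open>v\<close> and
            hence the conjugate \<open>w\<close> of \<open>t\<close> in \<open>Q\<close>, so
            \<open>Y\<close> contains \<open>w\<close>. Then \<open>conjC\<close> puts
            \<open>w\<close>, and with it \<open>t\<close>, into \<open>C\<close>.\<close>
          have VZ: "V \<subseteq> Z" using VsubR[OF Z True] .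
          obtain w where w: "w \<in> Q" "t = cj G v w" using t(1) v(2) by blast
          have wG: "w \<in> carrier G" using w QG by blast
          have "w = inv v \<otimes> t \<otimes> v" using w vG wG by (simp add: cj_def m_assoc)
          moreover have "v \<in> Z" "t \<in> Z" using v VZ t YZ by auto
          ultimately have "w \<in> Z" using subgroup.m_closed[OF Z] subgroup.m_inv_closed[OF Z] by simp
          then have "w \<in> Y" using w QZ by blast
          then obtain w' where w': "w' \<in> Q" "w = cj G v w'" using v(2) by blast
          have "w \<in> C" using conjC[OF v(1) v1 w'(1) w'(2)[symmetric] w(1)] by blast
          then have "t = w" using w(2) fixC[OF _ v(1)] by simp
          then show ?thesis using \<open>w \<in> C\<close> t by simp
        next
          case nZ: False
          obtain v where v: "v \<in> V" "Z \<subseteq> cj G v ` Q" using q_sub[OF Z nZ] by blast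
          have v1: "v \<noteq> \<one>" using v(2) YZ nYQ cj_image_one[OF QG] by auto
          have vG: "v \<in> carrier G" using v VG by blast
          obtain w where w: "w \<in> Q" "t = cj G v w" using t(1) v(2) YZ by blast
          have wC: "w \<notin> C" using w(2) t(2) fixC[OF _ v(1)] by auto
          obtain u where u: "u \<in> Q" "z = cj G v u" using z v(2) by blast
          have c: "w \<in> carrier G" "u \<in> carrier G" using w u QG by auto
          have cl: "cj G x y \<in> V" if "x \<in> Q" "y \<in> V" for x y using nQV that by (auto simp: normalizes_def)
          \<comment> \<open>The elements \<open>u\<close> and \<open>w\<close> act on
            \<open>V\<close> as powers whose exponents are \<open>q\<close>-th roots of unity modulo
            \<open>p\<close>. Since \<open>w\<close> acts nontrivially, \<open>u\<close> acts like a
            power of \<open>w\<close>, and \<open>z\<close> differs from that power of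
            \<open>t\<close> by an element of \<open>C\<close>.\<close>
          obtain k :: nat where k: "cj G u v = v [^] k" "[k ^ q = 1] (mod (card V))"
            using prime_card_cj_exponent[OF V(1) pV v(1) v1 c(2) cl[OF u(1)] pw[OF u(1) v(1)]] by metis
          obtain l :: nat where l: "cj G w v = v [^] l" "[l ^ q = 1] (mod (card V))" "\<And>i. cj G (w [^] (i::nat)) v = v [^] (l ^ i)"
            using prime_card_cj_exponent[OF V(1) pV v(1) v1 c(1) cl[OF w(1)] pw[OF w(1) v(1)]] by metis
          have vp: "v [^] card V = \<one>" using pow_card_one[OF V(1) v(1)] .
          have "\<not> [l = 1] (mod (card V))"
          proof
            assume "[l = 1] (mod (card V))"
            then have "cj G w v = v" using pow_cong[OF vG vp] l(1) vG by (metis nat_pow_eone)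
            then show False using commC[OF w(1) v(1) v1] wC by simp
          qed
          then obtain i where "[k = l ^ i] (mod (card V))"
            using power_roots_of_unity_mod_prime[OF pV q(1) k(2) l(2)] by blast
          then have "cj G u v = cj G (w [^] i) v" using k(1) l(3) pow_cong[OF vG vp] by metis
          then have "cj G (inv (w [^] i) \<otimes> u) v = v" using c vG by (simp add: cj_mult)
          moreover have "inv (w [^] i) \<otimes> u \<in> Q"
            using u(1) subgroup.m_closed[OF Q(1)] subgroup.m_inv_closed[OF Q(1)] subgroup_pow[OF Q(1) w(1)] by simp
          ultimately have cC: "inv (w [^] i) \<otimes> u \<in> C" using commC v(1) v1 by blast
          have "inv (t [^] i) \<otimes> z = cj G v (inv (w [^] i) \<otimes> u)"
            unfolding w(2) u(2) using c vG by (simp add: cj_mult cj_inv cj_pow)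
          then have e: "inv (t [^] i) \<otimes> z = inv (w [^] i) \<otimes> u" using fixC[OF cC v(1)] by simp
          have tG: "t \<in> carrier G" using t(1) subgroup.mem_carrier[OF Y] by blast
          have tiY: "t [^] i \<in> Y" using subgroup_pow[OF Y t(1)] .
          then have "inv (t [^] i) \<otimes> z \<in> Z" using z YZ subgroup.m_closed[OF Z] subgroup.m_inv_closed[OF Z] by blast
          moreover have "inv (t [^] i) \<otimes> z \<in> Q" using e cC C_def by simp
          ultimately have "inv (t [^] i) \<otimes> z \<in> Y" using QZ by blast
          then have "t [^] i \<otimes> (inv (t [^] i) \<otimes> z) \<in> Y" using tiY subgroup.m_closed[OF Y] by blast
          then show ?thesis using tG zG by simp
        qed
      qed
    qed
  qed (rule YZ)
qed

lemma submodular_first_step: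
  assumes "submodular_subgroup A G" "A \<noteq> carrier G"
  obtains K where "subgroup K G" "A \<subset> K" "modular_subgroup A (G\<lparr>carrier := K\<rparr>)"
proof -
  have "carrier G = A \<or> (\<exists>K. subgroup K G \<and> A \<subset> K \<and> modular_subgroup A (G\<lparr>carrier := K\<rparr>))"
    using assms(1)
  proof (induction rule: submodular_induct)
    case (step M K)
    show ?case
    proof (cases "M = A")
      case True
      then show ?thesis using step(2,4,5) by (cases "K = A") blast+
    qed (use step(6) in blast)
  qed simp
  then show ?thesis using assms(2) that by blast
qed

text \<open>The first chain member \<open>K\<close> above \<open>A\<close> contains a nontrivial
  \<open>v\<close> of \<open>V\<close>. The first modular law for \<open>?X\<close> and
  \<open>V \<inter> K\<close> makes \<open>?X\<close> the intersection of
  \<open>V \<inter> K\<close> with the join of \<open>?X\<close> and \<open>A\<close>; that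
  intersection is normalized by \<open>A\<close>.\<close>

lemma submodular_invariant_cyclic:
  assumes V: "subgroup V G" "A \<inter> V = {\<one>}" "V \<noteq> {\<one>}" "normalizes G (carrier G) V"
    and G: "carrier G = A <#> V" and A: "submodular_subgroup A G"
  obtains v where "v \<in> V" "v \<noteq> \<one>" "\<And>a. a \<in> A \<Longrightarrow> cj G a v \<in> generate G {v}"
proof -
  have sA: "subgroup A G" using submodular_subgroup_subgroup[OF A] .
  have AG: "A \<subseteq> carrier G" and VG: "V \<subseteq> carrier G" using sA V subgroup.subset by auto
  have "A \<noteq> carrier G" using V(2,3) VG by blast
  then obtain K where K: "subgroup K G" "A \<subset> K" "modular_subgroup A (G\<lparr>carrier := K\<rparr>)"
    using submodular_first_step[OF A] by blast
  then obtain k where k: "k \<in> K" "k \<notin> A" by blast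
  have "k \<in> A <#> V" using k(1) subgroup.mem_carrier[OF K(1)] G by simp
  then obtain a v where av: "a \<in> A" "v \<in> V" "k = a \<otimes> v" by (auto simp: set_mult_def)
  have c: "a \<in> carrier G" "v \<in> carrier G" using av AG VG by auto
  have "v = inv a \<otimes> k" using av c by simp
  moreover have "inv a \<in> K" using av(1) K(2) subgroup.m_inv_closed[OF K(1)] by blast
  ultimately have vK: "v \<in> K" using k(1) subgroup.m_closed[OF K(1)] by simp
  have v1: "v \<noteq> \<one>" using k(2) av c by auto
  let ?X = "generate G {v}"
  have sX: "subgroup ?X G" using cyclic_subgroup[OF c(2)] .
  have sZ: "subgroup (V \<inter> K) G" using subgroup_Int[OF V(1) K(1)] .
  have XZ: "?X \<subseteq> V \<inter> K" using cyclic_least[OF sZ] av vK by blast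
  have "generate G (?X \<union> (A \<inter> (V \<inter> K))) = generate G (?X \<union> A) \<inter> (V \<inter> K)"
    using K(3)[unfolded modular_sub_iff[OF K(1)]] sX sZ XZ by blast
  moreover have "A \<inter> (V \<inter> K) \<subseteq> ?X" using V(2) subgroup.one_closed[OF sX] by (metis Int_assoc Int_lower1 empty_subsetI insert_subset subset_trans)
  then have "?X \<union> (A \<inter> (V \<inter> K)) = ?X" by blast
  ultimately have X: "?X = generate G (?X \<union> A) \<inter> (V \<inter> K)" using generate_id[OF sX] by simp
  have s: "?X \<union> A \<subseteq> carrier G" using AG subgroup.subset[OF sX] by blast
  have sJ: "subgroup (generate G (?X \<union> A)) G" using generate_is_subgroup[OF s] .
  have J: "?X \<subseteq> generate G (?X \<union> A)" "A \<subseteq> generate G (?X \<union> A)" using generate_subset[OF s] by auto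
  have "cj G b v \<in> ?X" if b: "b \<in> A" for b
  proof -
    have "cj G b v \<in> generate G (?X \<union> A)" using cj_self_image[OF sJ, of b] b J cyclic_self by blast
    moreover have "cj G b v \<in> V" using V(4) b AG av by (auto simp: normalizes_def)
    moreover have "cj G b v \<in> K" using cj_self_image[OF K(1), of b] b K(2) vK by blast
    ultimately show ?thesis using X by blast
  qed
  then show ?thesis using that av(2) v1 by blast
qed

end

section \<open>Complements of a normal p-subgroup\<close>

context fin_group
begin

text \<open>Repeated normalizers climb from \<open>L\<close> to \<open>P\<close>, and every step is
  normal, hence modular.\<close>

lemma p_group_submodular:
  assumes P: "subgroup P G" "prime p" "prime_power_card p P" and L: "subgroup L G" "L \<subseteq> P"
  shows "submodular_subgroup L (G\<lparr>carrier := P\<rparr>)"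
  using L
proof (induction "card P - card L" arbitrary: L rule: less_induct)
  case less
  interpret P: fin_group "G\<lparr>carrier := P\<rparr>" using fin_group_sub[OF P(1)] .
  show ?case
  proof (cases "L = P")
    case True
    then show ?thesis using P.submodular_self by simp
  next
    case False
    have LG: "L \<subseteq> carrier G" using subgroup.subset[OF less.prems(1)] .
    obtain g where g: "g \<in> P" "g \<notin> L" "cj G g ` L = L"
      using normalizer_grows[OF P less.prems(1)] less.prems(2) False by blast
    let ?N = "normr G L \<inter> P"
    have N: "subgroup ?N G" using subgroup_Int[OF normr_subgroup[OF LG] P(1)] .
    have gN: "g \<in> ?N" using g subgroup.mem_carrier[OF P(1)] by (simp add: normr_def)
    have LN: "L \<subseteq> ?N" using normr_super[OF less.prems(1)] less.prems(2) by blast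
    have "card L < card ?N" using gN g(2) LN by (intro psubset_card_mono[OF sub_finite[OF N]]) blast
    moreover have "card ?N \<le> card P" using sub_finite[OF P(1)] by (intro card_mono) auto
    ultimately have smN: "submodular_subgroup ?N (G\<lparr>carrier := P\<rparr>)" using less.hyps[OF _ N] by simp
    interpret N: group "G\<lparr>carrier := ?N\<rparr>" using subgroup_imp_group[OF N] .
    have "cj G n l \<in> L" if "n \<in> ?N" "l \<in> L" for n l using that unfolding normr_def by blast
    then have "L \<lhd> G\<lparr>carrier := ?N\<rparr>"
      using LN less.prems(1) subgroup_subset_iff[OF N] cj_consistent[OF N]
      by (simp add: N.normal_iff_normalizes normalizes_def)
    then have "submodular_subgroup L (G\<lparr>carrier := ?N\<rparr>)"
      using N.normal_modular N.modular_submodular by blast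
    then show ?thesis using P.submodular_trans[OF _ smN] by simp
  qed
qed

text \<open>Sylow subgroups of \<open>A\<close> and \<open>B\<close> lie in conjugates of one Sylow
  subgroup by \<open>g\<close> and \<open>h\<close>. Writing \<open>g \<otimes> inv h\<close> as
  \<open>a \<otimes> b\<close> brings both into a single conjugate \<open>Q\<close>, at the cost of
  conjugations inside \<open>A\<close> and inside \<open>B\<close>. Comparing orders shows that the
  two intersections fill \<open>Q\<close>.\<close>

lemma factorized_sylow:
  assumes A: "subgroup A G" and B: "subgroup B G" and G: "carrier G = A <#> B" and q: "prime q"
  obtains Q where "sylow_subgroup q Q G" "Q \<subseteq> (Q \<inter> A) <#> (Q \<inter> B)"
proof -
  have ex: "\<exists>S. subgroup S G \<and> S \<subseteq> H \<and> card S = q ^ multiplicity q (card H)" if H: "subgroup H G" for H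
  proof -
    interpret H: fin_group "G\<lparr>carrier := H\<rparr>" using fin_group_sub[OF H] .
    obtain m where "order (G\<lparr>carrier := H\<rparr>) = q ^ multiplicity q (card H) * m"
      using multiplicity_dvd[of q "card H"] by (auto simp: order_def elim!: dvdE)
    then obtain S where "subgroup S (G\<lparr>carrier := H\<rparr>)" "card S = q ^ multiplicity q (card H)"
      using sylow_thm[OF q H.is_group _ H.fin] by metis
    then show ?thesis using subgroup_subset_iff[OF H] by auto
  qed
  obtain Sa where Sa: "subgroup Sa G" "Sa \<subseteq> A" "card Sa = q ^ multiplicity q (card A)" using ex[OF A] by blast
  obtain Sb where Sb: "subgroup Sb G" "Sb \<subseteq> B" "card Sb = q ^ multiplicity q (card B)" using ex[OF B] by blast
  obtain S where S: "subgroup S G" "card S = q ^ multiplicity q (order G)" using ex[OF subgroup_self] by (auto simp: order_def)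
  have syl: "sylow_subgroup q S G" using S q by (simp add: sylow_subgroup_def)
  have SG: "S \<subseteq> carrier G" using subgroup.subset[OF S(1)] .
  have AG: "A \<subseteq> carrier G" and BG: "B \<subseteq> carrier G" using A B subgroup.subset by auto
  have pp: "prime_power_card q Sa" "prime_power_card q Sb" using Sa Sb by (auto simp: prime_power_card_def)
  obtain g where g: "g \<in> carrier G" "Sa \<subseteq> cj G g ` S" by (rule sylow_contains[OF Sa(1) pp(1) syl])
  obtain h where h: "h \<in> carrier G" "Sb \<subseteq> cj G h ` S" by (rule sylow_contains[OF Sb(1) pp(2) syl])
  have "g \<otimes> inv h \<in> carrier G" using g h by simp
  then have "g \<otimes> inv h \<in> A <#> B" unfolding G .
  then obtain a b where ab: "a \<in> A" "b \<in> B" "g \<otimes> inv h = a \<otimes> b" by (auto simp: set_mult_def)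
  have c: "a \<in> carrier G" "b \<in> carrier G" using ab AG BG by auto
  have e: "inv a \<otimes> g = b \<otimes> h"
  proof -
    have "inv a \<otimes> g = inv a \<otimes> (g \<otimes> inv h) \<otimes> h" using c g h by (simp add: m_assoc)
    then show ?thesis using ab(3) c h by (simp add: m_assoc)
  qed
  define Q where "Q = cj G (inv a \<otimes> g) ` S"
  have kG: "inv a \<otimes> g \<in> carrier G" using c g by simp
  have Q: "subgroup Q G" "card Q = q ^ multiplicity q (order G)"
    using cj_subgroup[OF kG S(1)] cj_card[OF kG SG] S(2) Q_def by auto
  have sylQ: "sylow_subgroup q Q G" using Q q by (simp add: sylow_subgroup_def)
  have ppQ: "prime_power_card q Q" using Q by (auto simp: prime_power_card_def)
  have Qa: "Q = cj G (inv a) ` cj G g ` S" using cj_image_comp[of "inv a" g S] c g SG Q_def by simp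
  have Qb: "Q = cj G b ` cj G h ` S" using cj_image_comp[of b h S] c h SG Q_def e by simp
  let ?A = "cj G (inv a) ` Sa" and ?B = "cj G b ` Sb"
  have ia: "inv a \<in> A" using subgroup.m_inv_closed[OF A ab(1)] .
  have iaG: "inv a \<in> carrier G" using c by simp
  have "?A \<subseteq> cj G (inv a) ` A" using Sa(2) by blast
  then have A': "?A \<subseteq> Q \<inter> A" using cj_self_image[OF A ia] g(2) Qa by blast
  have "?B \<subseteq> cj G b ` B" using Sb(2) by blast
  then have B': "?B \<subseteq> Q \<inter> B" using cj_self_image[OF B ab(2)] h(2) Qb by blast
  have sQA: "subgroup (Q \<inter> A) G" and sQB: "subgroup (Q \<inter> B) G" using subgroup_Int Q A B by auto
  have "card Sa = card ?A" using cj_card[OF iaG subgroup.subset[OF Sa(1)]] by simp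
  then have cA: "card Sa \<le> card (Q \<inter> A)" using card_mono[OF sub_finite[OF sQA] A'] by simp
  have "card Sb = card ?B" using cj_card[OF c(2) subgroup.subset[OF Sb(1)]] by simp
  then have cB: "card Sb \<le> card (Q \<inter> B)" using card_mono[OF sub_finite[OF sQB] B'] by simp
  let ?I = "Q \<inter> A \<inter> (Q \<inter> B)"
  have sI: "subgroup ?I G" using subgroup_Int[OF sQA sQB] .
  have sAB: "subgroup (A \<inter> B) G" using subgroup_Int[OF A B] .
  have "prime_power_card q ?I" by (rule prime_power_card_sub[OF sI Q(1) _ q ppQ]) blast
  then obtain i where i: "card ?I = q ^ i" using prime_power_card_def by metis
  have "q ^ i dvd card (A \<inter> B)" using card_dvd[OF sI sAB] i by auto
  then have "i \<le> multiplicity q (card (A \<inter> B))"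
    using card_pos[OF sAB] prime_gt_1_nat[OF q] by (intro multiplicity_geI) auto
  then have cI: "card ?I \<le> q ^ multiplicity q (card (A \<inter> B))" unfolding i using prime_gt_0_nat[OF q] by (intro power_increasing) auto
  have "order G * card (A \<inter> B) = card A * card B" using card_set_mult[OF A B] G by (simp add: order_def)
  then have "multiplicity q (order G) + multiplicity q (card (A \<inter> B)) = multiplicity q (card A) + multiplicity q (card B)"
    using q card_pos[OF A] card_pos[OF B] card_pos[OF sAB] card_pos[OF subgroup_self]
    by (metis order_def less_irrefl prime_elem_multiplicity_mult_distrib prime_imp_prime_elem)
  then have "card Q * q ^ multiplicity q (card (A \<inter> B)) = card Sa * card Sb"
    using Q(2) Sa(3) Sb(3) by (metis power_add)
  also have "\<dots> \<le> card (Q \<inter> A) * card (Q \<inter> B)" using cA cB by (rule mult_le_mono)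
  also have "\<dots> = card ((Q \<inter> A) <#> (Q \<inter> B)) * card ?I" using card_set_mult[OF sQA sQB] by simp
  also have "\<dots> \<le> card ((Q \<inter> A) <#> (Q \<inter> B)) * q ^ multiplicity q (card (A \<inter> B))" using cI by simp
  finally have "card Q \<le> card ((Q \<inter> A) <#> (Q \<inter> B))" using q by (simp add: prime_gt_0_nat)
  moreover have "(Q \<inter> A) <#> (Q \<inter> B) \<subseteq> Q" using set_mult_least[OF Q(1)] by blast
  ultimately have "(Q \<inter> A) <#> (Q \<inter> B) = Q" using card_seteq[OF sub_finite[OF Q(1)]] by blast
  then show ?thesis using that sylQ by blast
qed

end

section \<open>Homomorphisms, primary elements and products\<close>

context group_hom
begin

lemma p_elem_image: "p_elem G p x \<Longrightarrow> p_elem H p (h x)"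
  unfolding p_elem_def by (metis hom_closed hom_nat_pow hom_one)

lemma prime_power_card_image:
  assumes "fin_group G" "fin_group H" "prime p" "subgroup L G" "prime_power_card p L"
  shows "prime_power_card p (h ` L)"
  using fin_group.prime_power_cardI[OF assms(2) subgroup_img_is_subgroup[OF assms(4)] assms(3)]
    fin_group.p_elem_in[OF assms(1,4,5)] p_elem_image by blast

lemma normalizes_image:
  "L \<subseteq> carrier G \<Longrightarrow> N \<subseteq> carrier G \<Longrightarrow> normalizes G L N \<Longrightarrow> normalizes H (h ` L) (h ` N)"
  by (auto simp: normalizes_def subset_iff simp flip: cj_hom_image)

lemma set_mult_image: "L \<subseteq> carrier G \<Longrightarrow> N \<subseteq> carrier G \<Longrightarrow> h ` (L <#> N) = h ` L <#>\<^bsub>H\<^esub> h ` N"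
  by (force simp: set_mult_def image_iff subset_iff)

lemma preimage_image:
  assumes L: "subgroup L G" and ker: "\<And>x. x \<in> carrier G \<Longrightarrow> h x = \<one>\<^bsub>H\<^esub> \<longleftrightarrow> x \<in> N" and N: "N \<subseteq> carrier G"
  shows "{x \<in> carrier G. h x \<in> h ` L} = L <#> N"
proof
  show "L <#> N \<subseteq> {x \<in> carrier G. h x \<in> h ` L}"
  proof
    fix x assume "x \<in> L <#> N"
    then obtain l n where ln: "l \<in> L" "n \<in> N" "x = l \<otimes> n" by (auto simp: set_mult_def)
    have c: "l \<in> carrier G" "n \<in> carrier G" using ln N subgroup.mem_carrier[OF L] by auto
    have "h x = h l" using ker[OF c(2)] ln c by simp
    then show "x \<in> {x \<in> carrier G. h x \<in> h ` L}" using ln c by auto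
  qed
  show "{x \<in> carrier G. h x \<in> h ` L} \<subseteq> L <#> N"
  proof
    fix x assume "x \<in> {x \<in> carrier G. h x \<in> h ` L}"
    then obtain l where l: "x \<in> carrier G" "l \<in> L" "h x = h l" by blast
    have lG: "l \<in> carrier G" using l subgroup.mem_carrier[OF L] by simp
    have "inv l \<otimes> x \<in> N" using l lG ker[of "inv l \<otimes> x"] by simp
    then have "l \<otimes> (inv l \<otimes> x) \<in> L <#> N" using l(2) G.set_multI by blast
    then show "x \<in> L <#> N" using l lG by simp
  qed
qed

end

text \<open>A coprime action of \<open>Q\<close> on \<open>P\<close> that is abelian by
  \<open>comm\<close>, where \<open>Q\<close> is generated by submodular elements and elements
  acting trivially. These conditions survive factoring out an invariant part of \<open>P\<close>,
  which drives the induction.\<close>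

locale submodular_action = fin_group +
  fixes p q :: nat and P Q S :: "'a set"
  assumes pq: "prime p" "prime q" "p \<noteq> q"
    and P: "subgroup P G" "prime_power_card p P" "normalizes G (carrier G) P"
    and Q: "subgroup Q G" "prime_power_card q Q"
    and G_eq: "carrier G = Q <#> P"
    and S: "S \<subseteq> Q" "\<And>a. a \<in> S \<Longrightarrow> submodular_subgroup (generate G {a}) G"
    and gen: "Q \<subseteq> generate G (S \<union> {u \<in> Q. \<forall>v\<in>P. cj G u v = v})"
    and comm: "\<And>u v w. u \<in> Q \<Longrightarrow> v \<in> Q \<Longrightarrow> w \<in> P \<Longrightarrow> cj G u (cj G v w) = cj G v (cj G u w)"
begin

lemma QG: "Q \<subseteq> carrier G" and PG: "P \<subseteq> carrier G"
  using Q P subgroup.subset by auto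

lemma cj_P: "g \<in> carrier G \<Longrightarrow> v \<in> P \<Longrightarrow> cj G g v \<in> P"
  using P(3) by (simp add: normalizes_def)

text \<open>Since the action is abelian, the elements whose \<open>q\<close>-th power acts trivially
  form a subgroup. It contains \<open>S\<close> by
  \<open>submodular_power_centralizes\<close>.\<close>

lemma q_power_trivial:
  assumes u: "u \<in> Q" and v: "v \<in> P"
  shows "cj G (u [^] q) v = v"
proof -
  let ?T = "{u \<in> Q. \<forall>v\<in>P. cj G (u [^] q) v = v}"
  have mult: "cj G ((a \<otimes> b) [^] n) w = cj G (a [^] n) (cj G (b [^] n) w)"
    if ab: "a \<in> Q" "b \<in> Q" and w: "w \<in> P" for a b w and n :: nat
    using w
  proof (induction n arbitrary: w)
    case (Suc n)
    have c: "a \<in> carrier G" "b \<in> carrier G" "w \<in> carrier G" using ab Suc.prems QG PG by auto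
    have w': "cj G b w \<in> P" "cj G a (cj G b w) \<in> P" using cj_P c Suc.prems by auto
    have "cj G ((a \<otimes> b) [^] Suc n) w = cj G ((a \<otimes> b) [^] n) (cj G a (cj G b w))"
      using c by (simp add: cj_mult)
    also have "\<dots> = cj G (a [^] n) (cj G (b [^] n) (cj G a (cj G b w)))" using Suc.IH[OF w'(2)] .
    also have "cj G (b [^] n) (cj G a (cj G b w)) = cj G a (cj G (b [^] n) (cj G b w))"
      using comm[OF subgroup_pow[OF Q(1) ab(2)] ab(1) w'(1)] .
    finally show ?case using c by (simp add: cj_mult)
  qed (use PG in auto)
  have T: "subgroup ?T G"
  proof (rule subgroupI)
    show "?T \<subseteq> carrier G" using QG by blast
    have "\<one> \<in> ?T" using subgroup.one_closed[OF Q(1)] PG by auto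
    then show "?T \<noteq> {}" by blast
    fix a assume a: "a \<in> ?T"
    have aG: "a \<in> carrier G" using a QG by blast
    have "cj G (inv a [^] q) v = v" if v: "v \<in> P" for v
    proof -
      have vG: "v \<in> carrier G" using v PG by blast
      have "cj G (a [^] q) v = v" using a v by blast
      then have "cj G (inv (a [^] q)) v = v" using aG vG by (metis cj_cancel(1) nat_pow_closed)
      then show ?thesis using aG by (simp add: nat_pow_inv)
    qed
    then show "inv a \<in> ?T" using a subgroup.m_inv_closed[OF Q(1)] by blast
    fix b assume b: "b \<in> ?T"
    then show "a \<otimes> b \<in> ?T" using a mult subgroup.m_closed[OF Q(1)] by simp
  qed
  have "S \<union> {u \<in> Q. \<forall>v\<in>P. cj G u v = v} \<subseteq> ?T"
  proof (intro Un_least subsetI)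
    fix a assume a: "a \<in> S"
    have aQ: "a \<in> Q" using a S by blast
    show "a \<in> ?T"
      using submodular_power_centralizes[OF P pq p_elem_in[OF Q aQ] S(2)[OF a]] aQ by blast
  next
    fix a assume a: "a \<in> {u \<in> Q. \<forall>v\<in>P. cj G u v = v}"
    have "cj G (a [^] n) v = v" if "v \<in> P" for v and n :: nat
      using that a QG PG by (induction n) (auto simp: cj_mult subset_iff)
    then show "a \<in> ?T" using a by blast
  qed
  then have "generate G (S \<union> {u \<in> Q. \<forall>v\<in>P. cj G u v = v}) \<subseteq> ?T" by (rule generate_mono_sub[OF T])
  then show ?thesis using gen u v by blast
qed

text \<open>A minimal nontrivial \<open>Q\<close>-invariant subgroup \<open>V\<close> of the centre
  of \<open>P\<close> is shown to have order \<open>p\<close>. Then \<open>Q\<close> is modular in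
  \<open>Q <#> V\<close>, and the latter is submodular because its image modulo \<open>V\<close> is
  so by induction.\<close>

lemma submodular_complement_step:
  assumes IH: "\<And>(K :: 'a monoid) P Q S. order K < order G \<Longrightarrow> submodular_action K p q P Q S \<Longrightarrow> submodular_subgroup Q K"
  shows "submodular_subgroup Q G"
proof (cases "P = {\<one>}")
  case True
  then have "Q <#> P \<subseteq> Q" using set_mult_least[OF Q(1) subset_refl, of P] subgroup.one_closed[OF Q(1)] by simp
  then have "carrier G = Q" using G_eq QG by blast
  then show ?thesis using submodular_self by simp
next
  case False
  let ?R = "\<lambda>V. subgroup V G \<and> V \<noteq> {\<one>} \<and> V \<subseteq> P \<and> (\<forall>v\<in>V. \<forall>w\<in>P. cj G w v = v) \<and> normalizes G Q V"
  let ?Z = "{z \<in> P. \<forall>w\<in>P. cj G w z = z}"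
  have nPP: "normalizes G P P" using P(3) PG by (auto simp: normalizes_def)
  obtain z where z: "z \<in> P" "z \<noteq> \<one>" "\<And>w. w \<in> P \<Longrightarrow> cj G w z = z"
    using fixed_element[OF P(1) pq(1) P(2) P(1) P(2) False nPP] by blast
  have "?R ?Z"
  proof (intro conjI)
    show "subgroup ?Z G"
    proof (rule subgroupI)
      show "?Z \<noteq> {}" using z by blast
    qed (use PG subgroup.m_closed[OF P(1)] subgroup.m_inv_closed[OF P(1)] in \<open>auto simp: cj_mult cj_inv subset_iff\<close>)
    show "?Z \<noteq> {\<one>}" using z by blast
    show "normalizes G Q ?Z" unfolding normalizes_def
    proof (intro ballI)
      fix u v assume u: "u \<in> Q" and v: "v \<in> ?Z"
      have c: "u \<in> carrier G" "v \<in> carrier G" using u v QG PG by auto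
      have "cj G w (cj G u v) = cj G u v" if w: "w \<in> P" for w
      proof -
        have wG: "w \<in> carrier G" using w PG by blast
        have "cj G w (cj G u v) = cj G u (cj G (cj G (inv u) w) v)"
          using c wG by (simp add: cj_def m_assoc inv_mult_group)
        also have "cj G (cj G (inv u) w) v = v" using v cj_P[of "inv u" w] c w by simp
        finally show ?thesis .
      qed
      then show "cj G u v \<in> ?Z" using cj_P c v by simp
    qed
  qed auto
  then obtain V where V: "?R V" and min: "\<And>W. ?R W \<Longrightarrow> card V \<le> card W"
    using ex_has_least_nat[of ?R ?Z card] by blast
  have sV: "subgroup V G" and V1: "V \<noteq> {\<one>}" and VP: "V \<subseteq> P" and cent: "\<And>v w. v \<in> V \<Longrightarrow> w \<in> P \<Longrightarrow> cj G w v = v"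
    and nQV: "normalizes G Q V" using V by auto
  have VG: "V \<subseteq> carrier G" using VP PG by blast
  have minV: "W = V" if "subgroup W G" "W \<noteq> {\<one>}" "W \<subseteq> V" "normalizes G Q W" for W
  proof -
    have "?R W" using that VP cent by blast
    then show ?thesis using min card_seteq[OF sub_finite[OF sV] that(3)] by blast
  qed
  have ppV: "prime_power_card p V" using prime_power_card_sub[OF sV P(1) VP pq(1) P(2)] .
  have nV: "normalizes G (carrier G) V" unfolding normalizes_def
  proof (intro ballI)
    fix g v assume "g \<in> carrier G" and v: "v \<in> V"
    then have "g \<in> Q <#> P" using G_eq by simp
    then obtain u w where uw: "u \<in> Q" "w \<in> P" "g = u \<otimes> w" by (auto simp: set_mult_def)
    have c: "u \<in> carrier G" "w \<in> carrier G" "v \<in> carrier G" using uw v QG PG VG by auto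
    have "cj G g v = cj G u v" using uw c cent[OF v uw(2)] by (simp add: cj_mult)
    then show "cj G g v \<in> V" using nQV uw v by (simp add: normalizes_def)
  qed
  have abV: "v \<otimes> w = w \<otimes> v" if "v \<in> V" "w \<in> V" for v w
    using cent[OF that(2), of v] that VP VG cj_fix_iff by blast
  have power: "cj G a v \<in> generate G {v}" if a: "a \<in> S" and v: "v \<in> V" for a v
  proof -
    have aQ: "a \<in> Q" using a S by blast
    have aG: "a \<in> carrier G" using aQ QG by blast
    let ?A = "generate G {a}"
    have sA: "subgroup ?A G" using cyclic_subgroup[OF aG] .
    have nAV: "normalizes G ?A V" using nV subgroup.subset[OF sA] by (auto simp: normalizes_def)
    have L: "subgroup (?A <#> V) G" using set_mult_subgroupI[OF sA sV nAV] .
    have AL: "?A \<subseteq> ?A <#> V" "V \<subseteq> ?A <#> V" using set_mult_contains[OF sA sV] by auto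
    interpret L: fin_group "G\<lparr>carrier := ?A <#> V\<rparr>" using fin_group_sub[OF L] .
    have "prime_power_card q ?A" using p_elem_iff[OF pq(2) aG] p_elem_in[OF Q aQ] by simp
    then have AV: "?A \<inter> V = {\<one>}" using coprime_Int_trivial[OF sA _ sV ppV pq(2,1)] pq(3) by simp
    have "submodular_subgroup ?A (G\<lparr>carrier := ?A <#> V\<rparr>)" using submodular_sub[OF S(2)[OF a] L AL(1)] .
    moreover have "normalizes (G\<lparr>carrier := ?A <#> V\<rparr>) (carrier (G\<lparr>carrier := ?A <#> V\<rparr>)) V"
      using normalizes_Int_sub[OF L _ nV, of "?A <#> V"] AL(2) by (simp add: Int_absorb2)
    moreover have "subgroup V (G\<lparr>carrier := ?A <#> V\<rparr>)" using subgroup_subset_iff[OF L] sV AL by blast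
    ultimately obtain v0 where v0: "v0 \<in> V" "v0 \<noteq> \<one>" "\<And>b. b \<in> ?A \<Longrightarrow> cj (G\<lparr>carrier := ?A <#> V\<rparr>) b v0 \<in> generate (G\<lparr>carrier := ?A <#> V\<rparr>) {v0}"
      using L.submodular_invariant_cyclic[of V ?A] AV V1 by auto
    have v0G: "v0 \<in> carrier G" using v0 VG by blast
    have "generate (G\<lparr>carrier := ?A <#> V\<rparr>) {v0} = generate G {v0}"
      using generate_consistent[OF _ L, of "{v0}"] v0(1) AL(2) by blast
    then have "cj G a v0 \<in> generate G {v0}"
      using v0(3)[of a] cyclic_self[of a] cj_consistent[OF L, of a] AL(1) by auto
    then obtain k :: nat where k: "cj G a v0 = v0 [^] k" using generate_nat_pow[OF v0G] by blast
    \<comment> \<open>The eigenspace of \<open>a\<close> for the exponent \<open>k\<close>. It is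
      \<open>Q\<close>-invariant because the action is abelian, so minimality makes it all of
      \<open>V\<close>.\<close>
    let ?W = "{v \<in> V. cj G a v = v [^] k}"
    have "?W = V"
    proof (rule minV)
      have pm: "(x \<otimes> y) [^] k = x [^] k \<otimes> y [^] k" if "x \<in> V" "y \<in> V" for x y
        using pow_mult_distrib[OF abV[OF that]] that VG by blast
      show "subgroup ?W G"
      proof (rule subgroupI)
        show "?W \<noteq> {}" using v0 k by blast
        fix x assume x: "x \<in> ?W"
        show "inv x \<in> ?W" using x aG VG subgroup.m_inv_closed[OF sV] by (auto simp: cj_inv nat_pow_inv subset_iff)
        fix y assume y: "y \<in> ?W"
        have xy: "x \<in> V" "y \<in> V" "x \<in> carrier G" "y \<in> carrier G" using x y VG by auto
        have "cj G a (x \<otimes> y) = (x \<otimes> y) [^] k" using x y pm[OF xy(1,2)] cj_mult(1)[OF aG xy(3,4)] by simp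
        then show "x \<otimes> y \<in> ?W" using subgroup.m_closed[OF sV xy(1,2)] by simp
      qed (use VG in blast)
      show "?W \<noteq> {\<one>}" using v0 k by blast
      show "normalizes G Q ?W" unfolding normalizes_def
      proof (intro ballI)
        fix u v assume u: "u \<in> Q" and v: "v \<in> ?W"
        have c: "u \<in> carrier G" "v \<in> carrier G" using u v QG VG by auto
        have "cj G a (cj G u v) = cj G u (cj G a v)" using comm[OF aQ u] v VP by blast
        also have "\<dots> = (cj G u v) [^] k" using v c by (simp add: cj_pow)
        finally show "cj G u v \<in> ?W" using nQV u v by (simp add: normalizes_def)
      qed
    qed blast
    then have "cj G a v = v [^] k" using v by blast
    then show ?thesis using generate_nat_pow v VG by blast
  qed
  \<comment> \<open>The elements that preserve every cyclic subgroup of \<open>V\<close> form a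
    subgroup containing the generators of \<open>Q\<close>. So all cyclic subgroups of
    \<open>V\<close> are invariant, and by minimality \<open>V\<close> is one of prime
    order.\<close>
  let ?N = "{u \<in> Q. \<forall>v\<in>V. cj G u v \<in> generate G {v}}"
  have sN: "subgroup ?N G"
  proof (rule subgroupI)
    show "?N \<subseteq> carrier G" using QG by blast
    have "\<one> \<in> ?N" using subgroup.one_closed[OF Q(1)] VG cyclic_self by auto
    then show "?N \<noteq> {}" by blast
    fix x assume x: "x \<in> ?N"
    have xG: "x \<in> carrier G" using x QG by blast
    have im: "cj G x ` generate G {v} = generate G {v}" if v: "v \<in> V" for v
    proof -
      have vG: "v \<in> carrier G" using v VG by blast
      have s: "subgroup (generate G {v}) G" using cyclic_subgroup[OF vG] .
      have "cj G x v \<in> generate G {v}" using x v by blast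
      then have "cj G x ` generate G {v} \<subseteq> generate G {v}"
        unfolding cj_generate[OF xG vG] using cyclic_least[OF s] by blast
      then show ?thesis using subgroup_eqI[OF s] cj_card[OF xG subgroup.subset[OF s]] by blast
    qed
    have "cj G (inv x) v \<in> generate G {v}" if v: "v \<in> V" for v
    proof -
      have vG: "v \<in> carrier G" using v VG by blast
      have "v \<in> cj G x ` generate G {v}" using im[OF v] cyclic_self by simp
      then show ?thesis using cj_image_iff[OF xG vG subgroup.subset[OF cyclic_subgroup[OF vG]]] by blast
    qed
    then show "inv x \<in> ?N" using x subgroup.m_inv_closed[OF Q(1)] by blast
    fix y assume y: "y \<in> ?N"
    have yG: "y \<in> carrier G" using y QG by blast
    have "cj G (x \<otimes> y) v \<in> generate G {v}" if v: "v \<in> V" for v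
    proof -
      have vG: "v \<in> carrier G" using v VG by blast
      have "cj G y v \<in> generate G {v}" using y v by blast
      then show ?thesis using im[OF v] cj_mult(2)[OF xG yG vG] by auto
    qed
    then show "x \<otimes> y \<in> ?N" using x y subgroup.m_closed[OF Q(1)] by blast
  qed
  have "S \<union> {u \<in> Q. \<forall>v\<in>P. cj G u v = v} \<subseteq> ?N"
    using power S(1) VP cyclic_self by fastforce
  then have QN: "Q \<subseteq> ?N" using generate_mono_sub[OF sN] gen by blast
  have "p dvd card V"
  proof -
    obtain k where k: "card V = p ^ k" using ppV prime_power_card_def by blast
    then show ?thesis using V1 card_one_iff[OF sV] by (cases k) auto
  qed
  then obtain v where v: "v \<in> V" "v \<noteq> \<one>" "card (generate G {v}) = p" using cauchy[OF sV pq(1)] by metis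
  have vG: "v \<in> carrier G" using v VG by blast
  have sv: "subgroup (generate G {v}) G" using cyclic_subgroup[OF vG] .
  have "generate G {v} = V"
  proof (rule minV[OF sv])
    show "generate G {v} \<noteq> {\<one>}" using v(2) cyclic_self[of v] by auto
    show vV: "generate G {v} \<subseteq> V" using cyclic_least[OF sV v(1)] .
    show "normalizes G Q (generate G {v})" unfolding normalizes_def
    proof (intro ballI)
      fix u w assume u: "u \<in> Q" and w: "w \<in> generate G {v}"
      have "cj G u w \<in> generate G {w}" using QN u w vV by blast
      then show "cj G u w \<in> generate G {v}" using cyclic_least[OF sv w] by blast
    qed
  qed
  then have cV: "card V = p" using v by simp
  have L: "subgroup (Q <#> V) G" using set_mult_subgroupI[OF Q(1) sV nQV] .
  have QL: "Q \<subseteq> Q <#> V" "V \<subseteq> Q <#> V" using set_mult_contains[OF Q(1) sV] by auto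
  interpret L: fin_group "G\<lparr>carrier := Q <#> V\<rparr>" using fin_group_sub[OF L] .
  have "modular_subgroup Q (G\<lparr>carrier := Q <#> V\<rparr>)"
  proof (rule L.modular_complement_of_prime[OF _ cV _ pq(1) _ Q(2) pq(2,3)])
    show "subgroup V (G\<lparr>carrier := Q <#> V\<rparr>)" "subgroup Q (G\<lparr>carrier := Q <#> V\<rparr>)"
      using subgroup_subset_iff[OF L] sV Q(1) QL by auto
    show "normalizes (G\<lparr>carrier := Q <#> V\<rparr>) (carrier (G\<lparr>carrier := Q <#> V\<rparr>)) V"
      using normalizes_Int_sub[OF L _ nV, of "Q <#> V"] QL(2) by (simp add: Int_absorb2)
    show "cj (G\<lparr>carrier := Q <#> V\<rparr>) (u [^]\<^bsub>G\<lparr>carrier := Q <#> V\<rparr>\<^esub> q) w = w" if "u \<in> Q" "w \<in> V" for u w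
    proof -
      have "u [^] q \<in> Q <#> V" using subgroup_pow[OF Q(1) that(1)] QL by blast
      then show ?thesis using q_power_trivial[OF that(1)] that(2) VP cj_consistent[OF L]
        by (auto simp: nat_pow_consistent[symmetric])
    qed
  qed simp
  then have smQ: "submodular_subgroup Q (G\<lparr>carrier := Q <#> V\<rparr>)" using L.modular_submodular by blast
  have "V \<lhd> G" using sV nV by (simp add: normal_iff_normalizes)
  then obtain K :: "'a monoid" and f where K: "fin_group K" "group_hom G K f" "f ` carrier G = carrier K"
    "\<And>x. x \<in> carrier G \<Longrightarrow> f x = \<one>\<^bsub>K\<^esub> \<longleftrightarrow> x \<in> V" "order G = order K * card V"
    by (rule exists_quotient) blast
  interpret K: fin_group K by fact
  interpret f: group_hom G K f by fact
  have "order K > 0" using K.fin K.order_gt_0_iff_finite by simp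
  then have lt: "order K < order G" using K(5) cV prime_gt_1_nat[OF pq(1)] by simp
  have "submodular_action K p q (f ` P) (f ` Q) (f ` S)"
  proof (intro submodular_action.intro K(1) submodular_action_axioms.intro pq)
    show "subgroup (f ` P) K" "subgroup (f ` Q) K" using f.subgroup_img_is_subgroup P(1) Q(1) by auto
    show "prime_power_card p (f ` P)" "prime_power_card q (f ` Q)"
      using f.prime_power_card_image[OF fin_group_axioms K(1)] pq P Q by auto
    show "normalizes K (carrier K) (f ` P)" using f.normalizes_image[OF _ PG P(3)] K(3) by simp
    show "carrier K = f ` Q <#>\<^bsub>K\<^esub> f ` P" using f.set_mult_image[OF QG PG] G_eq K(3) by simp
    show "f ` S \<subseteq> f ` Q" using S by blast
    show "submodular_subgroup (generate K {b}) K" if b: "b \<in> f ` S" for b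
    proof -
      obtain a where a: "a \<in> S" "b = f a" using b by blast
      have "f ` generate G {a} = generate K {b}" using f.image_generate[of "{a}"] a S QG by auto
      then show ?thesis using f.submodular_image[OF K(3) S(2)[OF a(1)]] by simp
    qed
    let ?C = "{u \<in> Q. \<forall>v\<in>P. cj G u v = v}" and ?C' = "{u \<in> f ` Q. \<forall>v\<in>f ` P. cj K u v = v}"
    have "f ` ?C \<subseteq> ?C'" using QG PG by (auto simp: subset_iff simp flip: f.cj_hom_image)
    then have sub: "f ` (S \<union> ?C) \<subseteq> f ` S \<union> ?C'" by blast
    have "f ` Q \<subseteq> f ` generate G (S \<union> ?C)" using gen by blast
    also have "\<dots> = generate K (f ` (S \<union> ?C))" using S QG by (intro f.image_generate) blast
    also have "\<dots> \<subseteq> generate K (f ` S \<union> ?C')" using K.mono_generate[OF sub] .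
    finally show "f ` Q \<subseteq> generate K (f ` S \<union> ?C')" .
    show "cj K u (cj K v w) = cj K v (cj K u w)" if uvw: "u \<in> f ` Q" "v \<in> f ` Q" "w \<in> f ` P" for u v w
    proof -
      obtain u' v' w' where e: "u' \<in> Q" "v' \<in> Q" "w' \<in> P" "u = f u'" "v = f v'" "w = f w'" using uvw by blast
      have c: "u' \<in> carrier G" "v' \<in> carrier G" "w' \<in> carrier G" using e QG PG by auto
      show ?thesis using comm[OF e(1-3)] e(4-6) c by (simp flip: f.cj_hom_image)
    qed
  qed
  then have "submodular_subgroup (f ` Q) K" by (rule IH[OF lt])
  then have "submodular_subgroup {x \<in> carrier G. f x \<in> f ` Q} G" by (rule f.submodular_preimage[OF K(3)])
  then have "submodular_subgroup (Q <#> V) G" using f.preimage_image[OF Q(1) K(4) VG] by simp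
  then show ?thesis by (rule submodular_trans[OF smQ])
qed

end

lemma submodular_complement:
  fixes G :: "'a monoid"
  assumes "submodular_action G p q P Q S"
  shows "submodular_subgroup Q G"
  using assms
proof (induction "order G" arbitrary: G P Q S rule: less_induct)
  case less
  show ?case by (rule submodular_action.submodular_complement_step[OF less.prems less.hyps])
qed

section \<open>Groups whose Sylow subgroups are generated by submodular elements\<close>

definition submodular_elements :: "('a, 'b) monoid_scheme \<Rightarrow> nat \<Rightarrow> 'a set" where
  "submodular_elements G p = {x. p_elem G p x \<and> submodular_subgroup (generate G {x}) G}"

text \<open>For finite \<open>G\<close> this amounts to \<open>F\<close> being a nilpotent normal
  subgroup, put in a form that is easily transported to images and products.\<close>

definition primary_in_cores :: "('a, 'b) monoid_scheme \<Rightarrow> 'a set \<Rightarrow> bool" where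
  "primary_in_cores G F \<longleftrightarrow> subgroup F G \<and> normalizes G (carrier G) F \<and>
     (\<forall>r x. prime r \<longrightarrow> x \<in> F \<longrightarrow> p_elem G r x \<longrightarrow> x \<in> p_core G r (carrier G))"

text \<open>The common ground of both statements, stable under quotients. \<open>L_comm\<close>
  makes \<open>L\<close> abelian modulo \<open>F\<close>, and \<open>L_gen\<close> supplies the
  generators of the action of \<open>L\<close> on normal Sylow subgroups.\<close>

locale submodular_generation = fin_group +
  fixes F :: "'a set" and q :: nat and L :: "'a set"
  assumes sylow_generated: "\<And>p. prime p \<Longrightarrow> \<exists>P. sylow_subgroup p P G \<and> P \<subseteq> generate G (submodular_elements G p)"
    and F: "primary_in_cores G F"
    and q: "prime q"
    and L: "subgroup L G" "prime_power_card q L"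
    and L_gen: "L \<subseteq> generate G ((L \<inter> submodular_elements G q) \<union> (L \<inter> F))"
    and L_comm: "\<And>u v. u \<in> L \<Longrightarrow> v \<in> L \<Longrightarrow> cj G u v \<otimes> inv v \<in> F"

lemma submodular_elements_image:
  assumes "group_hom G K f" "f ` carrier G = carrier K"
  shows "f ` submodular_elements G p \<subseteq> submodular_elements K p"
proof
  interpret f: group_hom G K f by fact
  fix y assume "y \<in> f ` submodular_elements G p"
  then obtain x where x: "y = f x" "p_elem G p x" "submodular_subgroup (generate G {x}) G"
    by (auto simp: submodular_elements_def)
  have xG: "x \<in> carrier G" using x(2) p_elem_def by metis
  have "f ` generate G {x} = generate K {y}" using f.image_generate[of "{x}"] x(1) xG by simp
  then have "submodular_subgroup (generate K {y}) K" using f.submodular_image[OF assms(2) x(3)] by simp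
  then show "y \<in> submodular_elements K p" using f.p_elem_image[OF x(2)] x(1) by (simp add: submodular_elements_def)
qed

text \<open>The exponent is a multiple of the part of the order of \<open>G\<close> prime to
  \<open>r\<close>, and congruent to 1 modulo a power of \<open>r\<close> that annihilates
  \<open>f x\<close>.\<close>

lemma primary_element_lift:
  assumes "group_hom G K f" "fin_group G" and r: "prime r" and x: "x \<in> carrier G" "p_elem K r (f x)"
  obtains n :: nat where "p_elem G r (x [^]\<^bsub>G\<^esub> n)" "f (x [^]\<^bsub>G\<^esub> n) = f x"
proof -
  interpret G: fin_group G by fact
  interpret f: group_hom G K f by fact
  obtain k where k: "f x [^]\<^bsub>K\<^esub> (r ^ k) = \<one>\<^bsub>K\<^esub>" using x(2) by (auto simp: p_elem_def)
  obtain m where m: "order G = r ^ multiplicity r (order G) * m" "\<not> r dvd m"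
    using multiplicity_decompose'[of "order G" r] G.fin G.order_gt_0_iff_finite r not_prime_unit
    by (metis less_irrefl)
  have "coprime m (r ^ k)" using m(2) r by (metis coprime_commute coprime_power_left_iff prime_imp_coprime)
  then obtain j where j: "[m * j = Suc 0] (mod (r ^ k))" using cong_solve_coprime_nat[of m "r ^ k"] by auto
  let ?n = "m * j"
  have "(x [^]\<^bsub>G\<^esub> ?n) [^]\<^bsub>G\<^esub> (r ^ multiplicity r (order G)) = (x [^]\<^bsub>G\<^esub> order G) [^]\<^bsub>G\<^esub> j"
    using x(1) m(1) by (simp add: G.nat_pow_pow mult.commute mult.left_commute mult.assoc)
  also have "\<dots> = \<one>\<^bsub>G\<^esub>" using x(1) by (simp add: G.pow_order_eq_1)
  finally have 1: "p_elem G r (x [^]\<^bsub>G\<^esub> ?n)" using x(1) by (auto simp: p_elem_def)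
  have pw: "f x [^]\<^bsub>K\<^esub> (c + b * r ^ k) = f x [^]\<^bsub>K\<^esub> c" for b c :: nat
  proof -
    have "f x [^]\<^bsub>K\<^esub> (c + b * r ^ k) = f x [^]\<^bsub>K\<^esub> c \<otimes>\<^bsub>K\<^esub> (f x [^]\<^bsub>K\<^esub> (r ^ k)) [^]\<^bsub>K\<^esub> b"
      using x(1) by (simp add: f.H.nat_pow_mult f.H.nat_pow_pow mult.commute)
    then show ?thesis using k x(1) by simp
  qed
  obtain k1 k2 where "Suc 0 + k1 * r ^ k = ?n + k2 * r ^ k" using j cong_iff_lin_nat by blast
  then have "f x [^]\<^bsub>K\<^esub> ?n = f x [^]\<^bsub>K\<^esub> Suc 0" using pw by metis
  then have 2: "f (x [^]\<^bsub>G\<^esub> ?n) = f x" using x(1) by (simp add: f.hom_nat_pow)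
  show ?thesis using that 1 2 by blast
qed

context submodular_generation
begin

lemma LG: "L \<subseteq> carrier G" using L subgroup.subset by auto

lemma FG: "F \<subseteq> carrier G" using F subgroup.subset by (auto simp: primary_in_cores_def)

lemma submodular_generation_image:
  assumes K: "fin_group K" "group_hom G K f" "f ` carrier G = carrier K"
  shows "submodular_generation K (f ` F) q (f ` L)"
proof (intro submodular_generation.intro K(1) submodular_generation_axioms.intro)
  interpret K: fin_group K by fact
  interpret f: group_hom G K f by fact
  show "\<exists>P. sylow_subgroup p P K \<and> P \<subseteq> generate K (submodular_elements K p)" if p: "prime p" for p
  proof -
    obtain P where P: "sylow_subgroup p P G" "P \<subseteq> generate G (submodular_elements G p)" using sylow_generated[OF p] by blast
    have "sylow_subgroup p (f ` P) K" by (rule sylow_subgroup_image[OF K(2) fin K(3) P(1)])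
    moreover have "f ` P \<subseteq> f ` generate G (submodular_elements G p)" using P(2) by blast
    moreover have "f ` generate G (submodular_elements G p) = generate K (f ` submodular_elements G p)"
      by (rule f.image_generate) (auto simp: submodular_elements_def p_elem_def)
    moreover have "\<dots> \<subseteq> generate K (submodular_elements K p)"
      by (rule K.mono_generate[OF submodular_elements_image[OF K(2,3)]])
    ultimately show ?thesis by blast
  qed
  have sF: "subgroup F G" "normalizes G (carrier G) F" using F by (auto simp: primary_in_cores_def)
  show "primary_in_cores K (f ` F)" unfolding primary_in_cores_def
  proof (intro conjI allI impI)
    show "subgroup (f ` F) K" using f.subgroup_img_is_subgroup[OF sF(1)] .
    show "normalizes K (carrier K) (f ` F)" using f.normalizes_image[OF subset_refl FG sF(2)] K(3) by simp
    fix r y assume r: "prime r" and y: "y \<in> f ` F" "p_elem K r y"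
    obtain x where x: "x \<in> F" "y = f x" using y by blast
    have xG: "x \<in> carrier G" using x FG by blast
    obtain n :: nat where n: "p_elem G r (x [^] n)" "f (x [^] n) = f x"
      using primary_element_lift[OF K(2) fin_group_axioms r xG] y(2) x(2) by metis
    have "x [^] n \<in> p_core G r (carrier G)"
      using F r n(1) subgroup_pow[OF sF(1) x(1)] by (simp add: primary_in_cores_def)
    then have "f (x [^] n) \<in> p_core K r (f ` carrier G)"
      using p_core_image[OF K(2) fin_group_axioms K(1) subgroup_self r] by blast
    then show "y \<in> p_core K r (carrier K)" using n(2) x(2) K(3) by simp
  qed
  show "prime q" by (rule q)
  show "subgroup (f ` L) K" "prime_power_card q (f ` L)"
    using f.subgroup_img_is_subgroup[OF L(1)] f.prime_power_card_image[OF fin_group_axioms K(1) q L] by auto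
  let ?S = "(L \<inter> submodular_elements G q) \<union> (L \<inter> F)"
  have "f ` L \<subseteq> f ` generate G ?S" using L_gen by blast
  also have "\<dots> = generate K (f ` ?S)" using LG by (intro f.image_generate) blast
  also have "\<dots> \<subseteq> generate K ((f ` L \<inter> submodular_elements K q) \<union> (f ` L \<inter> f ` F))"
    using submodular_elements_image[OF K(2,3)] by (intro K.mono_generate) blast
  finally show "f ` L \<subseteq> generate K ((f ` L \<inter> submodular_elements K q) \<union> (f ` L \<inter> f ` F))" .
  show "cj K u v \<otimes>\<^bsub>K\<^esub> inv\<^bsub>K\<^esub> v \<in> f ` F" if uv: "u \<in> f ` L" "v \<in> f ` L" for u v
  proof -
    obtain u' v' where e: "u' \<in> L" "v' \<in> L" "u = f u'" "v = f v'" using uv by blast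
    have "f (cj G u' v' \<otimes> inv v') = cj K u v \<otimes>\<^bsub>K\<^esub> inv\<^bsub>K\<^esub> v"
      using e LG by (simp add: f.cj_hom_image subset_iff)
    then show ?thesis using L_comm[OF e(1,2)] by (metis image_eqI)
  qed
qed

end

text \<open>For the largest prime \<open>p\<close> all submodular \<open>p\<close>-elements lie in
  the core, which is therefore a Sylow subgroup. If \<open>q = p\<close>, then \<open>L\<close> lies
  in it. Otherwise the quotient shows that \<open>L\<close> times the core is submodular, and there
  \<open>L\<close> is treated as a \<open>submodular_action\<close>.\<close>

lemma submodular_generation_step:
  fixes G :: "'a monoid" (structure)
  assumes "submodular_generation G F q L"
    and IH: "\<And>(K :: 'a monoid) F L. order K < order G \<Longrightarrow> submodular_generation K F q L \<Longrightarrow> submodular_subgroup L K"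
  shows "submodular_subgroup L G"
proof -
  interpret submodular_generation G F q L by fact
  have order0: "order G > 0" using fin order_gt_0_iff_finite by simp
  show ?thesis
  proof (cases "order G = 1")
    case True
    then have "card L = card (carrier G)" using card_dvd_order[OF L(1)] by (simp add: order_def)
    then have "L = carrier G" using fin LG card_subset_eq by blast
    then show ?thesis using submodular_self by simp
  next
    case False
    let ?R = "{r. prime r \<and> r dvd order G}"
    have finR: "finite ?R" using order0 by (intro finite_subset[OF _ finite_atMost[of "order G"]]) (auto dest: dvd_imp_le)
    have neR: "?R \<noteq> {}" using prime_factor_nat[OF False] by blast
    define p where "p = Max ?R"
    have p: "prime p" "p dvd order G" using Max_in[OF finR neR] by (auto simp: p_def)
    have largest: "r \<le> p" if "prime r" "r dvd order G" for r using Max_ge[OF finR] that by (simp add: p_def)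
    define O' where "O' = p_core G p (carrier G)"
    note O = p_core[OF subgroup_self p(1), folded O'_def]
    have OG: "O' \<subseteq> carrier G" using O by blast
    have "submodular_elements G p \<subseteq> O'"
    proof
      fix x assume "x \<in> submodular_elements G p"
      then have x: "p_elem G p x" "submodular_subgroup (generate G {x}) G" by (auto simp: submodular_elements_def)
      have xG: "x \<in> carrier G" using x(1) p_elem_def by metis
      have s: "subgroup (generate G {x}) G" using cyclic_subgroup[OF xG] .
      have "normalizes G (generate G {x}) (generate G {x})" unfolding normalizes_def using cj_self_image[OF s] by blast
      then have "generate G {x} \<subseteq> p_core G p (generate G {x})"
        using p_elem_iff[OF p(1) xG] x(1) by (intro p_core_greatest s) auto
      also have "\<dots> \<subseteq> O'" unfolding O'_def by (rule p_core_submodular[OF fin_group_axioms p(1) largest x(2)])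
      finally show "x \<in> O'" using cyclic_self by blast
    qed
    then have genO: "generate G (submodular_elements G p) \<subseteq> O'" using generate_mono_sub[OF O(1)] by blast
    obtain P where P: "sylow_subgroup p P G" "P \<subseteq> generate G (submodular_elements G p)" using sylow_generated[OF p(1)] by blast
    have sP: "subgroup P G" "card P = p ^ multiplicity p (order G)" using P(1) by (auto simp: sylow_subgroup_def)
    have PO: "P \<subseteq> O'" using P(2) genO by blast
    obtain k where k: "card O' = p ^ k" using O(4) prime_power_card_def by blast
    have "p ^ k dvd order G" using card_dvd_order[OF O(1)] k by simp
    then have "k \<le> multiplicity p (order G)" using order0 prime_gt_1_nat[OF p(1)] by (intro multiplicity_geI) auto
    then have "card O' \<le> card P" unfolding k sP(2) using prime_gt_0_nat[OF p(1)] by (intro power_increasing) auto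
    then have "P = O'" using card_seteq[OF sub_finite[OF O(1)] PO] by simp
    then have sylO: "sylow_subgroup p O' G" using P by simp
    have nO: "O' \<lhd> G" using p_core_carrier_normal[OF p(1)] O'_def by simp
    show ?thesis
    proof (cases "q = p")
      case True
      have "L \<subseteq> O'" using normal_sylow_contains[OF sylO O(3) L(1)] L(2) True by simp
      then have "submodular_subgroup L (G\<lparr>carrier := O'\<rparr>)" using p_group_submodular[OF O(1) p(1) O(4) L(1)] by simp
      moreover have "submodular_subgroup O' G" using modular_submodular[OF normal_modular[OF nO]] .
      ultimately show ?thesis by (rule submodular_trans)
    next
      case False
      have cO: "card O' > 1"
      proof -
        have "multiplicity p (order G) \<noteq> 0" using p order0 by (simp add: prime_multiplicity_gt_zero_iff)
        then show ?thesis using sP(2) \<open>P = O'\<close> prime_gt_1_nat[OF p(1)] by (metis one_less_power neq0_conv)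
      qed
      obtain K :: "'a monoid" and f where K: "fin_group K" "group_hom G K f" "f ` carrier G = carrier K"
        "\<And>x. x \<in> carrier G \<Longrightarrow> f x = \<one>\<^bsub>K\<^esub> \<longleftrightarrow> x \<in> O'" "order G = order K * card O'"
        by (rule exists_quotient[OF nO]) blast
      interpret f: group_hom G K f by fact
      have "order K > 0" using K(5) order0 by (cases "order K") auto
      then have lt: "order K < order G" using K(5) cO by simp
      have "submodular_subgroup (f ` L) K" by (rule IH[OF lt submodular_generation_image[OF K(1-3)]])
      then have "submodular_subgroup {x \<in> carrier G. f x \<in> f ` L} G" by (rule f.submodular_preimage[OF K(3)])
      then have smLO: "submodular_subgroup (L <#> O') G" using f.preimage_image[OF L(1) K(4) OG] by simp
      have nLO: "normalizes G L O'" using O(3) LG by (auto simp: normalizes_def)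
      have H: "subgroup (L <#> O') G" using set_mult_subgroupI[OF L(1) O(1) nLO] .
      have LH: "L \<subseteq> L <#> O'" "O' \<subseteq> L <#> O'" using set_mult_contains[OF L(1) O(1)] by auto
      let ?H = "G\<lparr>carrier := L <#> O'\<rparr>"
      have cjH: "cj ?H u v = cj G u v" if "u \<in> L" for u v using cj_consistent[OF H] that LH by blast
      \<comment> \<open>A \<open>q\<close>-element of \<open>F\<close> lies in the
        \<open>q\<close>-core, and cores for different primes centralize each other.\<close>
      have F_trivial: "cj G u v = v" if u: "u \<in> F" "p_elem G q u" and v: "v \<in> O'" for u v
      proof -
        note Oq = p_core[OF subgroup_self q]
        have uO: "u \<in> p_core G q (carrier G)" using F u q by (simp add: primary_in_cores_def)
        have c: "u \<in> carrier G" "v \<in> carrier G" using u v FG OG by auto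
        have "cj G u v \<otimes> inv v \<in> O'"
          using O(3) c v subgroup.m_closed[OF O(1)] subgroup.m_inv_closed[OF O(1)] by (simp add: normalizes_def)
        moreover have "cj G u v \<otimes> inv v = u \<otimes> cj G v (inv u)" using c by (simp add: cj_def m_assoc)
        moreover have "u \<otimes> cj G v (inv u) \<in> p_core G q (carrier G)"
          using Oq(3) c uO subgroup.m_closed[OF Oq(1)] subgroup.m_inv_closed[OF Oq(1)] by (simp add: normalizes_def)
        ultimately have "cj G u v \<otimes> inv v = \<one>"
          using coprime_Int_trivial[OF O(1,4) Oq(1,4) p(1) q] False by auto
        then have "cj G u v \<otimes> inv v \<otimes> v = \<one> \<otimes> v" by simp
        then show ?thesis using c by (simp add: m_assoc)
      qed
      have Lq: "p_elem G q u" if "u \<in> L" for u using p_elem_in[OF L that] .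
      have "submodular_action ?H p q O' L (L \<inter> submodular_elements G q)"
      proof (intro submodular_action.intro fin_group_sub[OF H] submodular_action_axioms.intro p(1) q)
        show "p \<noteq> q" using False by simp
        show "subgroup O' ?H" "subgroup L ?H" using subgroup_subset_iff[OF H] O(1) L(1) LH by auto
        show "prime_power_card p O'" "prime_power_card q L" using O(4) L(2) by auto
        show "normalizes ?H (carrier ?H) O'"
          using normalizes_Int_sub[OF H _ O(3), of "L <#> O'"] LH(2) by (simp add: Int_absorb2)
        show "carrier ?H = L <#>\<^bsub>?H\<^esub> O'" by simp
        show "L \<inter> submodular_elements G q \<subseteq> L" by blast
        show "submodular_subgroup (generate ?H {a}) ?H" if a: "a \<in> L \<inter> submodular_elements G q" for a
        proof -
          have aH: "{a} \<subseteq> L <#> O'" using a LH by blast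
          have "generate G {a} \<subseteq> L <#> O'" using cyclic_least[OF H] aH by simp
          then show ?thesis using submodular_sub[OF _ H] a generate_consistent[OF aH H]
            by (simp add: submodular_elements_def)
        qed
        let ?C = "{u \<in> L. \<forall>v\<in>O'. cj ?H u v = v}"
        have "L \<inter> F \<subseteq> ?C" using F_trivial Lq cjH by auto
        then have "generate G ((L \<inter> submodular_elements G q) \<union> (L \<inter> F)) \<subseteq> generate G ((L \<inter> submodular_elements G q) \<union> ?C)"
          by (intro mono_generate) blast
        also have "\<dots> = generate ?H ((L \<inter> submodular_elements G q) \<union> ?C)"
          using LH by (intro generate_consistent[OF _ H, symmetric]) blast
        finally show "L \<subseteq> generate ?H ((L \<inter> submodular_elements G q) \<union> ?C)" using L_gen by blast
        show "cj ?H u (cj ?H v w) = cj ?H v (cj ?H u w)" if u: "u \<in> L" and v: "v \<in> L" and w: "w \<in> O'" for u v w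
        proof -
          have c: "u \<in> carrier G" "v \<in> carrier G" "w \<in> carrier G" using u v w LG OG by auto
          \<comment> \<open>The commutator is an element of \<open>F\<close> inside the
            \<open>q\<close>-group \<open>L\<close>, so it acts trivially on the core.\<close>
          let ?c = "cj G u v \<otimes> inv v"
          have cL: "?c \<in> L" using cj_self_image[OF L(1) u] v subgroup.m_closed[OF L(1)] subgroup.m_inv_closed[OF L(1)] by blast
          have w': "cj G v (cj G u w) \<in> O'" using O(3) c w by (simp add: normalizes_def)
          have "cj G ?c (cj G v (cj G u w)) = cj G v (cj G u w)"
            using F_trivial[OF L_comm[OF u v] Lq[OF cL] w'] .
          moreover have "cj G ?c (cj G v (cj G u w)) = cj G u (cj G v w)"
            using c by (simp add: cj_def m_assoc inv_mult_group)
          ultimately show ?thesis using cjH u v by simp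
        qed
      qed
      then have "submodular_subgroup L ?H" by (rule submodular_complement)
      then show ?thesis using smLO by (rule submodular_trans)
    qed
  qed
qed

lemma submodular_if_generated:
  fixes G :: "'a monoid"
  assumes "submodular_generation G F q L"
  shows "submodular_subgroup L G"
  using assms
proof (induction "order G" arbitrary: G F L rule: less_induct)
  case less
  show ?case by (rule submodular_generation_step[OF less.prems less.hyps])
qed

context submodular_generation
begin

text \<open>Factoring out the trivial subgroup copies \<open>G\<close> to the type
  \<open>'a monoid\<close>, for which the induction was carried out.\<close>

lemma submodular_L: "submodular_subgroup L G"
proof -
  obtain K :: "'a monoid" and f where K: "fin_group K" "group_hom G K f" "f ` carrier G = carrier K"
    "\<And>x. x \<in> carrier G \<Longrightarrow> f x = \<one>\<^bsub>K\<^esub> \<longleftrightarrow> x \<in> {\<one>}" "order G = order K * card {\<one>}"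
    by (rule exists_quotient[OF one_is_normal]) blast
  interpret f: group_hom G K f by fact
  have "submodular_subgroup (f ` L) K"
    by (rule submodular_if_generated[OF submodular_generation_image[OF K(1-3)]])
  then have "submodular_subgroup {x \<in> carrier G. f x \<in> f ` L} G" by (rule f.submodular_preimage[OF K(3)])
  moreover have "{x \<in> carrier G. f x \<in> f ` L} = L <#> {\<one>}" by (rule f.preimage_image[OF L(1) K(4)]) auto
  moreover have "L <#> {\<one>} = L" using LG by (force simp: set_mult_def subset_iff)
  ultimately show ?thesis by simp
qed

end

section \<open>Nilpotent normal subgroups and the main theorem\<close>

lemma (in group) lower_central_subgroup: "subgroup (lower_central G n) G"
proof (induction n)
  case (Suc n)
  have "{h \<otimes> k \<otimes> inv h \<otimes> inv k | h k. h \<in> lower_central G n \<and> k \<in> carrier G} \<subseteq> carrier G"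
    using subgroup.mem_carrier[OF Suc] by auto
  then show ?case by (simp add: commutator_subgroup_def generate_is_subgroup)
qed (simp add: subgroup_self)

context fin_group
begin

text \<open>The last term of the lower central series not contained in \<open>U\<close> normalizes
  \<open>U\<close>, since its commutators lie in the next term.\<close>

lemma nilpotent_normalizer_grows:
  assumes nil: "nilpotent_group G" and U: "subgroup U G" "normr G U = U"
  shows "U = carrier G"
proof (rule ccontr)
  assume "U \<noteq> carrier G"
  then have n0: "\<not> lower_central G 0 \<subseteq> U" using subgroup.subset[OF U(1)] by auto
  obtain n where "lower_central G n = {\<one>}" using nil by (auto simp: nilpotent_group_def)
  then have "lower_central G n \<subseteq> U" using subgroup.one_closed[OF U(1)] by simp
  then obtain i where i: "\<not> lower_central G i \<subseteq> U" "lower_central G (Suc i) \<subseteq> U"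
    using n0 by (induction n) auto
  then obtain x where x: "x \<in> lower_central G i" "x \<notin> U" by blast
  have xG: "x \<in> carrier G" using subgroup.mem_carrier[OF lower_central_subgroup x(1)] .
  have "cj G x u \<in> U" if u: "u \<in> U" for u
  proof -
    have uG: "u \<in> carrier G" using subgroup.mem_carrier[OF U(1) u] .
    have "x \<otimes> u \<otimes> inv x \<otimes> inv u \<in> {h \<otimes> k \<otimes> inv h \<otimes> inv k | h k. h \<in> lower_central G i \<and> k \<in> carrier G}"
      using x(1) uG by blast
    then have "x \<otimes> u \<otimes> inv x \<otimes> inv u \<in> lower_central G (Suc i)"
      by (simp add: commutator_subgroup_def generate.incl)
    then have "x \<otimes> u \<otimes> inv x \<otimes> inv u \<in> U" using i(2) by blast
    then have "x \<otimes> u \<otimes> inv x \<otimes> inv u \<otimes> u \<in> U" using subgroup.m_closed[OF U(1) _ u] by blast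
    then show ?thesis using xG uG by (simp add: cj_def m_assoc)
  qed
  then have "cj G x ` U = U"
    using xG by (intro normalizes_eq[OF sub_finite[OF U(1)] _ subgroup.subset[OF U(1)], of "{x}"]) (auto simp: normalizes_def)
  then have "x \<in> normr G U" using xG by (simp add: normr_def)
  then show False using U(2) x(2) by simp
qed

lemma sylow_in_subgroup:
  assumes S: "sylow_subgroup p S G" and W: "subgroup W G" "S \<subseteq> W"
  shows "sylow_subgroup p S (G\<lparr>carrier := W\<rparr>)"
proof -
  have p: "prime p" and sS: "subgroup S G" and cS: "card S = p ^ multiplicity p (order G)"
    using S by (auto simp: sylow_subgroup_def)
  have o: "order G \<noteq> 0" "card W \<noteq> 0" using fin order_gt_0_iff_finite card_pos[OF W(1)] by auto
  have "p ^ multiplicity p (order G) dvd card W" using card_dvd[OF sS W(1,2)] cS by simp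
  then have "multiplicity p (order G) \<le> multiplicity p (card W)"
    using o prime_gt_1_nat[OF p] by (intro multiplicity_geI) auto
  moreover have "multiplicity p (card W) \<le> multiplicity p (order G)"
    using card_dvd_order[OF W(1)] o by (intro dvd_imp_multiplicity_le) auto
  ultimately show ?thesis using p sS cS W subgroup_subset_iff[OF W(1)]
    by (simp add: sylow_subgroup_def order_def)
qed

lemma exists_sylow:
  assumes p: "prime p"
  obtains S where "sylow_subgroup p S G"
proof -
  obtain m where "order G = p ^ multiplicity p (order G) * m"
    using multiplicity_dvd[of p "order G"] by (auto elim!: dvdE)
  then show ?thesis using sylow_thm[OF p is_group _ fin] p that by (auto simp: sylow_subgroup_def)
qed

text \<open>\<open>S\<close> is the unique Sylow \<open>p\<close>-subgroup of its normalizer, so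
  that normalizer is self-normalizing, hence everything.\<close>

lemma nilpotent_sylow_normal:
  assumes nil: "nilpotent_group G" and S: "sylow_subgroup p S G"
  shows "normalizes G (carrier G) S"
proof -
  have p: "prime p" and sS: "subgroup S G" and cS: "card S = p ^ multiplicity p (order G)"
    using S by (auto simp: sylow_subgroup_def)
  have SG: "S \<subseteq> carrier G" using subgroup.subset[OF sS] .
  have ppS: "prime_power_card p S" using cS by (auto simp: prime_power_card_def)
  let ?W = "normr G S"
  have W: "subgroup ?W G" using normr_subgroup[OF SG] .
  have WG: "?W \<subseteq> carrier G" using subgroup.subset[OF W] .
  have SW: "S \<subseteq> ?W" using normr_super[OF sS] .
  interpret W: fin_group "G\<lparr>carrier := ?W\<rparr>" using fin_group_sub[OF W] .
  have "normalizes G ?W S" unfolding normalizes_def normr_def by blast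
  then have nW: "normalizes (G\<lparr>carrier := ?W\<rparr>) (carrier (G\<lparr>carrier := ?W\<rparr>)) S"
    using cj_consistent[OF W] by (simp add: normalizes_def)
  have "normr G ?W \<subseteq> ?W"
  proof
    fix g assume g: "g \<in> normr G ?W"
    then have gG: "g \<in> carrier G" by (simp add: normr_def)
    have gW: "cj G g ` ?W = ?W" using g unfolding normr_def by blast
    then have sub: "cj G g ` S \<subseteq> ?W" using SW by blast
    have "cj G g ` S \<subseteq> S"
    proof (rule W.normal_sylow_contains[OF sylow_in_subgroup[OF S W SW] nW])
      show "subgroup (cj G g ` S) (G\<lparr>carrier := ?W\<rparr>)" using subgroup_subset_iff[OF W] cj_subgroup[OF gG sS] sub by blast
      show "prime_power_card p (cj G g ` S)" using ppS cj_card[OF gG SG] by (simp add: prime_power_card_def)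
    qed
    then have "cj G g ` S = S" using subgroup_eqI[OF sS] cj_card[OF gG SG] by blast
    then show "g \<in> ?W" using gG by (simp add: normr_def)
  qed
  then have "normr G ?W = ?W" using normr_super[OF W] by blast
  then have "?W = carrier G" by (rule nilpotent_normalizer_grows[OF nil W])
  then show ?thesis unfolding normalizes_def normr_def by blast
qed

lemma nilpotent_primary_in_cores:
  assumes N: "N \<lhd> G" and nil: "nilpotent_group (G\<lparr>carrier := N\<rparr>)"
  shows "primary_in_cores G N"
  unfolding primary_in_cores_def
proof (intro conjI allI impI)
  show sN: "subgroup N G" and nN: "normalizes G (carrier G) N" using N by (auto simp: normal_iff_normalizes)
  fix r x assume r: "prime r" and x: "x \<in> N" "p_elem G r x"
  interpret N: fin_group "G\<lparr>carrier := N\<rparr>" using fin_group_sub[OF sN] .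
  obtain S where S: "sylow_subgroup r S (G\<lparr>carrier := N\<rparr>)" using N.exists_sylow[OF r] .
  have xG: "x \<in> carrier G" using subgroup.mem_carrier[OF sN x(1)] .
  have s: "subgroup (generate G {x}) (G\<lparr>carrier := N\<rparr>)"
    using subgroup_subset_iff[OF sN] cyclic_subgroup[OF xG] cyclic_least[OF sN x(1)] by blast
  have nS: "normalizes (G\<lparr>carrier := N\<rparr>) (carrier (G\<lparr>carrier := N\<rparr>)) S" by (rule N.nilpotent_sylow_normal[OF nil S])
  have "generate G {x} \<subseteq> S"
    using N.normal_sylow_contains[OF S nS s] p_elem_iff[OF r xG] x(2) by blast
  moreover have "S \<subseteq> p_core (G\<lparr>carrier := N\<rparr>) r (carrier (G\<lparr>carrier := N\<rparr>))"
    using S nS subgroup.subset[of S "G\<lparr>carrier := N\<rparr>"]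
    by (intro N.p_core_greatest) (auto simp: sylow_subgroup_def prime_power_card_def)
  moreover have "p_core (G\<lparr>carrier := N\<rparr>) r (carrier (G\<lparr>carrier := N\<rparr>)) = p_core G r N"
    using p_core_consistent[OF sN, of N] by simp
  moreover have "p_core G r N \<subseteq> p_core G r (carrier G)"
    by (rule p_core_normal[OF subgroup_self r sN subgroup.subset[OF sN] nN])
  ultimately show "x \<in> p_core G r (carrier G)" using cyclic_self[of x] by blast
qed

text \<open>Some Sylow \<open>r\<close>-subgroup of the product is a product of subgroups of
  \<open>M\<close> and \<open>N\<close>, both inside the core of \<open>G\<close>. The core is
  normal, so it contains the conjugates too.\<close>

lemma primary_in_cores_mult:
  assumes M: "primary_in_cores G M" and N: "primary_in_cores G N"
  shows "primary_in_cores G (M <#> N)"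
proof -
  have sM: "subgroup M G" "normalizes G (carrier G) M" and sN: "subgroup N G" "normalizes G (carrier G) N"
    using M N by (auto simp: primary_in_cores_def)
  have MG: "M \<subseteq> carrier G" and NG: "N \<subseteq> carrier G" using sM sN subgroup.subset by auto
  have "normalizes G M N" using sN MG by (auto simp: normalizes_def)
  then have H: "subgroup (M <#> N) G" using set_mult_subgroupI[OF sM(1) sN(1)] by blast
  have MH: "M \<subseteq> M <#> N" "N \<subseteq> M <#> N" using set_mult_contains[OF sM(1) sN(1)] by auto
  show ?thesis unfolding primary_in_cores_def
  proof (intro conjI allI impI H)
    show "normalizes G (carrier G) (M <#> N)" unfolding normalizes_def
    proof (intro ballI)
      fix g u assume g: "g \<in> carrier G" and "u \<in> M <#> N"
      then obtain m n where mn: "m \<in> M" "n \<in> N" "u = m \<otimes> n" by (auto simp: set_mult_def)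
      have c: "m \<in> carrier G" "n \<in> carrier G" using mn MG NG by auto
      have "cj G g m \<in> M" "cj G g n \<in> N" using sM(2) sN(2) g mn by (auto simp: normalizes_def)
      then show "cj G g u \<in> M <#> N" using set_multI mn(3) cj_mult(1)[OF g c] by simp
    qed
    fix r x assume r: "prime r" and x: "x \<in> M <#> N" "p_elem G r x"
    interpret H: fin_group "G\<lparr>carrier := M <#> N\<rparr>" using fin_group_sub[OF H] .
    have "subgroup M (G\<lparr>carrier := M <#> N\<rparr>)" "subgroup N (G\<lparr>carrier := M <#> N\<rparr>)"
      using subgroup_subset_iff[OF H] sM(1) sN(1) MH by auto
    then obtain Q where Q: "sylow_subgroup r Q (G\<lparr>carrier := M <#> N\<rparr>)" "Q \<subseteq> (Q \<inter> M) <#> (Q \<inter> N)"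
      using H.factorized_sylow[of M N r] r by auto
    let ?O = "p_core G r (carrier G)"
    note O = p_core[OF subgroup_self r]
    have sQ: "subgroup Q G" "prime_power_card r Q"
      using Q(1) subgroup_subset_iff[OF H] by (auto simp: sylow_subgroup_def prime_power_card_def)
    have "p_elem G r u" if "u \<in> Q" for u using p_elem_in[OF sQ that] .
    then have "Q \<inter> M \<subseteq> ?O" "Q \<inter> N \<subseteq> ?O" using M N r by (auto simp: primary_in_cores_def)
    then have QO: "Q \<subseteq> ?O" using set_mult_least[OF O(1)] Q(2) by blast
    have xG: "x \<in> carrier G" using x(2) p_elem_def by metis
    have "subgroup (generate G {x}) (G\<lparr>carrier := M <#> N\<rparr>)"
      using subgroup_subset_iff[OF H] cyclic_subgroup[OF xG] cyclic_least[OF H x(1)] by blast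
    moreover have "prime_power_card r (generate G {x})" using p_elem_iff[OF r xG] x(2) by blast
    ultimately obtain g where g: "g \<in> M <#> N" "generate G {x} \<subseteq> cj (G\<lparr>carrier := M <#> N\<rparr>) g ` Q"
      using H.sylow_contains[OF _ _ Q(1)] by auto
    have gG: "g \<in> carrier G" using subgroup.mem_carrier[OF H g(1)] .
    have "x \<in> cj G g ` Q" using g cyclic_self[of x] cj_consistent[OF H g(1)] by auto
    then show "x \<in> ?O" using QO O(3) gG by (auto simp: normalizes_def)
  qed
qed

section \<open>The Fitting subgroup\<close>

lemma fitting_subgroup_normal: "fitting_subgroup G \<lhd> G"
  unfolding fitting_subgroup_def
proof (rule normal_generateI)
  show "\<Union> {N. N \<lhd> G \<and> nilpotent_group (G\<lparr>carrier := N\<rparr>)} \<subseteq> carrier G"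
    using normal_imp_subgroup subgroup.subset by fastforce
  fix h g assume "h \<in> \<Union> {N. N \<lhd> G \<and> nilpotent_group (G\<lparr>carrier := N\<rparr>)}" "g \<in> carrier G"
  then show "g \<otimes> h \<otimes> inv g \<in> \<Union> {N. N \<lhd> G \<and> nilpotent_group (G\<lparr>carrier := N\<rparr>)}"
    using normal.inv_op_closed2 by fastforce
qed

text \<open>A largest subgroup with the property absorbs every nilpotent normal subgroup. This
  replaces a proof, in terms of the lower central series, that the Fitting subgroup is
  nilpotent.\<close>

lemma fitting_primary_in_cores: "primary_in_cores G (fitting_subgroup G)"
proof -
  let ?Q = "primary_in_cores G"
  have base: "?Q {\<one>}"
    using subgroup.one_closed[OF p_core(1)[OF subgroup_self]]
    by (auto simp: primary_in_cores_def triv_subgroup normalizes_def)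
  have QG: "N \<subseteq> carrier G" if "?Q N" for N using that subgroup.subset by (auto simp: primary_in_cores_def)
  obtain M where M: "?Q M" and max: "\<And>L. ?Q L \<Longrightarrow> card L \<le> card M"
    by (rule ex_max_card[of ?Q, OF base QG]) blast+
  have sM: "subgroup M G" using M by (simp add: primary_in_cores_def)
  have "N \<subseteq> M" if N: "N \<lhd> G" "nilpotent_group (G\<lparr>carrier := N\<rparr>)" for N
  proof -
    have qN: "?Q N" by (rule nilpotent_primary_in_cores[OF N])
    have sN: "subgroup N G" using qN by (simp add: primary_in_cores_def)
    have qMN: "?Q (M <#> N)" by (rule primary_in_cores_mult[OF M qN])
    then have sMN: "subgroup (M <#> N) G" by (simp add: primary_in_cores_def)
    have "M = M <#> N" using card_seteq[OF sub_finite[OF sMN] set_mult_contains(1)[OF sM sN] max[OF qMN]] .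
    then show ?thesis using set_mult_contains(2)[OF sM sN] by simp
  qed
  then have "fitting_subgroup G \<subseteq> M" unfolding fitting_subgroup_def by (intro generate_mono_sub[OF sM]) blast
  then show ?thesis using M fitting_subgroup_normal by (auto simp: primary_in_cores_def normal_iff_normalizes)
qed

section \<open>Cyclic primary subgroups and Sylow subgroups of the factors\<close>

lemma cyclic_primary_generate:
  assumes "prime p" "p_elem G p x"
  shows "cyclic_primary_subgroup (generate G {x}) G"
proof -
  have xG: "x \<in> carrier G" using assms(2) p_elem_def by metis
  let ?C = "generate G {x}"
  have C: "subgroup ?C G" using cyclic_subgroup[OF xG] .
  have "?C = range (\<lambda>n::int. x [^]\<^bsub>G\<lparr>carrier := ?C\<rparr>\<^esub> n)"
    using generate_pow[OF xG] int_pow_consistent[OF C cyclic_self] by (simp add: full_SetCompr_eq)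
  then have "cyclic_group (G\<lparr>carrier := ?C\<rparr>)"
    using group.cyclic_group[OF subgroup_imp_group[OF C]] cyclic_self[of x] by auto
  then show ?thesis using C p_elem_iff[OF assms(1) xG] assms unfolding cyclic_primary_subgroup_def prime_power_card_def by blast
qed

lemma cyclic_primary_generator:
  assumes "cyclic_primary_subgroup C G"
  obtains p x where "prime p" "p_elem G p x" "C = generate G {x}"
proof -
  have C: "subgroup C G" "cyclic_group (G\<lparr>carrier := C\<rparr>)" using assms by (auto simp: cyclic_primary_subgroup_def)
  obtain p k where p: "prime p" "card C = p ^ k" using assms by (auto simp: cyclic_primary_subgroup_def)
  obtain x where x: "x \<in> C" "C = range (\<lambda>n::int. x [^]\<^bsub>G\<lparr>carrier := C\<rparr>\<^esub> n)"
    using C(2) group.cyclic_group[OF subgroup_imp_group[OF C(1)]] by auto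
  have xG: "x \<in> carrier G" using subgroup.mem_carrier[OF C(1) x(1)] .
  have "C = generate G {x}" using x(2) generate_pow[OF xG] int_pow_consistent[OF C(1) x(1)] by auto
  moreover have "p_elem G p x" using p_elem_in[OF C(1) _ x(1)] p(2) by (auto simp: prime_power_card_def)
  ultimately show ?thesis using that p(1) by blast
qed

lemma class_C_submodular_elements:
  assumes A: "submodular_subgroup A G" "class_C (G\<lparr>carrier := A\<rparr>)" and p: "prime p" and a: "a \<in> A" "p_elem G p a"
  shows "a \<in> submodular_elements G p"
proof -
  have sA: "subgroup A G" using submodular_subgroup_subgroup[OF A(1)] .
  interpret A: fin_group "G\<lparr>carrier := A\<rparr>" using fin_group_sub[OF sA] .
  have "cyclic_primary_subgroup (generate (G\<lparr>carrier := A\<rparr>) {a}) (G\<lparr>carrier := A\<rparr>)"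
    using A.cyclic_primary_generate[OF p] p_elem_consistent[OF sA a(1)] a(2) by blast
  then have "submodular_subgroup (generate (G\<lparr>carrier := A\<rparr>) {a}) (G\<lparr>carrier := A\<rparr>)"
    using A(2) by (simp add: class_C_def)
  then have "submodular_subgroup (generate G {a}) (G\<lparr>carrier := A\<rparr>)"
    using generate_consistent[OF _ sA, of "{a}"] a(1) by simp
  then show ?thesis using submodular_trans[OF _ A(1)] a(2) by (simp add: submodular_elements_def)
qed

lemma submodular_conjugate:
  assumes "submodular_subgroup H G" "g \<in> carrier G"
  shows "submodular_subgroup (cj G g ` H) G"
proof -
  interpret c: group_hom G G "cj G g" using cj_hom[OF assms(2)] .
  show ?thesis using c.submodular_image[OF cj_carrier_image[OF assms(2)] assms(1)] .
qed

text \<open>Because the index is prime to \<open>q\<close>, Sylow \<open>q\<close>-subgroups of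
  \<open>Y <#> F\<close> are Sylow in \<open>G\<close>, and one of them factorizes along
  \<open>Y\<close> and \<open>F\<close>.\<close>

lemma coprime_index_sylow:
  assumes Y: "subgroup Y G" and F: "subgroup F G" "normalizes G (carrier G) F" and q: "prime q"
    and n: "\<not> q dvd card (rcosets (Y <#> F))"
  obtains Q where "sylow_subgroup q Q G" "Q \<subseteq> (Q \<inter> Y) <#> (Q \<inter> F)"
proof -
  have "normalizes G Y F" using F(2) subgroup.subset[OF Y] by (auto simp: normalizes_def)
  then have H: "subgroup (Y <#> F) G" by (rule set_mult_subgroupI[OF Y F(1)])
  interpret H: fin_group "G\<lparr>carrier := Y <#> F\<rparr>" using fin_group_sub[OF H] .
  have "subgroup Y (G\<lparr>carrier := Y <#> F\<rparr>)" "subgroup F (G\<lparr>carrier := Y <#> F\<rparr>)"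
    using subgroup_subset_iff[OF H] Y F(1) set_mult_contains[OF Y F(1)] by auto
  then obtain Q where Q: "sylow_subgroup q Q (G\<lparr>carrier := Y <#> F\<rparr>)" "Q \<subseteq> (Q \<inter> Y) <#> (Q \<inter> F)"
    using H.factorized_sylow[of Y F q] q by auto
  have l: "card (rcosets (Y <#> F)) * card (Y <#> F) = order G" using lagrange[OF H] .
  have "order G \<noteq> 0" using fin order_gt_0_iff_finite by simp
  then have "card (rcosets (Y <#> F)) \<noteq> 0" "card (Y <#> F) \<noteq> 0" using l by (metis mult_eq_0_iff)+
  then have "multiplicity q (order G) = multiplicity q (card (rcosets (Y <#> F))) + multiplicity q (card (Y <#> F))"
    unfolding l[symmetric] using q by (intro prime_elem_multiplicity_mult_distrib) auto
  also have "multiplicity q (card (rcosets (Y <#> F))) = 0" using n by (rule not_dvd_imp_multiplicity_0)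
  finally have "sylow_subgroup q Q G"
    using Q(1) subgroup_subset_iff[OF H] by (auto simp: sylow_subgroup_def order_def)
  then show ?thesis using that Q(2) by blast
qed

end

theorem theorem2:
  fixes G (structure)
  assumes "group G" and "finite (carrier G)"
    and "submodular_subgroup A G" and "submodular_subgroup B G"
    and "carrier G = A <#> B"
    and "class_C (G\<lparr>carrier := A\<rparr>)" and "class_C (G\<lparr>carrier := B\<rparr>)"
  shows "(coprime (card (rcosets (A <#> fitting_subgroup G)))
                  (card (rcosets (B <#> fitting_subgroup G))) \<longrightarrow> class_C G)
       \<and> (nilpotent_group (G\<lparr>carrier := A_residual G\<rparr>) \<longrightarrow> class_Z G)"
proof -
  interpret fin_group G using assms(1,2) by (simp add: fin_group_def fin_group_axioms_def)
  have sA: "subgroup A G" and sB: "subgroup B G" using assms(3,4) submodular_subgroup_subgroup by auto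
  note elemA = class_C_submodular_elements[OF assms(3,6)] and elemB = class_C_submodular_elements[OF assms(4,7)]
  \<comment> \<open>The factors of \<open>Q\<close> consist of \<open>q\<close>-elements of
    \<open>A\<close> and of \<open>B\<close>, whose cyclic subgroups are submodular there and hence
    in \<open>G\<close>.\<close>
  have fact: "\<exists>Q. sylow_subgroup q Q G \<and> Q \<subseteq> (Q \<inter> A) <#> (Q \<inter> B) \<and>
      Q \<inter> A \<subseteq> submodular_elements G q \<and> Q \<inter> B \<subseteq> submodular_elements G q" if q: "prime q" for q
  proof -
    obtain Q where Q: "sylow_subgroup q Q G" "Q \<subseteq> (Q \<inter> A) <#> (Q \<inter> B)"
      by (rule factorized_sylow[OF sA sB assms(5) q])
    have "subgroup Q G" "prime_power_card q Q" using Q(1) by (auto simp: sylow_subgroup_def prime_power_card_def)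
    then have "p_elem G q x" if "x \<in> Q" for x using p_elem_in that by blast
    then have "Q \<inter> A \<subseteq> submodular_elements G q" "Q \<inter> B \<subseteq> submodular_elements G q"
      using elemA[OF q] elemB[OF q] by auto
    then show ?thesis using Q by blast
  qed
  have genQ: "X \<subseteq> generate G S" if "X \<subseteq> U <#> V" "U \<subseteq> S" "V \<subseteq> S" for X U V S
    using that by (force simp: set_mult_def intro: generate.eng generate.incl)
  have tower: "\<exists>P. sylow_subgroup p P G \<and> P \<subseteq> generate G (submodular_elements G p)" if "prime p" for p
    using fact[OF that] genQ by blast
  have class_C: "class_C G" if cop: "coprime (card (rcosets (A <#> fitting_subgroup G))) (card (rcosets (B <#> fitting_subgroup G)))"
  proof -
    let ?F = "fitting_subgroup G"
    have F: "primary_in_cores G ?F" by (rule fitting_primary_in_cores)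
    then have sF: "subgroup ?F G" "normalizes G (carrier G) ?F" by (auto simp: primary_in_cores_def)
    have "submodular_subgroup C G" if C: "cyclic_primary_subgroup C G" for C
    proof -
      obtain q c where q: "prime q" and c: "p_elem G q c" "C = generate G {c}" by (rule cyclic_primary_generator[OF C])
      have cG: "c \<in> carrier G" using c(1) p_elem_def by metis
      \<comment> \<open>A prime cannot divide both of two coprime indices, so \<open>A\<close> or
        \<open>B\<close> serves as \<open>Y\<close>.\<close>
      have "\<exists>Y. subgroup Y G \<and> (\<forall>a\<in>Y. p_elem G q a \<longrightarrow> a \<in> submodular_elements G q) \<and> \<not> q dvd card (rcosets (Y <#> ?F))"
        using cop q elemA[OF q] elemB[OF q] sA sB by (metis coprime_common_divisor_nat not_prime_1)
      then obtain Y where Y: "subgroup Y G" "\<And>a. a \<in> Y \<Longrightarrow> p_elem G q a \<Longrightarrow> a \<in> submodular_elements G q"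
        "\<not> q dvd card (rcosets (Y <#> ?F))" by blast
      obtain Q where Q: "sylow_subgroup q Q G" "Q \<subseteq> (Q \<inter> Y) <#> (Q \<inter> ?F)"
        by (rule coprime_index_sylow[OF Y(1) sF q Y(3)])
      have sQ: "subgroup Q G" and ppQ: "prime_power_card q Q" using Q(1) by (auto simp: sylow_subgroup_def prime_power_card_def)
      have QG: "Q \<subseteq> carrier G" using subgroup.subset[OF sQ] .
      have "prime_power_card q (generate G {c})" using p_elem_iff[OF q cG] c(1) by blast
      then obtain g where g: "g \<in> carrier G" "generate G {c} \<subseteq> cj G g ` Q"
        using sylow_contains[OF cyclic_subgroup[OF cG] _ Q(1)] by blast
      obtain x where x: "x \<in> Q" "c = cj G g x" using g(2) cyclic_self[of c] by blast
      have xG: "x \<in> carrier G" using x(1) QG by blast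
      obtain a f where af: "a \<in> Q \<inter> Y" "f \<in> Q \<inter> ?F" "x = a \<otimes> f" using x(1) Q(2) by (force simp: set_mult_def)
      have aG: "a \<in> carrier G" and fG: "f \<in> carrier G" using af QG by auto
      \<comment> \<open>\<open>Q\<close> need not be abelian modulo \<open>?F\<close>, but
        \<open>L\<close> is cyclic there, because \<open>x = a \<otimes> f\<close> has the same
        coset as \<open>a\<close>. It also contains \<open>f\<close>, so it is generated by the
        submodular element \<open>a\<close> and an element of \<open>?F\<close>.\<close>
      define L where "L = generate G {a, x}"
      have sL: "subgroup L G" unfolding L_def using generate_is_subgroup aG xG by simp
      have aL: "a \<in> L" "x \<in> L" unfolding L_def by (auto intro: generate.incl)
      have LQ: "L \<subseteq> Q" unfolding L_def by (rule generate_mono_sub[OF sQ]) (use af x in auto)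
      have ppL: "prime_power_card q L" by (rule prime_power_card_sub[OF sL sQ LQ q ppQ])
      interpret F: normal ?F G by (rule fitting_subgroup_normal)
      let ?q = "\<lambda>u. ?F #> u"
      interpret Q: group "G Mod ?F" by (rule F.factorgroup_is_group)
      interpret h: group_hom G "G Mod ?F" ?q by (unfold_locales) (rule F.r_coset_hom_Mod)
      have comm: "?q u \<otimes>\<^bsub>G Mod ?F\<^esub> ?q v = ?q v \<otimes>\<^bsub>G Mod ?F\<^esub> ?q u" if u: "u \<in> L" and v: "v \<in> L" for u v
      proof -
        have "?q f = \<one>\<^bsub>G Mod ?F\<^esub>" using F.rcos_const[OF is_group] af(2) by simp
        then have qx: "?q x = ?q a" using h.hom_mult[OF aG fG] Q.r_one[OF h.hom_closed[OF aG]] unfolding af(3) by (simp only:)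
        have "?q ` L = generate (G Mod ?F) (?q ` {a, x})" unfolding L_def using aG xG by (intro h.image_generate) simp
        also have "\<dots> = generate (G Mod ?F) {?q a}" using qx by simp
        finally have "?q ` L = {?q a [^]\<^bsub>G Mod ?F\<^esub> (k::int) | k. k \<in> UNIV}"
          unfolding Q.generate_pow[OF h.hom_closed[OF aG]] .
        then have "\<exists>i::int. ?q w = ?q a [^]\<^bsub>G Mod ?F\<^esub> i" if "w \<in> L" for w
          using imageI[OF that, of ?q] by simp
        then obtain i j :: int where ij: "?q u = ?q a [^]\<^bsub>G Mod ?F\<^esub> i" "?q v = ?q a [^]\<^bsub>G Mod ?F\<^esub> j" using u v by meson
        show ?thesis unfolding ij using Q.int_pow_mult[of "?q a"] aG by (metis add.commute h.hom_closed)
      qed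
      have "submodular_generation G ?F q L"
      proof (intro submodular_generation.intro fin_group_axioms submodular_generation_axioms.intro F q sL ppL)
        show "\<exists>P. sylow_subgroup p P G \<and> P \<subseteq> generate G (submodular_elements G p)" if "prime p" for p using tower[OF that] .
        show "L \<subseteq> generate G (L \<inter> submodular_elements G q \<union> L \<inter> ?F)"
        proof -
          let ?S = "L \<inter> submodular_elements G q \<union> L \<inter> ?F"
          have S: "?S \<subseteq> carrier G" using subgroup.subset[OF sL] by blast
          have "p_elem G q a" using p_elem_in[OF sL ppL aL(1)] .
          then have "a \<in> ?S" using Y(2) af(1) aL(1) by blast
          moreover have "f \<in> ?S"
          proof -
            have "f = inv a \<otimes> x" using af(3) aG fG by simp
            then show ?thesis using af(2) aL subgroup.m_closed[OF sL] subgroup.m_inv_closed[OF sL] by simp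
          qed
          ultimately have "{a, x} \<subseteq> generate G ?S" using af(3) by (auto intro: generate.incl generate.eng)
          then show ?thesis unfolding L_def by (rule generate_mono_sub[OF generate_is_subgroup[OF S[unfolded L_def]]])
        qed
        show "cj G u v \<otimes> inv v \<in> ?F" if uv: "u \<in> L" "v \<in> L" for u v
        proof -
          have c: "u \<in> carrier G" "v \<in> carrier G" using uv subgroup.mem_carrier[OF sL] by auto
          have "?q (u \<otimes> v) = ?q (v \<otimes> u)" using comm[OF uv] h.hom_mult c by simp
          then have "u \<otimes> v \<otimes> inv (v \<otimes> u) \<in> ?F" by (rule iffD1[OF rcoset_eq_iff[OF sF(1) m_closed[OF c] m_closed[OF c(2,1)]]])
          then show ?thesis using c by (simp add: cj_def inv_mult_group m_assoc)
        qed
      qed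
      then have smL: "submodular_subgroup L G" by (rule submodular_generation.submodular_L)
      have "submodular_subgroup (generate G {x}) (G\<lparr>carrier := L\<rparr>)"
        by (rule p_group_submodular[OF sL q ppL cyclic_subgroup[OF xG] cyclic_least[OF sL aL(2)]])
      then have "submodular_subgroup (generate G {x}) G" using smL by (rule submodular_trans)
      then have "submodular_subgroup (cj G g ` generate G {x}) G" using g(1) by (rule submodular_conjugate)
      then show ?thesis using cj_generate[OF g(1) xG] x(2) c(2) by simp
    qed
    then show ?thesis using assms(1,2) by (simp add: class_C_def)
  qed
  have class_Z: "class_Z G" if nil: "nilpotent_group (G\<lparr>carrier := A_residual G\<rparr>)"
  proof -
    let ?R = "A_residual G"
    note R = A_residual_least[OF assms(1,2)]
    have F: "primary_in_cores G ?R" by (rule nilpotent_primary_in_cores[OF R(1) nil])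
    then have sR: "subgroup ?R G" by (simp add: primary_in_cores_def)
    interpret R: normal ?R G by (rule R(1))
    let ?q = "\<lambda>u. ?R #> u"
    interpret h: group_hom G "G Mod ?R" ?q
      by (simp add: group_hom_def group_hom_axioms_def is_group R.factorgroup_is_group R.r_coset_hom_Mod)
    have "submodular_subgroup P G" if P: "sylow_subgroup q P G" for q P
    proof -
      have q: "prime q" and sP: "subgroup P G" and cP: "card P = q ^ multiplicity q (order G)"
        using P by (auto simp: sylow_subgroup_def)
      obtain Q where Q: "sylow_subgroup q Q G" "Q \<subseteq> (Q \<inter> A) <#> (Q \<inter> B)"
        "Q \<inter> A \<subseteq> submodular_elements G q" "Q \<inter> B \<subseteq> submodular_elements G q" using fact[OF q] by blast
      have sQ: "subgroup Q G" and cQ: "card Q = q ^ multiplicity q (order G)" using Q(1) by (auto simp: sylow_subgroup_def)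
      have QG: "Q \<subseteq> carrier G" using subgroup.subset[OF sQ] .
      have pp: "prime_power_card q P" "prime_power_card q Q" using cP cQ by (auto simp: prime_power_card_def)
      \<comment> \<open>Modulo the residual the image of \<open>Q\<close> is abelian, so here
        \<open>Q\<close> itself can be taken for the subgroup \<open>L\<close> of
        \<open>submodular_generation\<close>.\<close>
      have "sylow_subgroup q (?q ` Q) (G Mod ?R)"
        by (rule sylow_subgroup_image[OF h.group_hom_axioms fin _ Q(1)]) (simp add: carrier_FactGroup)
      then have "comm_group ((G Mod ?R)\<lparr>carrier := ?q ` Q\<rparr>)" using R(2) by (auto simp: class_A_def)
      then have ab: "?q u \<otimes>\<^bsub>G Mod ?R\<^esub> ?q v = ?q v \<otimes>\<^bsub>G Mod ?R\<^esub> ?q u" if "u \<in> Q" "v \<in> Q" for u v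
        using comm_monoid.m_comm[OF comm_group.axioms(1), of "(G Mod ?R)\<lparr>carrier := ?q ` Q\<rparr>" "?q u" "?q v"] that by simp
      have "submodular_generation G ?R q Q"
      proof (intro submodular_generation.intro fin_group_axioms submodular_generation_axioms.intro F q sQ pp(2))
        show "\<exists>P. sylow_subgroup p P G \<and> P \<subseteq> generate G (submodular_elements G p)" if "prime p" for p using tower[OF that] .
        show "Q \<subseteq> generate G (Q \<inter> submodular_elements G q \<union> Q \<inter> ?R)"
          by (rule genQ[OF Q(2)]) (use Q(3,4) in blast)+
        show "cj G u v \<otimes> inv v \<in> ?R" if uv: "u \<in> Q" "v \<in> Q" for u v
        proof -
          have c: "u \<in> carrier G" "v \<in> carrier G" using uv QG by auto
          have "?q (u \<otimes> v) = ?q (v \<otimes> u)" using ab[OF uv] h.hom_mult c by simp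
          then have "u \<otimes> v \<otimes> inv (v \<otimes> u) \<in> ?R" by (rule iffD1[OF rcoset_eq_iff[OF sR m_closed[OF c] m_closed[OF c(2,1)]]])
          then show ?thesis using c by (simp add: cj_def inv_mult_group m_assoc)
        qed
      qed
      then have smQ: "submodular_subgroup Q G" by (rule submodular_generation.submodular_L)
      obtain g where g: "g \<in> carrier G" "P \<subseteq> cj G g ` Q" by (rule sylow_contains[OF sP pp(1) Q(1)])
      have "P = cj G g ` Q" using subgroup_eqI[OF cj_subgroup[OF g(1) sQ] g(2)] cj_card[OF g(1) QG] cP cQ by simp
      then show ?thesis using submodular_conjugate[OF smQ g(1)] by simp
    qed
    then show ?thesis using assms(1,2) by (simp add: class_Z_def)
  qed
  show ?thesis using class_C class_Z by blast
qed

end
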